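(* Let $P\subset\mathbb{R}^2$ be a convex polygon with $k$ vertices and perimeter $p$. Let also the sequences $a=(a_0,a_1,\dots,a_n)$ and $b=(b_0,b_1,\dots,b_n)$ be given. Then the partial sums $$c_s=\sum_{\substack{i+j=s\\ (i,j)\in P\cap\mathbb{Z}^2}} a_i b_j$$ can be calculated in $\mathcal{O}\left(k+p(\log p)^2\log k\right)$ time.
   Context: $P$ denotes the filled polygon (the region bounded by the polygon), given by its vertices. The sums $c_s$ are to be computed for all integers $s$ for which the sum can be non-empty: if $x_l,x_u,y_l,y_u$ are the minimal and maximal $x$- and $y$-coordinates of the vertices, these are the integers $s$ with $x_l+y_l\le s\le x_u+y_u$. The entries $a_i$ and $b_j$ are read as $0$ outside the index range $\{0,\dots,n\}$. Arithmetic operations (on numbers with $\mathcal{O}(\log n)$ bits) take constant time. The acyclic convolution of two sequences of length $m$, i.e. the $2m-1$ sums $\sum_{i+j=s}a_ib_j$, can be computed in $\mathcal{O}(m\log m)$ operations. *)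

theory Defs
  imports "HOL-Analysis.Analysis" "HOL-Library.Landau_Symbols"
begin

section \<open>Convex polygons\<close>

text \<open>
  A polygon is given by the list of its vertices in the order in which they occur on the boundary
  (in either direction). Three pairwise distinct extreme points of a planar set are never
  collinear, so polygons have non-empty interior.
\<close>

definition next_vertex :: "(real \<times> real) list \<Rightarrow> nat \<Rightarrow> real \<times> real" where
  "next_vertex vs i = vs ! (Suc i mod length vs)"

definition filled_polygon :: "(real \<times> real) list \<Rightarrow> (real \<times> real) set" where
  "filled_polygon vs = convex hull (set vs)"

definition convex_polygon :: "(real \<times> real) list \<Rightarrow> bool" where
  "convex_polygon vs \<longleftrightarrow>
     3 \<le> length vs \<and> distinct vs \<and>
     set vs = {v. v extreme_point_of filled_polygon vs} \<and>
     (\<forall>i<length vs. closed_segment (vs ! i) (next_vertex vs i) edge_of filled_polygon vs)"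

definition perimeter :: "(real \<times> real) list \<Rightarrow> real" where
  "perimeter vs = (\<Sum>i<length vs. dist (vs ! i) (next_vertex vs i))"


section \<open>The partial sums\<close>

definition entry :: "nat \<Rightarrow> (nat \<Rightarrow> 'a::zero) \<Rightarrow> int \<Rightarrow> 'a" where
  "entry n a i = (if 0 \<le> i \<and> i \<le> int n then a (nat i) else 0)"

definition partial_sum ::
    "nat \<Rightarrow> (nat \<Rightarrow> 'a::comm_ring_1) \<Rightarrow> (nat \<Rightarrow> 'a) \<Rightarrow> (real \<times> real) set \<Rightarrow> int \<Rightarrow> 'a" where
  "partial_sum n a b P s =
     (\<Sum>(i, j) \<in> {(i, j). i + j = s \<and> (real_of_int i, real_of_int j) \<in> P}. entry n a i * entry n b j)"

definition sum_range :: "(real \<times> real) list \<Rightarrow> int set" where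
  "sum_range vs =
     {s. Min (fst ` set vs) + Min (snd ` set vs) \<le> real_of_int s \<and>
         real_of_int s \<le> Max (fst ` set vs) + Max (snd ` set vs)}"


section \<open>The machine model\<close>

text \<open>
  Algorithms are programs of a random access machine with three kinds of memory: integer words (for
  addresses and control flow), exact real numbers (for the coordinates of the vertices), and ring
  elements (for the entries of the sequences). Memory is organised in named arrays; a scalar
  variable is cell 0 of an array. Addresses are integer words, possibly negative.

  Three restrictions keep the unit-cost measure honest.
  \<^item> All values of integer expressions, including those of subexpressions and of rounded reals, have
    to be bounded in absolute value by the word bound \<open>B\<close>; otherwise execution is stuck.
  \<^item> Ring elements can only be copied, added, subtracted, multiplied and convolved. They influence
    neither the control flow nor the other two kinds of memory.
  \<^item> The initial contents of the memory outside the input are arbitrary.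
\<close>

type_synonym name = string

record 'a state =
  words :: "name \<times> int \<Rightarrow> int"
  reals :: "name \<times> int \<Rightarrow> real"
  elems :: "name \<times> int \<Rightarrow> 'a"

datatype iexp =
    IConst int
  | ILoad name iexp
  | IAdd iexp iexp
  | ISub iexp iexp
  | IMul iexp iexp
  | IDiv iexp iexp

datatype rexp =
    RLoad name iexp
  | ROfInt iexp
  | RAdd rexp rexp
  | RSub rexp rexp
  | RMul rexp rexp
  | RDiv rexp rexp

datatype eexp =
    EConst int
  | ELoad name iexp
  | EAdd eexp eexp
  | ESub eexp eexp
  | EMul eexp eexp

datatype bexp =
    ILess iexp iexp
  | RLess rexp rexp
  | BNot bexp
  | BAnd bexp bexp

datatype com =
    Skip
  | IStore name iexp iexp
  | IFloor name iexp rexp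
  | RStore name iexp rexp
  | EStore name iexp eexp
  | Conv name name name iexp
  | Seq com com
  | IfThen bexp com com
  | While bexp com

fun ival :: "iexp \<Rightarrow> 'a state \<Rightarrow> int" where
  "ival (IConst c) \<sigma> = c"
| "ival (ILoad x e) \<sigma> = words \<sigma> (x, ival e \<sigma>)"
| "ival (IAdd e f) \<sigma> = ival e \<sigma> + ival f \<sigma>"
| "ival (ISub e f) \<sigma> = ival e \<sigma> - ival f \<sigma>"
| "ival (IMul e f) \<sigma> = ival e \<sigma> * ival f \<sigma>"
| "ival (IDiv e f) \<sigma> = ival e \<sigma> div ival f \<sigma>"

fun rval :: "rexp \<Rightarrow> 'a state \<Rightarrow> real" where
  "rval (RLoad x e) \<sigma> = reals \<sigma> (x, ival e \<sigma>)"
| "rval (ROfInt e) \<sigma> = real_of_int (ival e \<sigma>)"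
| "rval (RAdd r q) \<sigma> = rval r \<sigma> + rval q \<sigma>"
| "rval (RSub r q) \<sigma> = rval r \<sigma> - rval q \<sigma>"
| "rval (RMul r q) \<sigma> = rval r \<sigma> * rval q \<sigma>"
| "rval (RDiv r q) \<sigma> = rval r \<sigma> / rval q \<sigma>"

fun elval :: "eexp \<Rightarrow> 'a::comm_ring_1 state \<Rightarrow> 'a" where
  "elval (EConst c) \<sigma> = of_int c"
| "elval (ELoad x e) \<sigma> = elems \<sigma> (x, ival e \<sigma>)"
| "elval (EAdd u v) \<sigma> = elval u \<sigma> + elval v \<sigma>"
| "elval (ESub u v) \<sigma> = elval u \<sigma> - elval v \<sigma>"
| "elval (EMul u v) \<sigma> = elval u \<sigma> * elval v \<sigma>"

fun bval :: "bexp \<Rightarrow> 'a state \<Rightarrow> bool" where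
  "bval (ILess e f) \<sigma> \<longleftrightarrow> ival e \<sigma> < ival f \<sigma>"
| "bval (RLess r q) \<sigma> \<longleftrightarrow> rval r \<sigma> < rval q \<sigma>"
| "bval (BNot b) \<sigma> \<longleftrightarrow> \<not> bval b \<sigma>"
| "bval (BAnd b c) \<sigma> \<longleftrightarrow> bval b \<sigma> \<and> bval c \<sigma>"

definition fits :: "real \<Rightarrow> int \<Rightarrow> bool" where
  "fits B i \<longleftrightarrow> \<bar>real_of_int i\<bar> \<le> B"

fun iok :: "real \<Rightarrow> iexp \<Rightarrow> 'a state \<Rightarrow> bool" where
  "iok B (IConst c) \<sigma> \<longleftrightarrow> fits B c"
| "iok B (ILoad x e) \<sigma> \<longleftrightarrow> iok B e \<sigma> \<and> fits B (ival (ILoad x e) \<sigma>)"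
| "iok B (IAdd e f) \<sigma> \<longleftrightarrow> iok B e \<sigma> \<and> iok B f \<sigma> \<and> fits B (ival (IAdd e f) \<sigma>)"
| "iok B (ISub e f) \<sigma> \<longleftrightarrow> iok B e \<sigma> \<and> iok B f \<sigma> \<and> fits B (ival (ISub e f) \<sigma>)"
| "iok B (IMul e f) \<sigma> \<longleftrightarrow> iok B e \<sigma> \<and> iok B f \<sigma> \<and> fits B (ival (IMul e f) \<sigma>)"
| "iok B (IDiv e f) \<sigma> \<longleftrightarrow> iok B e \<sigma> \<and> iok B f \<sigma> \<and> ival f \<sigma> \<noteq> 0 \<and> fits B (ival (IDiv e f) \<sigma>)"

fun rok :: "real \<Rightarrow> rexp \<Rightarrow> 'a state \<Rightarrow> bool" where
  "rok B (RLoad x e) \<sigma> \<longleftrightarrow> iok B e \<sigma>"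
| "rok B (ROfInt e) \<sigma> \<longleftrightarrow> iok B e \<sigma>"
| "rok B (RAdd r q) \<sigma> \<longleftrightarrow> rok B r \<sigma> \<and> rok B q \<sigma>"
| "rok B (RSub r q) \<sigma> \<longleftrightarrow> rok B r \<sigma> \<and> rok B q \<sigma>"
| "rok B (RMul r q) \<sigma> \<longleftrightarrow> rok B r \<sigma> \<and> rok B q \<sigma>"
| "rok B (RDiv r q) \<sigma> \<longleftrightarrow> rok B r \<sigma> \<and> rok B q \<sigma> \<and> rval q \<sigma> \<noteq> 0"

fun eok :: "real \<Rightarrow> eexp \<Rightarrow> 'a state \<Rightarrow> bool" where
  "eok B (EConst c) \<sigma> \<longleftrightarrow> fits B c"
| "eok B (ELoad x e) \<sigma> \<longleftrightarrow> iok B e \<sigma>"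
| "eok B (EAdd u v) \<sigma> \<longleftrightarrow> eok B u \<sigma> \<and> eok B v \<sigma>"
| "eok B (ESub u v) \<sigma> \<longleftrightarrow> eok B u \<sigma> \<and> eok B v \<sigma>"
| "eok B (EMul u v) \<sigma> \<longleftrightarrow> eok B u \<sigma> \<and> eok B v \<sigma>"

fun bok :: "real \<Rightarrow> bexp \<Rightarrow> 'a state \<Rightarrow> bool" where
  "bok B (ILess e f) \<sigma> \<longleftrightarrow> iok B e \<sigma> \<and> iok B f \<sigma>"
| "bok B (RLess r q) \<sigma> \<longleftrightarrow> rok B r \<sigma> \<and> rok B q \<sigma>"
| "bok B (BNot b) \<sigma> \<longleftrightarrow> bok B b \<sigma>"
| "bok B (BAnd b c) \<sigma> \<longleftrightarrow> bok B b \<sigma> \<and> bok B c \<sigma>"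

definition convolution :: "int \<Rightarrow> (int \<Rightarrow> 'a::comm_ring_1) \<Rightarrow> (int \<Rightarrow> 'a) \<Rightarrow> int \<Rightarrow> 'a" where
  "convolution m f g s = (\<Sum>(i, j) \<in> {(i, j) \<in> {0..<m} \<times> {0..<m}. i + j = s}. f i * g j)"

text \<open>
  \<open>exec B T c \<sigma> t \<tau>\<close>: with word bound \<open>B\<close>, program \<open>c\<close> started in state \<open>\<sigma>\<close> halts in state \<open>\<tau>\<close>
  after \<open>t\<close> time units. The expressions of a program have a fixed size, so a command other than
  \<open>Conv\<close> takes one unit. \<open>Conv z x y e\<close> is the subroutine for acyclic convolutions: it convolves
  the first \<open>m\<close> cells of the arrays \<open>x\<close> and \<open>y\<close>, where \<open>m\<close> is the value of \<open>e\<close>, and stores the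
  result in the first \<open>2 * m - 1\<close> cells of \<open>z\<close>. Its running time is \<open>T m\<close>.
\<close>

inductive exec ::
    "real \<Rightarrow> (nat \<Rightarrow> nat) \<Rightarrow> com \<Rightarrow> 'a::comm_ring_1 state \<Rightarrow> nat \<Rightarrow> 'a state \<Rightarrow> bool"
  for B :: real and T :: "nat \<Rightarrow> nat" where
  Skip: "exec B T Skip \<sigma> 1 \<sigma>"
| IStore: "iok B e \<sigma> \<Longrightarrow> iok B f \<sigma> \<Longrightarrow>
    exec B T (IStore x e f) \<sigma> 1 (\<sigma>\<lparr>words := (words \<sigma>)((x, ival e \<sigma>) := ival f \<sigma>)\<rparr>)"
| IFloor: "iok B e \<sigma> \<Longrightarrow> rok B r \<sigma> \<Longrightarrow> fits B \<lfloor>rval r \<sigma>\<rfloor> \<Longrightarrow>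
    exec B T (IFloor x e r) \<sigma> 1 (\<sigma>\<lparr>words := (words \<sigma>)((x, ival e \<sigma>) := \<lfloor>rval r \<sigma>\<rfloor>)\<rparr>)"
| RStore: "iok B e \<sigma> \<Longrightarrow> rok B r \<sigma> \<Longrightarrow>
    exec B T (RStore x e r) \<sigma> 1 (\<sigma>\<lparr>reals := (reals \<sigma>)((x, ival e \<sigma>) := rval r \<sigma>)\<rparr>)"
| EStore: "iok B e \<sigma> \<Longrightarrow> eok B u \<sigma> \<Longrightarrow>
    exec B T (EStore x e u) \<sigma> 1 (\<sigma>\<lparr>elems := (elems \<sigma>)((x, ival e \<sigma>) := elval u \<sigma>)\<rparr>)"
| Conv: "iok B e \<sigma> \<Longrightarrow> ival e \<sigma> = m \<Longrightarrow> 1 \<le> m \<Longrightarrow> fits B (2 * m) \<Longrightarrow>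
    exec B T (Conv z x y e) \<sigma> (1 + T (nat m))
      (\<sigma>\<lparr>elems := (\<lambda>(w, s).
          if w = z \<and> 0 \<le> s \<and> s < 2 * m - 1
          then convolution m (\<lambda>i. elems \<sigma> (x, i)) (\<lambda>j. elems \<sigma> (y, j)) s
          else elems \<sigma> (w, s))\<rparr>)"
| Seq: "exec B T c \<sigma> t \<rho> \<Longrightarrow> exec B T d \<rho> u \<tau> \<Longrightarrow> exec B T (Seq c d) \<sigma> (t + u) \<tau>"
| IfTrue: "bok B b \<sigma> \<Longrightarrow> bval b \<sigma> \<Longrightarrow> exec B T c \<sigma> t \<tau> \<Longrightarrow> exec B T (IfThen b c d) \<sigma> (1 + t) \<tau>"
| IfFalse: "bok B b \<sigma> \<Longrightarrow> \<not> bval b \<sigma> \<Longrightarrow> exec B T d \<sigma> t \<tau> \<Longrightarrow> exec B T (IfThen b c d) \<sigma> (1 + t) \<tau>"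
| WhileFalse: "bok B b \<sigma> \<Longrightarrow> \<not> bval b \<sigma> \<Longrightarrow> exec B T (While b c) \<sigma> 1 \<sigma>"
| WhileTrue: "bok B b \<sigma> \<Longrightarrow> bval b \<sigma> \<Longrightarrow> exec B T c \<sigma> t \<rho> \<Longrightarrow> exec B T (While b c) \<rho> u \<tau> \<Longrightarrow>
    exec B T (While b c) \<sigma> (1 + t + u) \<tau>"

lemma exec_deterministic:
  "exec B T c \<sigma> t \<tau> \<Longrightarrow> exec B T c \<sigma> t' \<tau>' \<Longrightarrow> t = t' \<and> \<tau> = \<tau>'"
proof (induction arbitrary: t' \<tau>' rule: exec.induct)
  case (Skip \<sigma>)
  then show ?case by cases simp
next
  case (IStore e \<sigma> f x)
  from IStore.prems show ?case by cases simp
next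
  case (IFloor e \<sigma> r x)
  from IFloor.prems show ?case by cases simp
next
  case (RStore e \<sigma> r x)
  from RStore.prems show ?case by cases simp
next
  case (EStore e \<sigma> u x)
  from EStore.prems show ?case by cases simp
next
  case (Conv e \<sigma> m z x y)
  from Conv.prems Conv.hyps(2) show ?case by cases simp
next
  case (Seq c \<sigma> t \<rho> d u \<tau>)
  from Seq.prems show ?case
  proof cases
    case (Seq t1 \<rho>1 u1)
    with Seq.IH(1)[of t1 \<rho>1] Seq.IH(2)[of u1 \<tau>'] show ?thesis by simp
  qed
next
  case (IfTrue b \<sigma> c t \<tau> d)
  from IfTrue.prems show ?case
  proof cases
    case (IfTrue t1)
    with IfTrue.IH[of t1 \<tau>'] show ?thesis by simp
  qed (use IfTrue.hyps in simp)
next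
  case (IfFalse b \<sigma> d t \<tau> c)
  from IfFalse.prems show ?case
  proof cases
    case (IfFalse t1)
    with IfFalse.IH[of t1 \<tau>'] show ?thesis by simp
  qed (use IfFalse.hyps in simp)
next
  case (WhileFalse b \<sigma> c)
  from WhileFalse.prems show ?case
    by cases (use WhileFalse.hyps in simp_all)
next
  case (WhileTrue b \<sigma> c t \<rho> u \<tau>)
  from WhileTrue.prems show ?case
  proof cases
    case (WhileTrue t1 \<rho>1 u1)
    with WhileTrue.IH(1)[of t1 \<rho>1] WhileTrue.IH(2)[of u1 \<tau>'] show ?thesis by simp
  qed (use WhileTrue.hyps in simp)
qed


section \<open>Input, output and word size\<close>

definition holds_input ::
    "nat \<Rightarrow> (nat \<Rightarrow> 'a) \<Rightarrow> (nat \<Rightarrow> 'a) \<Rightarrow> (real \<times> real) list \<Rightarrow> 'a state \<Rightarrow> bool" where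
  "holds_input n a b vs \<sigma> \<longleftrightarrow>
     words \<sigma> (''n'', 0) = int n \<and>
     words \<sigma> (''k'', 0) = int (length vs) \<and>
     (\<forall>i<length vs. reals \<sigma> (''x'', int i) = fst (vs ! i) \<and> reals \<sigma> (''y'', int i) = snd (vs ! i)) \<and>
     (\<forall>i\<le>n. elems \<sigma> (''a'', int i) = a i \<and> elems \<sigma> (''b'', int i) = b i)"

definition holds_output ::
    "nat \<Rightarrow> (nat \<Rightarrow> 'a::comm_ring_1) \<Rightarrow> (nat \<Rightarrow> 'a) \<Rightarrow> (real \<times> real) list \<Rightarrow> 'a state \<Rightarrow> bool" where
  "holds_output n a b vs \<tau> \<longleftrightarrow>
     (\<forall>s\<in>sum_range vs. elems \<tau> (''c'', s) = partial_sum n a b (filled_polygon vs) s)"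

text \<open>
  Words of \<open>O (log n)\<close> bits are integers bounded by a power of the numbers that any algorithm has to
  address: the lengths of the sequences and of the vertex list, and the size of the coordinates.
\<close>

definition magnitude :: "nat \<Rightarrow> (real \<times> real) list \<Rightarrow> real" where
  "magnitude n vs = 2 + real n + real (length vs) + Max (norm ` set vs)"

definition solves_within ::
    "nat \<Rightarrow> (nat \<Rightarrow> nat) \<Rightarrow> com \<Rightarrow> real \<Rightarrow> nat \<Rightarrow> (nat \<Rightarrow> 'a::comm_ring_1) \<Rightarrow> (nat \<Rightarrow> 'a) \<Rightarrow>
     (real \<times> real) list \<Rightarrow> bool" where
  "solves_within d T prog bound n a b vs \<longleftrightarrow>
     (\<forall>\<sigma>. holds_input n a b vs \<sigma> \<longrightarrow>
        (\<exists>t \<tau>. exec (magnitude n vs ^ d) T prog \<sigma> t \<tau> \<and> holds_output n a b vs \<tau> \<and> real t \<le> bound))"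

end

theory Submission
  imports Defs
begin

text \<open>
  In every column \<open>i\<close> the lattice points of the polygon form an interval \<open>lo i..hi i\<close>. Rasterising the
  edges computes all these intervals in time \<open>O(k + p)\<close>. Since \<open>lo\<close> is quasiconvex and \<open>hi\<close> is
  quasiconcave, their total variation is \<open>O(p)\<close>.

  Group the columns into blocks of \<open>m = 2\<^sup>h\<close> consecutive columns. The core of a block consists of the
  rows that are common to all its columns; it is a rectangle. When two neighbouring blocks are merged,
  the rows of either core that do not belong to the core of the union are split off and
  multiplied with the columns of the block, in pieces of length \<open>m\<close>, by convolutions. The number of
  rows that are split off on one level is bounded by the total variation, so each of the
  \<open>O(log p)\<close> levels takes time \<open>O(p log p)\<close>. Hence the algorithm runs in time \<open>O(k + p (log p)\<^sup>2)\<close>,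
  even without the factor \<open>log k\<close>.
\<close>

section \<open>Running time and correctness of programs\<close>

text \<open>Splitting off \<open>d\<close> rows from a block of \<open>m\<close> columns costs
  \<open>O((d + m) (1 + log m))\<close> rather than \<open>d * m\<close>, because each piece of
  \<open>m\<close> rows is a single convolution. On one level the \<open>d\<close> add up to at most
  the variation of the row bounds, and the \<open>m\<close> to a multiple of the number of columns;
  both are \<open>O(p + 1)\<close>. One logarithm is the number of levels, the other is the factor
  in \<open>T m / m\<close>. The lower and upper row bounds of a core are kept apart even when they
  have crossed and the core is empty. Rows can then be charged to the variations of
  \<open>lo\<close> and \<open>hi\<close> separately, without a case distinction in the cost.
  Correctness rests on a balance: \<open>c\<close> plus what the current cores still have to
  contribute is constant. Two obstacles lie outside this scheme. The definition of a polygon only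
  says that the listed segments are edges; that rasterising them misses no part of the lower or
  upper boundary needs a planar argument. And \<open>p (ln p)^2 ln k\<close> vanishes at
  \<open>p = 1\<close>, so for short perimeters the term \<open>k\<close>, which is at least 3, has
  to pay.\<close>

text \<open>
  The postcondition also receives what is left of the time budget \<open>t\<close>. This makes the rules for
  all commands except loops equivalences, which the simplifier can execute.
\<close>

definition wp :: "real \<Rightarrow> (nat \<Rightarrow> nat) \<Rightarrow> com \<Rightarrow> (real \<Rightarrow> 'a::comm_ring_1 state \<Rightarrow> bool) \<Rightarrow>
    real \<Rightarrow> 'a state \<Rightarrow> bool" where
  "wp B T c Q t \<sigma> \<longleftrightarrow> (\<exists>u \<tau>. exec B T c \<sigma> u \<tau> \<and> Q (t - real u) \<tau>)"

inductive_cases SkipE: "exec B T Skip \<sigma> t \<tau>"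
inductive_cases IStoreE: "exec B T (IStore x e f) \<sigma> t \<tau>"
inductive_cases IFloorE: "exec B T (IFloor x e r) \<sigma> t \<tau>"
inductive_cases RStoreE: "exec B T (RStore x e r) \<sigma> t \<tau>"
inductive_cases EStoreE: "exec B T (EStore x e u) \<sigma> t \<tau>"
inductive_cases ConvE: "exec B T (Conv z x y e) \<sigma> t \<tau>"
inductive_cases SeqE: "exec B T (Seq c d) \<sigma> t \<tau>"
inductive_cases IfThenE: "exec B T (IfThen b c d) \<sigma> t \<tau>"

lemma wp_Skip [simp]: "wp B T Skip Q t \<sigma> \<longleftrightarrow> Q (t - 1) \<sigma>"
  unfolding wp_def by (force intro: exec.Skip elim: SkipE)

lemma wp_IStore [simp]: "wp B T (IStore x e f) Q t \<sigma> \<longleftrightarrow>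
    iok B e \<sigma> \<and> iok B f \<sigma> \<and> Q (t - 1) (\<sigma>\<lparr>words := (words \<sigma>)((x, ival e \<sigma>) := ival f \<sigma>)\<rparr>)"
  unfolding wp_def by (force intro: exec.IStore elim: IStoreE)

lemma wp_IFloor [simp]: "wp B T (IFloor x e r) Q t \<sigma> \<longleftrightarrow>
    iok B e \<sigma> \<and> rok B r \<sigma> \<and> fits B \<lfloor>rval r \<sigma>\<rfloor> \<and>
    Q (t - 1) (\<sigma>\<lparr>words := (words \<sigma>)((x, ival e \<sigma>) := \<lfloor>rval r \<sigma>\<rfloor>)\<rparr>)"
  unfolding wp_def by (force intro: exec.IFloor elim: IFloorE)

lemma wp_RStore [simp]: "wp B T (RStore x e r) Q t \<sigma> \<longleftrightarrow>
    iok B e \<sigma> \<and> rok B r \<sigma> \<and> Q (t - 1) (\<sigma>\<lparr>reals := (reals \<sigma>)((x, ival e \<sigma>) := rval r \<sigma>)\<rparr>)"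
  unfolding wp_def by (force intro: exec.RStore elim: RStoreE)

lemma wp_EStore [simp]: "wp B T (EStore x e u) Q t \<sigma> \<longleftrightarrow>
    iok B e \<sigma> \<and> eok B u \<sigma> \<and> Q (t - 1) (\<sigma>\<lparr>elems := (elems \<sigma>)((x, ival e \<sigma>) := elval u \<sigma>)\<rparr>)"
  unfolding wp_def by (force intro: exec.EStore elim: EStoreE)

lemma wp_Conv [simp]: "wp B T (Conv z x y e) Q t \<sigma> \<longleftrightarrow>
    iok B e \<sigma> \<and> 1 \<le> ival e \<sigma> \<and> fits B (2 * ival e \<sigma>) \<and>
    Q (t - 1 - real (T (nat (ival e \<sigma>)))) (\<sigma>\<lparr>elems := (\<lambda>(w, s).
          if w = z \<and> 0 \<le> s \<and> s < 2 * ival e \<sigma> - 1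
          then convolution (ival e \<sigma>) (\<lambda>i. elems \<sigma> (x, i)) (\<lambda>j. elems \<sigma> (y, j)) s
          else elems \<sigma> (w, s))\<rparr>)" (is "?l = ?r")
proof
  assume ?l
  then show ?r unfolding wp_def by (elim exE conjE ConvE) (simp add: diff_diff_eq)
next
  assume r: ?r
  show ?l unfolding wp_def
    by (intro exI conjI, rule exec.Conv[OF _ refl]) (use r in \<open>simp_all add: diff_diff_eq\<close>)
qed

lemma wp_Seq [simp]: "wp B T (Seq c d) Q t \<sigma> \<longleftrightarrow> wp B T c (wp B T d Q) t \<sigma>" (is "?l = ?r")
proof
  assume ?l
  then show ?r unfolding wp_def
    by (elim exE conjE SeqE) (auto simp: diff_diff_eq)
next
  assume ?r
  then show ?l unfolding wp_def
    by (metis exec.Seq diff_diff_eq of_nat_add)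
qed

lemma wp_IfThen [simp]: "wp B T (IfThen b c d) Q t \<sigma> \<longleftrightarrow>
    bok B b \<sigma> \<and> (bval b \<sigma> \<longrightarrow> wp B T c Q (t - 1) \<sigma>) \<and>
      (\<not> bval b \<sigma> \<longrightarrow> wp B T d Q (t - 1) \<sigma>)" (is "?l = ?r")
proof
  assume ?l
  then show ?r unfolding wp_def
    by (elim exE conjE IfThenE) (auto simp: diff_diff_eq)
next
  assume ?r
  then show ?l unfolding wp_def
    using exec.IfTrue[of B b \<sigma> T c _ _ d] exec.IfFalse[of B b \<sigma> T d _ _ c]
    by (cases "bval b \<sigma>") (auto simp: diff_diff_eq, (metis of_nat_Suc plus_1_eq_Suc add.commute)+)
qed

section \<open>Syntactic frame conditions: which arrays a program can change\<close>

fun wmod :: "com \<Rightarrow> name set" where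
  "wmod (IStore x e f) = {x}"
| "wmod (IFloor x e r) = {x}"
| "wmod (Seq c d) = wmod c \<union> wmod d"
| "wmod (IfThen b c d) = wmod c \<union> wmod d"
| "wmod (While b c) = wmod c"
| "wmod c = {}"

fun rmod :: "com \<Rightarrow> name set" where
  "rmod (RStore x e r) = {x}"
| "rmod (Seq c d) = rmod c \<union> rmod d"
| "rmod (IfThen b c d) = rmod c \<union> rmod d"
| "rmod (While b c) = rmod c"
| "rmod c = {}"

fun emod :: "com \<Rightarrow> name set" where
  "emod (EStore x e u) = {x}"
| "emod (Conv z x y e) = {z}"
| "emod (Seq c d) = emod c \<union> emod d"
| "emod (IfThen b c d) = emod c \<union> emod d"
| "emod (While b c) = emod c"
| "emod c = {}"

definition frame :: "com \<Rightarrow> 'a state \<Rightarrow> 'a state \<Rightarrow> bool" where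
  "frame c \<sigma> \<tau> \<longleftrightarrow>
     (\<forall>x i. x \<notin> wmod c \<longrightarrow> words \<tau> (x, i) = words \<sigma> (x, i)) \<and>
     (\<forall>x i. x \<notin> rmod c \<longrightarrow> reals \<tau> (x, i) = reals \<sigma> (x, i)) \<and>
     (\<forall>x i. x \<notin> emod c \<longrightarrow> elems \<tau> (x, i) = elems \<sigma> (x, i))"

lemma frame_words: "frame c \<sigma> \<tau> \<Longrightarrow> x \<notin> wmod c \<Longrightarrow> words \<tau> (x, i) = words \<sigma> (x, i)"
  and frame_reals: "frame c \<sigma> \<tau> \<Longrightarrow> x \<notin> rmod c \<Longrightarrow> reals \<tau> (x, i) = reals \<sigma> (x, i)"
  and frame_elems: "frame c \<sigma> \<tau> \<Longrightarrow> x \<notin> emod c \<Longrightarrow> elems \<tau> (x, i) = elems \<sigma> (x, i)"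
  by (simp_all add: frame_def)

lemma exec_frame: "exec B T c \<sigma> t \<tau> \<Longrightarrow> frame c \<sigma> \<tau>"
  by (induction rule: exec.induct) (simp_all add: frame_def)

section \<open>Specifications with a time budget and counted loops\<close>

definition runs :: "real \<Rightarrow> (nat \<Rightarrow> nat) \<Rightarrow> com \<Rightarrow> 'a::comm_ring_1 state \<Rightarrow> real \<Rightarrow>
    ('a state \<Rightarrow> bool) \<Rightarrow> bool" where
  "runs B T c \<sigma> t Q \<longleftrightarrow> wp B T c (\<lambda>u \<tau>. 0 \<le> u \<and> Q \<tau>) t \<sigma>"

lemma runs_exec: "runs B T c \<sigma> t Q \<longleftrightarrow> (\<exists>u \<tau>. exec B T c \<sigma> u \<tau> \<and> real u \<le> t \<and> Q \<tau>)"
  by (simp add: runs_def wp_def)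

lemma wp_runs:
  assumes "runs B T c \<sigma> t Q"
    and "\<And>u \<tau>. Q \<tau> \<Longrightarrow> frame c \<sigma> \<tau> \<Longrightarrow> t' - t \<le> u \<Longrightarrow> R u \<tau>"
  shows "wp B T c R t' \<sigma>"
  using assms exec_frame unfolding runs_exec wp_def by (metis diff_left_mono)

lemma runs_weaken:
  assumes "runs B T c \<sigma> t Q" "t \<le> t'" "\<And>\<tau>. Q \<tau> \<Longrightarrow> frame c \<sigma> \<tau> \<Longrightarrow> R \<tau>"
  shows "runs B T c \<sigma> t' R"
  using assms exec_frame unfolding runs_exec by (meson order_trans)

text \<open>Every loop of the algorithm has an iteration count that is known on entry, so an
  invariant indexed by the number of finished iterations yields termination, correctness and time at
  once. The extra units are the \<open>N + 1\<close> evaluations of the test.\<close>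

lemma runs_for:
  assumes "I 0 \<sigma>"
    and step: "\<And>r \<tau>. r < N \<Longrightarrow> I r \<tau> \<Longrightarrow> frame c \<sigma> \<tau> \<Longrightarrow>
      bok B b \<tau> \<and> bval b \<tau> \<and> runs B T c \<tau> (t r) (I (Suc r))"
    and stop: "\<And>\<tau>. I N \<tau> \<Longrightarrow> frame c \<sigma> \<tau> \<Longrightarrow> bok B b \<tau> \<and> \<not> bval b \<tau>"
  shows "runs B T (While b c) \<sigma> (1 + (\<Sum>r<N. 1 + t r)) (I N)"
proof -
  \<comment> \<open>Induction on the number \<open>d\<close> of iterations still to come.\<close>
  have "\<exists>u \<tau>. exec B T (While b c) \<rho> u \<tau> \<and> real u \<le> 1 + (\<Sum>r\<in>{N-d..<N}. 1 + t r) \<and> I N \<tau>"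
    if "d \<le> N" "I (N - d) \<rho>" "frame c \<sigma> \<rho>" for d \<rho>
    using that
  proof (induction d arbitrary: \<rho>)
    case 0
    then show ?case using stop[of \<rho>] exec.WhileFalse by (intro exI[of _ 1] exI[of _ \<rho>]) auto
  next
    case (Suc d)
    let ?r = "N - Suc d"
    have r: "?r < N" "Suc ?r = N - d" using Suc.prems by auto
    from step[OF r(1) Suc.prems(2,3)] obtain u1 \<rho>1 where
      1: "bok B b \<rho>" "bval b \<rho>" "exec B T c \<rho> u1 \<rho>1" "real u1 \<le> t ?r" "I (N - d) \<rho>1"
      unfolding runs_exec r(2) by blast
    have "frame c \<sigma> \<rho>1" using exec_frame[OF 1(3)] Suc.prems(3) by (simp add: frame_def)
    from Suc.IH[OF _ 1(5) this] Suc.prems obtain u2 \<tau> where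
      2: "exec B T (While b c) \<rho>1 u2 \<tau>" "real u2 \<le> 1 + (\<Sum>r\<in>{N-d..<N}. 1 + t r)" "I N \<tau>" by auto
    have "(\<Sum>r\<in>{?r..<N}. 1 + t r) = 1 + t ?r + (\<Sum>r\<in>{N-d..<N}. 1 + t r)"
      using r by (simp add: sum.atLeast_Suc_lessThan)
    with exec.WhileTrue[OF 1(1-3) 2(1)] 1(4) 2(2,3) show ?case
      by (intro exI[of _ "1 + u1 + u2"] exI[of _ \<tau>]) simp
  qed
  from this[of N \<sigma>] assms(1) show ?thesis
    by (simp add: runs_exec frame_def lessThan_atLeast0)
qed

section \<open>Convolving the columns with a rectangle of rows\<close>

abbreviation ivar :: "name \<Rightarrow> iexp" where "ivar x \<equiv> ILoad x (IConst 0)"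
abbreviation assign :: "name \<Rightarrow> iexp \<Rightarrow> com" where "assign x e \<equiv> IStore x (IConst 0) e"
abbreviation incr :: "name \<Rightarrow> com" where "incr x \<equiv> assign x (IAdd (ivar x) (IConst 1))"
abbreviation ile :: "iexp \<Rightarrow> iexp \<Rightarrow> bexp" where "ile e f \<equiv> BNot (ILess f e)"

text \<open>
  Register \<open>p\<close> holds the first column of a block, \<open>m\<close> its length, and \<open>j\<close> and \<open>g\<close> the first and last row of
  the rectangle. Cells without an entry, beyond the last column \<open>i1\<close> or above the row \<open>g\<close> are loaded as zero, so
  pieces of length \<open>m\<close> may overlap the boundary.
\<close>

definition load_com :: com where
  "load_com = While (ILess (ivar ''t'') (ivar ''m''))
    (Seq (IfThen (BAnd (ile (IAdd (ivar ''p'') (ivar ''t'')) (ivar ''i1''))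
                 (BAnd (ile (IConst 0) (IAdd (ivar ''p'') (ivar ''t'')))
                       (ile (IAdd (ivar ''p'') (ivar ''t'')) (ivar ''n''))))
           (EStore ''X'' (ivar ''t'') (ELoad ''a'' (IAdd (ivar ''p'') (ivar ''t''))))
           (EStore ''X'' (ivar ''t'') (EConst 0)))
    (Seq (IfThen (BAnd (ile (IAdd (ivar ''j'') (ivar ''t'')) (ivar ''g''))
                 (BAnd (ile (IConst 0) (IAdd (ivar ''j'') (ivar ''t'')))
                       (ile (IAdd (ivar ''j'') (ivar ''t'')) (ivar ''n''))))
           (EStore ''Y'' (ivar ''t'') (ELoad ''b'' (IAdd (ivar ''j'') (ivar ''t''))))
           (EStore ''Y'' (ivar ''t'') (EConst 0)))
      (incr ''t'')))"

definition add_com :: com where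
  "add_com = While (ILess (ivar ''t'') (ISub (IAdd (ivar ''m'') (ivar ''m'')) (IConst 1)))
    (Seq (EStore ''c'' (IAdd (IAdd (ivar ''p'') (ivar ''j'')) (ivar ''t''))
           (EAdd (ELoad ''c'' (IAdd (IAdd (ivar ''p'') (ivar ''j'')) (ivar ''t''))) (ELoad ''Z'' (ivar ''t''))))
      (incr ''t''))"

definition block_com :: com where
  "block_com = Seq (assign ''t'' (IConst 0)) (Seq load_com (Seq (Conv ''Z'' ''X'' ''Y'' (ivar ''m''))
     (Seq (assign ''t'' (IConst 0)) (Seq add_com (assign ''j'' (IAdd (ivar ''j'') (ivar ''m'')))))))"

definition rect_com :: com where
  "rect_com = While (ile (ivar ''j'') (ivar ''g'')) block_com"

lemma load_mod [simp]: "wmod load_com = {''t''}" "rmod load_com = {}" "emod load_com = {''X'', ''Y''}"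
  by (auto simp: load_com_def)

lemma add_mod [simp]: "wmod add_com = {''t''}" "rmod add_com = {}" "emod add_com = {''c''}"
  by (auto simp: add_com_def)

lemma block_mod [simp]: "wmod block_com = {''t'', ''j''}" "rmod block_com = {}"
    "emod block_com = {''X'', ''Y'', ''Z'', ''c''}"
  by (auto simp: block_com_def)

lemma rect_mod [simp]: "wmod rect_com = {''t'', ''j''}" "rmod rect_com = {}"
    "emod rect_com = {''X'', ''Y'', ''Z'', ''c''}"
  by (simp_all add: rect_com_def)

text \<open>Solving for the second index leaves one sum over columns, the shape in which
  \<open>col\<close> describes a rectangle.\<close>

lemma convolution_eq:
  "convolution m f g s = (\<Sum>i\<in>{0..<m}. f i * (if 0 \<le> s - i \<and> s - i < m then g (s - i) else 0))"
proof -
  have "{(i, j) \<in> {0..<m} \<times> {0..<m}. i + j = s} =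
      (\<lambda>i. (i, s - i)) ` {i\<in>{0..<m}. 0 \<le> s - i \<and> s - i < m}" by force
  then have "convolution m f g s = (\<Sum>i\<in>{i\<in>{0..<m}. 0 \<le> s - i \<and> s - i < m}. f i * g (s - i))"
    by (simp add: convolution_def sum.reindex inj_on_def del: mem_Sigma_iff)
  also have "\<dots> = (\<Sum>i\<in>{0..<m}. if 0 \<le> s - i \<and> s - i < m then f i * g (s - i) else 0)"
    by (rule sum.inter_filter) simp
  also have "\<dots> = (\<Sum>i\<in>{0..<m}. f i * (if 0 \<le> s - i \<and> s - i < m then g (s - i) else 0))"
    by (rule sum.cong) auto
  finally show ?thesis .
qed

text \<open>\<open>N\<close> is a common scale for coordinates and lengths. The factor 16 leaves
  room for sums such as the address \<open>p + j + t\<close> in \<open>c\<close>.\<close>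

locale sequences =
  fixes B :: real and T :: "nat \<Rightarrow> nat" and N :: int and n :: nat and a b :: "nat \<Rightarrow> 'a::comm_ring_1"
    and i1 :: int
  assumes B: "of_int (16 * N) \<le> B" and N: "2 \<le> N" "int n \<le> N" "- N \<le> i1" "i1 \<le> N"
begin

lemma fits_N: "- 16 * N \<le> i \<Longrightarrow> i \<le> 16 * N \<Longrightarrow> fits B i"
  using B unfolding fits_def by linarith

text \<open>The share of column \<open>i\<close>, restricted to the rows \<open>l..u\<close>, in the
  sum with index \<open>z\<close>. The test against \<open>i1\<close> makes it harmless that the
  last block overhangs the last column.\<close>

definition col :: "int \<Rightarrow> int \<Rightarrow> int \<Rightarrow> int \<Rightarrow> 'a" where
  "col i l u z = (if i \<le> i1 \<and> l \<le> z - i \<and> z - i \<le> u then entry n a i * entry n b (z - i) else 0)"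

lemma col_empty: "u < l \<Longrightarrow> col i l u z = 0"
  unfolding col_def by (rule if_not_P) linarith

lemma col_append: "l \<le> u' + 1 \<Longrightarrow> u' \<le> u \<Longrightarrow> col i l u' z + col i (u' + 1) u z = col i l u z"
  by (auto simp: col_def)

definition ready :: "'a state \<Rightarrow> bool" where
  "ready \<sigma> \<longleftrightarrow> words \<sigma> (''n'', 0) = int n \<and> words \<sigma> (''i1'', 0) = i1 \<and>
    (\<forall>i\<in>{0..int n}. elems \<sigma> (''a'', i) = entry n a i \<and> elems \<sigma> (''b'', i) = entry n b i)"

lemma run_load:
  assumes "ready \<sigma>" "words \<sigma> (''t'', 0) = 0" "words \<sigma> (''m'', 0) = m" "words \<sigma> (''p'', 0) = p"
    "words \<sigma> (''j'', 0) = j" "words \<sigma> (''g'', 0) = g"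
    and bnd: "1 \<le> m" "m \<le> 2 * N" "- 2 * N \<le> p" "p \<le> 2 * N" "- 4 * N \<le> j" "j \<le> 4 * N" "- 2 * N \<le> g" "g \<le> 2 * N"
  shows "runs B T load_com \<sigma> (1 + 6 * of_int m) (\<lambda>\<tau>. \<forall>i\<in>{0..<m}.
     elems \<tau> (''X'', i) = (if p + i \<le> i1 then entry n a (p + i) else 0) \<and>
     elems \<tau> (''Y'', i) = (if j + i \<le> g then entry n b (j + i) else 0))"
proof -
  let ?I = "\<lambda>r \<tau>. words \<tau> (''t'', 0) = int r \<and> (\<forall>i\<in>{0..<int r}.
     elems \<tau> (''X'', i) = (if p + i \<le> i1 then entry n a (p + i) else 0) \<and>
     elems \<tau> (''Y'', i) = (if j + i \<le> g then entry n b (j + i) else 0))"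
  have "runs B T load_com \<sigma> (1 + (\<Sum>r<nat m. 1 + 5)) (?I (nat m))"
    unfolding load_com_def
  proof (rule runs_for, goal_cases)
    case 1
    then show ?case using assms by simp
  next
    case (2 r \<tau>)
    note fr = 2(3)[folded load_com_def]
    note [simp] = frame_words[OF fr] frame_elems[OF fr]
    have [simp]: "words \<tau> (''t'', 0) = int r" using 2 by simp
    have [simp]: "words \<sigma> (''n'', 0) = int n" "words \<sigma> (''i1'', 0) = i1" using assms by (simp_all add: ready_def)
    have [simp]: "elems \<sigma> (''a'', i) = entry n a i" "elems \<sigma> (''b'', i) = entry n b i" if "0 \<le> i" "i \<le> int n" for i
      using assms(1) that by (simp_all add: ready_def)
    have r: "int r < m" using 2(1) by linarith
    have old: "elems \<tau> (''X'', i) = (if p + i \<le> i1 then entry n a (p + i) else 0)"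
       "elems \<tau> (''Y'', i) = (if j + i \<le> g then entry n b (j + i) else 0)" if "0 \<le> i" "i < int r" for i
      using 2(2) that by simp_all
    have *: "(\<forall>i\<in>{0..<int (Suc r)}. P i) \<longleftrightarrow> P (int r) \<and> (\<forall>i. 0 \<le> i \<longrightarrow> i < int r \<longrightarrow> P i)" for P
      by (auto simp: less_le)
    have [simp]: "fits B 0" "fits B 1" "fits B (int r)" "fits B (int r + 1)" "fits B m" "fits B p" "fits B j" "fits B g"
      "fits B i1" "fits B (int n)" "fits B (p + int r)" "fits B (j + int r)"
      using bnd N r by (intro fits_N; linarith)+
    show ?case unfolding * using r
      by (simp add: runs_def assms old entry_def)
  next
    case (3 \<tau>)
    note fr = 3(2)[folded load_com_def]
    have [simp]: "fits B 0" "fits B m" using bnd N by (intro fits_N; linarith)+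
    show ?case using 3(1) bnd(1) by (simp add: frame_words[OF fr] assms)
  qed
  then show ?thesis
    by (rule runs_weaken) (use bnd in auto)
qed

lemma run_add:
  assumes "words \<sigma> (''t'', 0) = 0" "words \<sigma> (''m'', 0) = m" "words \<sigma> (''p'', 0) = p" "words \<sigma> (''j'', 0) = j"
    and bnd: "1 \<le> m" "m \<le> 2 * N" "- 2 * N \<le> p" "p \<le> 2 * N" "- 4 * N \<le> j" "j \<le> 4 * N"
  shows "runs B T add_com \<sigma> (6 * of_int m) (\<lambda>\<tau>. \<forall>z. elems \<tau> (''c'', z) = elems \<sigma> (''c'', z) +
     (if 0 \<le> z - p - j \<and> z - p - j < 2 * m - 1 then elems \<sigma> (''Z'', z - p - j) else 0))"
proof -
  let ?I = "\<lambda>r \<tau>. words \<tau> (''t'', 0) = int r \<and> (\<forall>z. elems \<tau> (''c'', z) = elems \<sigma> (''c'', z) +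
     (if 0 \<le> z - p - j \<and> z - p - j < int r then elems \<sigma> (''Z'', z - p - j) else 0))"
  have "runs B T add_com \<sigma> (1 + (\<Sum>r<nat (2 * m - 1). 1 + 2)) (?I (nat (2 * m - 1)))"
    unfolding add_com_def
  proof (rule runs_for, goal_cases)
    case 1
    then show ?case using assms(1) by auto
  next
    case (2 r \<tau>)
    note fr = 2(3)[folded add_com_def]
    note [simp] = frame_words[OF fr] frame_elems[OF fr]
    have [simp]: "words \<tau> (''t'', 0) = int r" using 2 by simp
    have r: "int r < 2 * m - 1" using 2(1) by linarith
    have [simp]: "fits B 0" "fits B 1" "fits B (int r)" "fits B (int r + 1)" "fits B m" "fits B p" "fits B j"
      "fits B (m + m)" "fits B (m + m - 1)" "fits B (2 * m)" "fits B (2 * m - 1)" "fits B (p + j)" "fits B (p + j + int r)"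
      using bnd N r by (intro fits_N; linarith)+
    show ?case using r 2(2)
      by (auto simp: runs_def assms)
  next
    case (3 \<tau>)
    note fr = 3(2)[folded add_com_def]
    have [simp]: "fits B 0" "fits B 1" "fits B m" "fits B (2 * m)" "fits B (2 * m - 1)"
      using bnd N by (intro fits_N; linarith)+
    show ?case using 3(1) bnd(1) by (simp add: frame_words[OF fr] assms)
  qed
  then show ?thesis
    by (rule runs_weaken) (use bnd in auto)
qed

text \<open>Cell \<open>i\<close> of \<open>X\<close> is column \<open>p + i\<close> and cell
  \<open>i\<close> of \<open>Y\<close> is row \<open>j + i\<close>, so index
  \<open>z - p - j\<close> collects the antidiagonal \<open>z\<close>. The length of the piece cuts
  the rows at \<open>j + m - 1\<close>, the zeros loaded into \<open>Y\<close> cut them at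
  \<open>g\<close>.\<close>

lemma conv_col:
  "convolution m (\<lambda>i. if p + i \<le> i1 then entry n a (p + i) else 0)
      (\<lambda>i. if j + i \<le> g then entry n b (j + i) else 0) (z - p - j) =
   (\<Sum>i\<in>{p..<p + m}. col i j (min g (j + m - 1)) z)"
  unfolding convolution_eq
  by (rule sum.reindex_bij_witness[of _ "\<lambda>i. i - p" "\<lambda>i. p + i"]) (auto simp: col_def algebra_simps)

lemma convolution_cong:
  assumes "\<And>i. i \<in> {0..<m} \<Longrightarrow> f i = f' i \<and> g i = g' i"
  shows "convolution m f g z = convolution m f' g' z"
  unfolding convolution_def by (rule sum.cong) (use assms in auto)

lemma run_block:
  assumes "ready \<sigma>" "words \<sigma> (''m'', 0) = m" "words \<sigma> (''p'', 0) = p"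
    "words \<sigma> (''j'', 0) = j" "words \<sigma> (''g'', 0) = g"
    and bnd: "1 \<le> m" "m \<le> 2 * N" "- 2 * N \<le> p" "p \<le> 2 * N" "- 4 * N \<le> j" "j \<le> 4 * N" "- 2 * N \<le> g" "g \<le> 2 * N"
  shows "runs B T block_com \<sigma> (5 + 12 * real_of_int m + real (T (nat m))) (\<lambda>\<tau>. words \<tau> (''j'', 0) = j + m \<and>
     (\<forall>z. elems \<tau> (''c'', z) = elems \<sigma> (''c'', z) + (\<Sum>i\<in>{p..<p + m}. col i j (min g (j + m - 1)) z)))"
proof -
  have [simp]: "fits B 0" "fits B m" "fits B j" "fits B (j + m)" "fits B (2 * m)"
    using bnd N by (intro fits_N; linarith)+
  \<comment> \<open>Only \<open>2 * m - 1\<close> antidiagonals meet an \<open>m\<close> by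
    \<open>m\<close> square. For every other \<open>z\<close> the claimed increment is zero, so the
    postcondition can speak of all \<open>z\<close>.\<close>
  have sum: "(\<Sum>i\<in>{p..<p + m}. col i j (min g (j + m - 1)) z) = 0"
    if "j \<le> z - p \<longrightarrow> \<not> z - p - j < 2 * m - 1" for z
    using that by (auto intro!: sum.neutral simp: col_def)
  show ?thesis
    unfolding runs_def block_com_def
    apply (simp add: assms)
    apply (rule wp_runs, rule run_load[where m = m and p = p and j = j and g = g])
    using assms apply (simp_all add: ready_def)[14]
    subgoal premises load for u \<tau>
    proof -
      note fr = load(2)
      note [simp] = frame_words[OF fr] frame_elems[OF fr]
      have conv: "convolution m (\<lambda>i. elems \<tau> (''X'', i)) (\<lambda>i. elems \<tau> (''Y'', i)) (z - p - j) =
          (\<Sum>i\<in>{p..<p + m}. col i j (min g (j + m - 1)) z)" for z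
        unfolding conv_col[symmetric] by (rule convolution_cong) (use load(1) in auto)
      show ?thesis
        apply (simp add: assms)
        apply (rule wp_runs, rule run_add[where m = m and p = p and j = j])
        using bnd apply (simp_all add: assms)[10]
        subgoal premises add for v \<rho>
        proof -
          note fr' = add(2)
          note [simp] = frame_words[OF fr'] frame_elems[OF fr']
          show ?thesis
            using add(1) add(3) load(3) bnd(1) sum
            by (simp add: assms conv)
        qed
        done
    qed
    done
qed

text \<open>The number of rows divided by \<open>m\<close>, rounded up; \<open>nat\<close> sends the
  nonpositive quotient of an empty interval to zero.\<close>

definition rect_blocks :: "int \<Rightarrow> int \<Rightarrow> int \<Rightarrow> nat" where
  "rect_blocks m j g = nat ((g - j + m) div m)"

lemma run_rect:
  assumes "ready \<sigma>" "words \<sigma> (''m'', 0) = m" "words \<sigma> (''p'', 0) = p"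
    "words \<sigma> (''j'', 0) = j" "words \<sigma> (''g'', 0) = g"
    and bnd: "1 \<le> m" "m \<le> 2 * N" "- 2 * N \<le> p" "p \<le> 2 * N" "- 2 * N \<le> j" "j \<le> 2 * N" "- 2 * N \<le> g" "g \<le> 2 * N"
  shows "runs B T rect_com \<sigma> (1 + real (rect_blocks m j g) * (6 + 12 * real_of_int m + real (T (nat m))))
     (\<lambda>\<tau>. \<forall>z. elems \<tau> (''c'', z) = elems \<sigma> (''c'', z) + (\<Sum>i\<in>{p..<p + m}. col i j g z))"
proof -
  let ?N = "rect_blocks m j g"
  let ?I = "\<lambda>r \<tau>. words \<tau> (''j'', 0) = j + m * int r \<and> (\<forall>z. elems \<tau> (''c'', z) = elems \<sigma> (''c'', z) +
     (\<Sum>i\<in>{p..<p + m}. col i j (min g (j + m * int r - 1)) z))"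
  have less: "j + m * int r \<le> g" if "r < ?N" for r
  proof -
    have "int r + 1 \<le> (g - j + m) div m" using that by (simp add: rect_blocks_def)
    with bnd(1) have "m * (int r + 1) \<le> m * ((g - j + m) div m)" by (simp add: mult_left_mono)
    also have "\<dots> \<le> g - j + m"
      using bnd(1) minus_mod_eq_mult_div[of "g - j + m" m] pos_mod_sign[of m "g - j + m"] by linarith
    finally have "m * (int r + 1) \<le> g - j + m" .
    then show ?thesis by (simp add: algebra_simps)
  qed
  have last: "g < j + m * int ?N"
  proof (cases "0 \<le> g - j + m")
    case True
    with bnd(1) have "0 \<le> (g - j + m) div m" by (metis pos_imp_zdiv_nonneg_iff zero_less_one order_less_le_trans)
    then have "int ?N = (g - j + m) div m" by (simp add: rect_blocks_def)
    then show ?thesis using bnd(1) by (smt (verit) minus_mod_eq_mult_div pos_mod_bound)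
  next
    case False
    with bnd(1) have "(g - j + m) div m < 0" by (metis pos_imp_zdiv_neg_iff zero_less_one order_less_le_trans not_le)
    then have "?N = 0" unfolding rect_blocks_def by linarith
    then show ?thesis using False bnd(1) by simp
  qed
  have "runs B T rect_com \<sigma> (1 + (\<Sum>r<?N. 1 + (5 + 12 * real_of_int m + real (T (nat m))))) (?I ?N)"
    unfolding rect_com_def
  proof (rule runs_for, goal_cases)
    case 1
    then show ?case using assms by (simp add: col_empty sum.neutral)
  next
    case (2 r \<tau>)
    note fr = 2(3)[folded rect_com_def]
    note [simp] = frame_words[OF fr] frame_elems[OF fr]
    note le = less[OF 2(1)]
    have ge: "j \<le> j + m * int r" using bnd(1) by simp
    have [simp]: "fits B 0" "fits B g" "fits B (j + m * int r)"
      using bnd N le ge by (intro fits_N; linarith)+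
    have eq: "col i j (min g (j + m * int r - 1)) z + col i (j + m * int r) (min g (j + m * int r + m - 1)) z =
        col i j (min g (j + m * int (Suc r) - 1)) z" for i z
      using le ge bnd(1) col_append[of j "j + m * int r - 1" "min g (j + m * int r + m - 1)" i z]
      by (simp add: algebra_simps min_absorb2)
    have jb: "- 4 * N \<le> j + m * int r" "j + m * int r \<le> 4 * N" using bnd N le ge by linarith+
    have sumeq: "(\<Sum>i\<in>{p..<p + m}. col i j (min g (j + m * int r - 1)) z) +
        (\<Sum>i\<in>{p..<p + m}. col i (j + m * int r) (min g (j + m * int r + m - 1)) z) =
        (\<Sum>i\<in>{p..<p + m}. col i j (min g (j + m * int (Suc r) - 1)) z)" for z
      unfolding sum.distrib[symmetric] by (rule sum.cong) (auto simp only: eq)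
    have "runs B T block_com \<tau> (5 + 12 * real_of_int m + real (T (nat m))) (\<lambda>\<rho>. words \<rho> (''j'', 0) = j + m * int r + m \<and>
        (\<forall>z. elems \<rho> (''c'', z) = elems \<tau> (''c'', z) +
          (\<Sum>i\<in>{p..<p + m}. col i (j + m * int r) (min g (j + m * int r + m - 1)) z)))"
      by (rule run_block[OF _ _ _ _ _ bnd(1-4) jb bnd(7,8)]) (use 2(2) assms in \<open>simp_all add: ready_def\<close>)
    then have "runs B T block_com \<tau> (5 + 12 * real_of_int m + real (T (nat m))) (?I (Suc r))"
      by (rule runs_weaken) (use 2(2) in \<open>simp_all add: sumeq[symmetric] add.assoc distrib_left del: of_nat_Suc\<close>, simp add: distrib_left)
    then show ?case using 2(2) le by (simp add: assms)
  next
    case (3 \<tau>)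
    note fr = 3(2)[folded rect_com_def]
    note [simp] = frame_words[OF fr] frame_elems[OF fr]
    have [simp]: "fits B 0" "fits B g" using bnd N by (intro fits_N; linarith)+
    \<comment> \<open>The last piece starts at or below \<open>g\<close>, so \<open>j\<close>
      overshoots \<open>g\<close> by at most \<open>m\<close> and still fits into a word.\<close>
    have "j + m * int ?N \<le> max j (g + m)"
    proof (cases ?N)
      case (Suc r)
      then show ?thesis using less[of r] by (simp add: algebra_simps)
    qed simp
    then have [simp]: "fits B (j + m * int ?N)" using bnd N last by (intro fits_N; linarith)
    show ?case using 3(1) last by (simp add: assms)
  qed
  then show ?thesis
    by (rule runs_weaken) (use last in \<open>auto simp: algebra_simps min_absorb1\<close>)
qed

end

section \<open>Cores of blocks of columns\<close>

lemma abs_diff_le_variation: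
  fixes f :: "int \<Rightarrow> int"
  assumes "u \<le> x" "x \<le> y" "y \<le> v"
  shows "\<bar>f x - f y\<bar> \<le> (\<Sum>i\<in>{u..<v}. \<bar>f (i + 1) - f i\<bar>)"
proof -
  have "\<bar>f x - f y\<bar> \<le> (\<Sum>i\<in>{x..<y}. \<bar>f (i + 1) - f i\<bar>)" using assms(2)
  proof (induction y rule: int_ge_induct)
    case (step y)
    have "{x..<y + 1} = insert y {x..<y}" using step.hyps by auto
    then show ?case using step.IH by simp
  qed simp
  also have "\<dots> \<le> (\<Sum>i\<in>{u..<v}. \<bar>f (i + 1) - f i\<bar>)"
    using assms by (intro sum_mono2) auto
  finally show ?thesis .
qed

text \<open>\<open>\<kappa>\<close> bounds the time of a convolution per cell, uniformly for all
  block lengths. These may reach twice the number of columns, since the final block is a power of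
  two that can overhang. Columns with \<open>hi i < lo i\<close> are allowed and contain no lattice
  point.\<close>

locale columns = sequences +
  fixes i0 :: int and lo hi :: "int \<Rightarrow> int" and \<kappa> :: real
  assumes i01: "i0 \<le> i1" "i1 - i0 < N" "- N \<le> i0"
    and lo: "\<And>i. i \<in> {i0..i1} \<Longrightarrow> - N \<le> lo i \<and> lo i \<le> N"
    and hi: "\<And>i. i \<in> {i0..i1} \<Longrightarrow> - N \<le> hi i \<and> hi i \<le> N"
    and \<kappa>: "\<And>m. 1 \<le> m \<Longrightarrow> int m \<le> 2 * (i1 - i0 + 1) \<Longrightarrow> real (T m) \<le> \<kappa> * real m"
begin

text \<open>\<open>LM\<close> and \<open>UM\<close> bound the rows common to all columns of the
  block that starts at \<open>s\<close>. They may cross, and then the core is empty.\<close>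

definition LM :: "int \<Rightarrow> int \<Rightarrow> int" where "LM m s = Max (lo ` {s..min (s + m - 1) i1})"
definition UM :: "int \<Rightarrow> int \<Rightarrow> int" where "UM m s = Min (hi ` {s..min (s + m - 1) i1})"

definition block :: "int \<Rightarrow> int \<Rightarrow> int" where "block m i = i0 + m * ((i - i0) div m)"

definition core :: "int \<Rightarrow> int \<Rightarrow> int \<Rightarrow> 'a" where
  "core m i z = col i (LM m (block m i)) (UM m (block m i)) z"

text \<open>
  What is still to be added to the sums when the cores of length \<open>m\<close> have been replaced by those of
  length \<open>2 * m\<close> to the left of \<open>x\<close>.
\<close>

definition remaining :: "int \<Rightarrow> int \<Rightarrow> int \<Rightarrow> 'a" where
  "remaining m x z = (\<Sum>i\<in>{i0..i1}. core (if i < x then 2 * m else m) i z)"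

definition variation :: "(int \<Rightarrow> int) \<Rightarrow> int" where
  "variation f = (\<Sum>i\<in>{i0..<i1}. \<bar>f (i + 1) - f i\<bar>)"

lemma block_eq: "1 \<le> m \<Longrightarrow> i0 + m * q \<le> i \<Longrightarrow> i < i0 + m * q + m \<Longrightarrow> block m i = i0 + m * q"
  unfolding block_def by (simp add: int_div_pos_eq[of "i - i0" m q "i - i0 - m * q"])

lemma LM_in: "s \<le> i1 \<Longrightarrow> 1 \<le> m \<Longrightarrow> \<exists>i\<in>{s..min (s + m - 1) i1}. LM m s = lo i"
  unfolding LM_def using Max_in[of "lo ` {s..min (s + m - 1) i1}"] by (simp add: image_iff)

lemma UM_in: "s \<le> i1 \<Longrightarrow> 1 \<le> m \<Longrightarrow> \<exists>i\<in>{s..min (s + m - 1) i1}. UM m s = hi i"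
  unfolding UM_def using Min_in[of "hi ` {s..min (s + m - 1) i1}"] by (simp add: image_iff)

lemma LM_bounds: "i0 \<le> s \<Longrightarrow> s \<le> i1 \<Longrightarrow> 1 \<le> m \<Longrightarrow> - N \<le> LM m s \<and> LM m s \<le> N"
  using LM_in[of s m] lo by fastforce

lemma UM_bounds: "i0 \<le> s \<Longrightarrow> s \<le> i1 \<Longrightarrow> 1 \<le> m \<Longrightarrow> - N \<le> UM m s \<and> UM m s \<le> N"
  using UM_in[of s m] hi by fastforce

lemma range_double:
  "1 \<le> m \<Longrightarrow> s + m \<le> i1 \<Longrightarrow>
    {s..min (s + 2 * m - 1) i1} = {s..min (s + m - 1) i1} \<union> {s + m..min (s + m + m - 1) i1}"
  by auto

lemma LM_double: "1 \<le> m \<Longrightarrow> s + m \<le> i1 \<Longrightarrow> LM (2 * m) s = max (LM m s) (LM m (s + m))"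
  unfolding LM_def range_double image_Un by (rule Max_Un) auto

lemma UM_double: "1 \<le> m \<Longrightarrow> s + m \<le> i1 \<Longrightarrow> UM (2 * m) s = min (UM m s) (UM m (s + m))"
  unfolding UM_def range_double image_Un by (rule Min_Un) auto

text \<open>A last block without a partner is already cut at \<open>i1\<close>, so doubling its
  nominal length does not change its columns.\<close>

lemma LM_last: "1 \<le> m \<Longrightarrow> i1 < s + m \<Longrightarrow> LM (2 * m) s = LM m s"
  and UM_last: "1 \<le> m \<Longrightarrow> i1 < s + m \<Longrightarrow> UM (2 * m) s = UM m s"
  by (simp_all add: LM_def UM_def min_absorb2)

text \<open>Both maxima are attained in the two adjacent blocks, so this is a difference of two
  values of \<open>lo\<close> within the merged block.\<close>

lemma LM_diff:
  assumes "1 \<le> m" "s + m \<le> i1"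
  shows "\<bar>LM m s - LM m (s + m)\<bar> \<le> (\<Sum>i\<in>{s..<min (s + 2 * m) i1}. \<bar>lo (i + 1) - lo i\<bar>)"
proof -
  from LM_in[of s m] assms obtain x where x: "s \<le> x" "x < s + m" "LM m s = lo x" by auto
  from LM_in[of "s + m" m] assms obtain y where y: "s + m \<le> y" "y < s + 2 * m" "y \<le> i1" "LM m (s + m) = lo y"
    by auto
  show ?thesis unfolding x y by (rule abs_diff_le_variation) (use x y in auto)
qed

lemma UM_diff:
  assumes "1 \<le> m" "s + m \<le> i1"
  shows "\<bar>UM m s - UM m (s + m)\<bar> \<le> (\<Sum>i\<in>{s..<min (s + 2 * m) i1}. \<bar>hi (i + 1) - hi i\<bar>)"
proof -
  from UM_in[of s m] assms obtain x where x: "s \<le> x" "x < s + m" "UM m s = hi x" by auto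
  from UM_in[of "s + m" m] assms obtain y where y: "s + m \<le> y" "y < s + 2 * m" "y \<le> i1" "UM m (s + m) = hi y"
    by auto
  show ?thesis unfolding x y by (rule abs_diff_le_variation) (use x y in auto)
qed

text \<open>Different pairs of blocks occupy disjoint ranges of columns, so charging each pair to
  the variation in its own range counts no step twice.\<close>

lemma sum_variation:
  fixes D :: "int \<Rightarrow> int"
  assumes m: "1 \<le> m"
    and D: "\<And>s. i0 \<le> s \<Longrightarrow> s + m \<le> i1 \<Longrightarrow> D s \<le> (\<Sum>i\<in>{s..<min (s + 2 * m) i1}. \<bar>f (i + 1) - f i\<bar>)"
    and R: "\<And>r. r < R \<Longrightarrow> i0 + 2 * m * int r + m \<le> i1"
  shows "(\<Sum>r<R. D (i0 + 2 * m * int r)) \<le> variation f"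
proof -
  have "(\<Sum>r<R. D (i0 + 2 * m * int r)) \<le> (\<Sum>i\<in>{i0..<min (i0 + 2 * m * int R) i1}. \<bar>f (i + 1) - f i\<bar>)"
    using R
  proof (induction R)
    case (Suc R)
    let ?s = "i0 + 2 * m * int R"
    have s: "i0 \<le> ?s" "?s + m \<le> i1" using m Suc.prems[of R] by auto
    have "{i0..<min (t + 2 * m) i1} = {i0..<t} \<union> {t..<min (t + 2 * m) i1}" if "i0 \<le> t" "t + m \<le> i1" for t
      using that m by auto
    from this[OF s] have eq: "{i0..<min (i0 + 2 * m * int (Suc R)) i1} = {i0..<?s} \<union> {?s..<min (?s + 2 * m) i1}"
      by (simp add: algebra_simps)
    have "(\<Sum>i\<in>{i0..<min (i0 + 2 * m * int (Suc R)) i1}. \<bar>f (i + 1) - f i\<bar>) =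
        (\<Sum>i\<in>{i0..<?s}. \<bar>f (i + 1) - f i\<bar>) + (\<Sum>i\<in>{?s..<min (?s + 2 * m) i1}. \<bar>f (i + 1) - f i\<bar>)"
      unfolding eq by (rule sum.union_disjoint) auto
    moreover have "min ?s i1 = ?s" using s m by simp
    ultimately show ?case using Suc.IH Suc.prems D[OF s] by simp
  qed simp
  also have "\<dots> \<le> variation f"
    unfolding variation_def by (intro sum_mono2) auto
  finally show ?thesis .
qed

text \<open>If \<open>u' < l'\<close>, the second piece starts at \<open>l'\<close>, the two pieces
  exhaust \<open>l..u\<close> and the subtracted term vanishes. Hence one program serves empty and
  nonempty cores.\<close>

lemma col_split:
  assumes "l \<le> l'" "u' \<le> u"
  shows "col i l (min u (l' - 1)) z + col i (max l' (u' + 1)) u z = col i l u z - col i l' u' z"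
  using assms by (auto simp: col_def)

text \<open>Passing a pair of blocks changes the cores of their own columns only, and the loss there
  is what the two halves of a merge add to \<open>c\<close>.\<close>

lemma remaining_step:
  assumes m: "1 \<le> m" and s: "s = i0 + 2 * m * q" "i0 \<le> s" "s + m \<le> i1"
  shows "remaining m s z = remaining m (s + 2 * m) z +
    (\<Sum>i\<in>{s..<s + m}. col i (LM m s) (UM m s) z - col i (LM (2 * m) s) (UM (2 * m) s) z) +
    (\<Sum>i\<in>{s + m..<s + m + m}. col i (LM m (s + m)) (UM m (s + m)) z - col i (LM (2 * m) s) (UM (2 * m) s) z)"
proof -
  let ?d = "\<lambda>i. core m i z - core (2 * m) i z"
  have "remaining m s z - remaining m (s + 2 * m) z =
      (\<Sum>i\<in>{i0..i1}. if i \<in> {s..<s + 2 * m} then ?d i else 0)"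
    unfolding remaining_def sum_subtractf[symmetric] using m by (intro sum.cong) auto
  also have "\<dots> = (\<Sum>i\<in>{i0..i1} \<inter> {s..<s + 2 * m}. ?d i)"
    by (simp add: sum.inter_restrict)
  \<comment> \<open>The second block may overhang the last column, where \<open>col\<close> is
    zero.\<close>
  also have "\<dots> = (\<Sum>i\<in>{s..<s + 2 * m}. ?d i)"
    using s by (intro sum.mono_neutral_left) (auto simp: core_def col_def)
  also have "{s..<s + 2 * m} = {s..<s + m} \<union> {s + m..<s + m + m}" using m by auto
  also have "(\<Sum>i\<in>\<dots>. ?d i) = (\<Sum>i\<in>{s..<s + m}. ?d i) + (\<Sum>i\<in>{s + m..<s + m + m}. ?d i)"
    by (rule sum.union_disjoint) auto
  also have "(\<Sum>i\<in>{s..<s + m}. ?d i) =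
      (\<Sum>i\<in>{s..<s + m}. col i (LM m s) (UM m s) z - col i (LM (2 * m) s) (UM (2 * m) s) z)"
    using m block_eq[of m "2 * q"] block_eq[of "2 * m" q]
    by (intro sum.cong) (auto simp: core_def s(1) algebra_simps)
  also have "(\<Sum>i\<in>{s + m..<s + m + m}. ?d i) =
      (\<Sum>i\<in>{s + m..<s + m + m}. col i (LM m (s + m)) (UM m (s + m)) z - col i (LM (2 * m) s) (UM (2 * m) s) z)"
    using m block_eq[of m "2 * q + 1"] block_eq[of "2 * m" q]
    by (intro sum.cong) (auto simp: core_def s(1) algebra_simps)
  finally show ?thesis by (simp add: algebra_simps)
qed

text \<open>Right of \<open>s\<close> at most one unpaired block is left. Its offset from
  \<open>i0\<close> is a multiple of \<open>2 * m\<close>, so it is also a block of the next level,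
  with the same core.\<close>

lemma remaining_level:
  assumes m: "1 \<le> m" and s: "s = i0 + 2 * m * q" "s \<le> i1 + m" "i1 < s + m"
  shows "remaining m s z = remaining (2 * m) i0 z"
  unfolding remaining_def
proof (rule sum.cong[OF refl], goal_cases)
  case (1 i)
  show ?case
  proof (cases "i < s")
    case False
    with 1 s m have "block m i = s" "block (2 * m) i = s"
      using block_eq[of m "2 * q" i] block_eq[of "2 * m" q i] by (auto simp: algebra_simps)
    with False 1 show ?thesis using s m by (simp add: core_def LM_last UM_last)
  qed (use 1 in simp)
qed

lemma remaining_first: "remaining 1 i0 z = (\<Sum>i\<in>{i0..i1}. col i (lo i) (hi i) z)"
  unfolding remaining_def by (rule sum.cong) (auto simp: core_def block_def LM_def UM_def)

lemma remaining_last: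
  assumes "i1 - i0 < m"
  shows "remaining m i0 z = (\<Sum>i\<in>{i0..<i0 + m}. col i (LM m i0) (UM m i0) z)"
proof -
  have "remaining m i0 z = (\<Sum>i\<in>{i0..i1}. col i (LM m i0) (UM m i0) z)"
    unfolding remaining_def using assms by (intro sum.cong) (auto simp: core_def block_def)
  also have "\<dots> = (\<Sum>i\<in>{i0..<i0 + m}. col i (LM m i0) (UM m i0) z)"
    using assms by (intro sum.mono_neutral_left) (auto simp: col_def)
  finally show ?thesis .
qed

end

section \<open>Merging blocks\<close>

text \<open>A conditional store becomes a store of a conditional value, so a chain of them does not
  split the goal and the values can be rewritten to \<open>min\<close> and \<open>max\<close>. Both
  branches take two units.\<close>

lemma wp_If_IStore [simp]:
  "wp B T (IfThen b (IStore x e f) Skip) Q t \<sigma> \<longleftrightarrow> bok B b \<sigma> \<and> (bval b \<sigma> \<longrightarrow> iok B e \<sigma> \<and> iok B f \<sigma>) \<and>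
    Q (t - 2) (\<sigma>\<lparr>words := (words \<sigma>)((x, ival e \<sigma>) := if bval b \<sigma> then ival f \<sigma> else words \<sigma> (x, ival e \<sigma>))\<rparr>)"
  by auto

lemma wp_If_RStore [simp]:
  "wp B T (IfThen b (RStore x e r) Skip) Q t \<sigma> \<longleftrightarrow> bok B b \<sigma> \<and> (bval b \<sigma> \<longrightarrow> iok B e \<sigma> \<and> rok B r \<sigma>) \<and>
    Q (t - 2) (\<sigma>\<lparr>reals := (reals \<sigma>)((x, ival e \<sigma>) := if bval b \<sigma> then rval r \<sigma> else reals \<sigma> (x, ival e \<sigma>))\<rparr>)"
  by auto

text \<open>
  Splits off the rows of one block outside the common core \<open>l..u\<close>. If the common core is empty,
  the two intervals of rows meet at \<open>l\<close>.
\<close>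

definition half_com :: com where
  "half_com = Seq (assign ''j'' (ILoad ''L'' (ivar ''p''))) (Seq (assign ''g'' (ILoad ''U'' (ivar ''p'')))
    (Seq (IfThen (ile (ivar ''l'') (ivar ''g'')) (assign ''g'' (ISub (ivar ''l'') (IConst 1))) Skip)
    (Seq rect_com
    (Seq (assign ''g'' (ILoad ''U'' (ivar ''p''))) (Seq (assign ''j'' (ivar ''l''))
    (Seq (IfThen (ile (ivar ''j'') (ivar ''u'')) (assign ''j'' (IAdd (ivar ''u'') (IConst 1))) Skip)
      rect_com))))))"

definition merge_com :: com where
  "merge_com = (let sm = IAdd (ivar ''s'') (ivar ''m'') in
    Seq (assign ''l'' (ILoad ''L'' (ivar ''s'')))
    (Seq (IfThen (ILess (ivar ''l'') (ILoad ''L'' sm)) (assign ''l'' (ILoad ''L'' sm)) Skip)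
    (Seq (assign ''u'' (ILoad ''U'' (ivar ''s'')))
    (Seq (IfThen (ILess (ILoad ''U'' sm) (ivar ''u'')) (assign ''u'' (ILoad ''U'' sm)) Skip)
    (Seq (assign ''p'' (ivar ''s'')) (Seq half_com (Seq (assign ''p'' sm) (Seq half_com
    (Seq (IStore ''L'' (ivar ''s'') (ivar ''l'')) (Seq (IStore ''U'' (ivar ''s'') (ivar ''u''))
      (assign ''s'' (IAdd sm (ivar ''m'')))))))))))))"

definition level_com :: com where
  "level_com = While (ile (IAdd (ivar ''s'') (ivar ''m'')) (ivar ''i1'')) merge_com"

definition levels_com :: com where
  "levels_com = While (ile (ivar ''m'') (ISub (ivar ''i1'') (ivar ''i0'')))
     (Seq (assign ''s'' (ivar ''i0'')) (Seq level_com (assign ''m'' (IAdd (ivar ''m'') (ivar ''m'')))))"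

definition tree_com :: com where
  "tree_com = Seq (assign ''m'' (IConst 1)) (Seq levels_com
     (Seq (assign ''p'' (ivar ''i0'')) (Seq (assign ''j'' (ILoad ''L'' (ivar ''i0'')))
     (Seq (assign ''g'' (ILoad ''U'' (ivar ''i0''))) rect_com))))"

lemma half_mod [simp]: "wmod half_com = {''t'', ''j'', ''g''}" "rmod half_com = {}"
    "emod half_com = {''X'', ''Y'', ''Z'', ''c''}"
  by (auto simp: half_com_def)

lemma merge_mod [simp]: "wmod merge_com = {''t'', ''j'', ''g'', ''l'', ''u'', ''p'', ''s'', ''L'', ''U''}"
    "rmod merge_com = {}" "emod merge_com = {''X'', ''Y'', ''Z'', ''c''}"
  by (auto simp: merge_com_def Let_def)

lemma level_mod [simp]: "wmod level_com = {''t'', ''j'', ''g'', ''l'', ''u'', ''p'', ''s'', ''L'', ''U''}"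
    "rmod level_com = {}" "emod level_com = {''X'', ''Y'', ''Z'', ''c''}"
  by (simp_all add: level_com_def)

lemma levels_mod [simp]: "wmod levels_com = {''t'', ''j'', ''g'', ''l'', ''u'', ''p'', ''s'', ''L'', ''U'', ''m''}"
    "rmod levels_com = {}" "emod levels_com = {''X'', ''Y'', ''Z'', ''c''}"
  by (auto simp: levels_com_def)

lemma tree_mod [simp]: "wmod tree_com = {''t'', ''j'', ''g'', ''l'', ''u'', ''p'', ''s'', ''L'', ''U'', ''m''}"
    "rmod tree_com = {}" "emod tree_com = {''X'', ''Y'', ''Z'', ''c''}"
  by (auto simp: tree_com_def)

lemma (in sequences) ready_frame:
  "ready \<sigma> \<Longrightarrow> frame c \<sigma> \<tau> \<Longrightarrow> ''n'' \<notin> wmod c \<Longrightarrow> ''i1'' \<notin> wmod c \<Longrightarrow> ''a'' \<notin> emod c \<Longrightarrow> ''b'' \<notin> emod c \<Longrightarrow> ready \<tau>"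
  by (simp add: ready_def frame_def)

lemma (in sequences) ready_upd [simp]:
  "x \<noteq> ''n'' \<Longrightarrow> x \<noteq> ''i1'' \<Longrightarrow> ready (\<sigma>\<lparr>words := f((x, i) := v)\<rparr>) = ready (\<sigma>\<lparr>words := f\<rparr>)"
  "ready (\<sigma>\<lparr>words := words \<sigma>\<rparr>) = ready \<sigma>"
  by (simp_all add: ready_def)

context columns
begin

lemma \<kappa>_nonneg: "0 \<le> \<kappa>"
  using \<kappa>[of 1] i01 by simp

text \<open>A piece costs at most \<open>(18 + \<kappa>) * m\<close>, as
  \<open>6 + 12 * m \<le> 18 * m\<close>, and rounding up wastes less than one piece. The bound is
  linear in \<open>d + m\<close> although the rectangle has about \<open>d * m\<close> cells: this
  is what fast convolution buys.\<close>

lemma run_rect':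
  assumes "ready \<sigma>" "words \<sigma> (''m'', 0) = m" "words \<sigma> (''p'', 0) = p"
    "words \<sigma> (''j'', 0) = j" "words \<sigma> (''g'', 0) = g"
    and bnd: "1 \<le> m" "m \<le> 2 * (i1 - i0 + 1)" "- 2 * N \<le> p" "p \<le> 2 * N" "- 2 * N \<le> j" "j \<le> 2 * N"
      "- 2 * N \<le> g" "g \<le> 2 * N" and d: "g - j \<le> d" "0 \<le> d"
  shows "runs B T rect_com \<sigma> (1 + (18 + \<kappa>) * (of_int d + of_int m))
     (\<lambda>\<tau>. \<forall>z. elems \<tau> (''c'', z) = elems \<sigma> (''c'', z) + (\<Sum>i\<in>{p..<p + m}. col i j g z))"
proof (rule runs_weaken, rule run_rect[where m = m and p = p and j = j and g = g])
  have "rect_blocks m j g * m \<le> max 0 (g - j + m)"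
  proof (cases "0 \<le> (g - j + m) div m")
    case True
    then have "rect_blocks m j g * m = m * ((g - j + m) div m)" unfolding rect_blocks_def by (simp only: nat_0_le mult.commute)
    then show ?thesis using bnd(1) minus_mod_eq_mult_div[of "g - j + m" m] pos_mod_sign[of m "g - j + m"] by linarith
  next
    case False
    then have "rect_blocks m j g = 0" unfolding rect_blocks_def by linarith
    then show ?thesis by simp
  qed
  then have "int (rect_blocks m j g) * m \<le> d + m" using d bnd(1) by linarith
  then have "real_of_int (int (rect_blocks m j g) * m) \<le> of_int (d + m)" by (simp only: of_int_le_iff)
  then have "real (rect_blocks m j g) * of_int m \<le> of_int (d + m)" by simp
  moreover have "6 + 12 * real_of_int m + T (nat m) \<le> (18 + \<kappa>) * of_int m"
  proof -
    have "1 \<le> nat m" "int (nat m) \<le> 2 * (i1 - i0 + 1)" using bnd(1,2) by linarith+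
    from \<kappa>[OF this] have "real (T (nat m)) \<le> \<kappa> * of_int m" using bnd(1) by simp
    moreover have "1 \<le> real_of_int m" using bnd(1) by linarith
    ultimately show ?thesis unfolding distrib_right by linarith
  qed
  then have "real (rect_blocks m j g) * (6 + 12 * real_of_int m + T (nat m)) \<le> real (rect_blocks m j g) * ((18 + \<kappa>) * of_int m)"
    by (intro mult_left_mono) auto
  moreover have "(18 + \<kappa>) * (real (rect_blocks m j g) * of_int m) \<le> (18 + \<kappa>) * of_int (d + m)"
    using calculation(1) \<kappa>_nonneg by (intro mult_left_mono) auto
  ultimately show "1 + real (rect_blocks m j g) * (6 + 12 * real_of_int m + real (T (nat m)))
      \<le> 1 + (18 + \<kappa>) * (of_int d + of_int m)"
    by (simp add: algebra_simps)
qed (use assms i01 in auto)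

text \<open>The two rectangles have at most \<open>l - lp\<close> and \<open>up - u\<close> rows,
  also when the common core is empty. The 10 units pay for the assignments, the conditional stores
  and the closing tests of the two loops.\<close>

lemma run_half:
  assumes "ready \<sigma>" "words \<sigma> (''m'', 0) = m" "words \<sigma> (''p'', 0) = p"
    "words \<sigma> (''l'', 0) = l" "words \<sigma> (''u'', 0) = u" "words \<sigma> (''L'', p) = lp" "words \<sigma> (''U'', p) = up"
    and bnd: "1 \<le> m" "m \<le> 2 * (i1 - i0 + 1)" "- 2 * N \<le> p" "p \<le> 2 * N" "- N \<le> lp" "lp \<le> l" "l \<le> N"
      "- N \<le> u" "u \<le> up" "up \<le> N"
  shows "runs B T half_com \<sigma> (10 + (18 + \<kappa>) * (of_int (l - lp) + of_int (up - u) + 2 * of_int m))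
     (\<lambda>\<tau>. \<forall>z. elems \<tau> (''c'', z) = elems \<sigma> (''c'', z) + (\<Sum>i\<in>{p..<p + m}. col i lp up z - col i l u z))"
proof -
  have [simp]: "fits B 0" "fits B 1" "fits B p" "fits B lp" "fits B up" "fits B l" "fits B u" "fits B (l - 1)" "fits B (u + 1)"
    using bnd N by (intro fits_N; linarith)+
  have mins: "(if l \<le> up then l - 1 else up) = min up (l - 1)" "(if l \<le> u then u + 1 else l) = max l (u + 1)"
    by auto
  show ?thesis
    unfolding runs_def half_com_def
    apply (simp add: assms not_less mins del: wp_IfThen split del: if_split)
    apply (rule wp_runs, rule run_rect'[where m = m and p = p and j = lp and g = "min up (l - 1)" and d = "l - lp"])
    apply (simp_all add: assms)[5]
    using bnd N apply linarith+
    subgoal premises r for v \<tau>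
    proof -
      note fr = r(2)
      note [simp] = frame_words[OF fr] frame_elems[OF fr]
      have ready: "ready \<tau>" by (rule ready_frame[OF _ fr]) (simp_all add: assms)
      show ?thesis
        apply (simp add: assms not_less mins del: wp_IfThen split del: if_split)
        apply (rule wp_runs, rule run_rect'[where m = m and p = p and j = "max l (u + 1)" and g = up and d = "up - u"])
        using ready apply (simp_all add: assms)[5]
        using bnd N apply linarith+
        using r(1,3) apply (simp add: sum.distrib[symmetric] col_split[OF bnd(6,9)] add.assoc)
        apply (simp add: algebra_simps)
        done
    qed
    done
qed

end

section \<open>Processing all levels\<close>

context columns
begin

text \<open>Bounds are stored at the first column of their block, so cell \<open>s\<close> is reused
  for the merged block. The constant 31 is twice the 10 units of \<open>run_half\<close> plus 11 for
  bookkeeping; each half contributes \<open>2 * m\<close> to the term \<open>4 * m\<close>.\<close>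

lemma run_merge:
  assumes ready: "ready \<sigma>" and "words \<sigma> (''m'', 0) = m" "words \<sigma> (''s'', 0) = s"
    "words \<sigma> (''L'', s) = LM m s" "words \<sigma> (''L'', s + m) = LM m (s + m)"
    "words \<sigma> (''U'', s) = UM m s" "words \<sigma> (''U'', s + m) = UM m (s + m)"
    and m: "1 \<le> m" and s: "s = i0 + 2 * m * q" "i0 \<le> s" "s + m \<le> i1"
  shows "runs B T merge_com \<sigma> (31 + (18 + \<kappa>) *
        (of_int \<bar>LM m s - LM m (s + m)\<bar> + of_int \<bar>UM m s - UM m (s + m)\<bar> + 4 * of_int m))
     (\<lambda>\<tau>. words \<tau> (''s'', 0) = s + 2 * m \<and>
       (\<forall>x. words \<tau> (''L'', x) = (if x = s then LM (2 * m) s else words \<sigma> (''L'', x))) \<and>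
       (\<forall>x. words \<tau> (''U'', x) = (if x = s then UM (2 * m) s else words \<sigma> (''U'', x))) \<and>
       (\<forall>z. elems \<tau> (''c'', z) + remaining m (s + 2 * m) z = elems \<sigma> (''c'', z) + remaining m s z))"
proof -
  define l u where "l = LM (2 * m) s" and "u = UM (2 * m) s"
  define l1 l2 u1 u2 where "l1 = LM m s" and "l2 = LM m (s + m)" and "u1 = UM m s" and "u2 = UM m (s + m)"
  note defs = l1_def[symmetric] l2_def[symmetric] u1_def[symmetric] u2_def[symmetric]
  have lu: "l = max l1 l2" "u = min u1 u2"
    using m s(3) by (simp_all add: LM_double UM_double defs l_def u_def)
  have bnd: "- N \<le> l1" "l1 \<le> N" "- N \<le> l2" "l2 \<le> N" "- N \<le> u1" "u1 \<le> N" "- N \<le> u2" "u2 \<le> N"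
    using LM_bounds[of s m] LM_bounds[of "s + m" m] UM_bounds[of s m] UM_bounds[of "s + m" m] m s(2,3)
    by (simp_all add: defs)
  have [simp]: "fits B 0" "fits B s" "fits B m" "fits B (s + m)" "fits B (s + m + m)" "fits B (2 * m + s)"
     "fits B l1" "fits B l2" "fits B u1" "fits B u2" "fits B l" "fits B u"
    using bnd N m s(2,3) i01 lu by (intro fits_N; linarith)+
  have if_max: "(if l1 < l2 then l2 else l1) = l" "(if u2 < u1 then u2 else u1) = u"
    by (auto simp: lu)
  have m2: "m \<le> 2 * (i1 - i0 + 1)" using s(2,3) i01(1) by simp
  note st = assms(2-7)[unfolded defs]
  \<comment> \<open>the rows lost by the two blocks add up to exactly the difference of their bounds\<close>
  have cost: "\<bar>real_of_int l1 - real_of_int l2\<bar> = (real_of_int l - real_of_int l1) + (real_of_int l - real_of_int l2)"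
    "\<bar>real_of_int u1 - real_of_int u2\<bar> = (real_of_int u1 - real_of_int u) + (real_of_int u2 - real_of_int u)"
    by (auto simp: lu max_def min_def)
  show ?thesis
    unfolding runs_def merge_com_def Let_def defs l_def[symmetric] u_def[symmetric]
    apply (simp add: st if_max del: wp_IfThen split del: if_split)
    apply (rule wp_runs, rule run_half[where m = m and p = s and l = l and u = u and lp = l1 and up = u1])
    using ready apply (simp_all add: st)[7]
    using bnd N m m2 s(2,3) i01 lu apply linarith+
    subgoal premises h for v \<tau>
    proof -
      note fr = h(2)
      note [simp] = frame_words[OF fr] frame_elems[OF fr]
      have ready': "ready \<tau>" by (rule ready_frame[OF _ fr]) (simp_all add: ready)
      show ?thesis
        apply (simp add: st del: wp_IfThen)
        apply (rule wp_runs, rule run_half[where m = m and p = "s + m" and l = l and u = u and lp = l2 and up = u2])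
        using ready' apply (simp_all add: st)[7]
        using bnd N m m2 s(2,3) i01 lu apply linarith+
        subgoal premises h' for w \<rho>
        proof -
          note fr' = h'(2)
          note [simp] = frame_words[OF fr'] frame_elems[OF fr']
          have "3 \<le> w" using h(3) h'(3) by (simp add: cost algebra_simps)
          then show ?thesis
            using h(1) h'(1) by (simp add: st remaining_step[OF m s] defs l_def[symmetric] u_def[symmetric]
              if_max split del: if_split cong: if_cong)
        qed
        done
    qed
    done
qed

text \<open>Only the cells at block starts matter; the others may keep stale bounds of earlier
  levels.\<close>

definition blocks_ok :: "int \<Rightarrow> 'a state \<Rightarrow> bool" where
  "blocks_ok m \<tau> \<longleftrightarrow> (\<forall>q. i0 + m * int q \<le> i1 \<longrightarrow>
     words \<tau> (''L'', i0 + m * int q) = LM m (i0 + m * int q) \<and>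
     words \<tau> (''U'', i0 + m * int q) = UM m (i0 + m * int q))"

lemma run_level:
  assumes ready: "ready \<sigma>" and st: "words \<sigma> (''m'', 0) = m" "words \<sigma> (''s'', 0) = i0"
    and ok: "blocks_ok m \<sigma>" and m: "1 \<le> m" "m \<le> i1 - i0"
  shows "runs B T level_com \<sigma> (1 + 32 * (i1 - i0 + 1) +
       (18 + \<kappa>) * (of_int (variation lo) + of_int (variation hi) + 4 * (i1 - i0 + 1)))
     (\<lambda>\<tau>. blocks_ok (2 * m) \<tau> \<and>
       (\<forall>z. elems \<tau> (''c'', z) + remaining (2 * m) i0 z = elems \<sigma> (''c'', z) + remaining m i0 z))"
proof -
  \<comment> \<open>Both blocks of the pair starting at \<open>i0 + 2 * m * r\<close> exist iff this
    start is at most \<open>i1 - m\<close>, which holds for exactly \<open>R\<close> values of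
    \<open>r\<close>.\<close>
  define R where "R = nat ((i1 - i0 + m) div (2 * m))"
  let ?s = "\<lambda>r. i0 + 2 * m * int r"
  have R: "int R = (i1 - i0 + m) div (2 * m)"
    unfolding R_def using m by (simp add: pos_imp_zdiv_nonneg_iff)
  have Rm: "2 * m * int R \<le> i1 - i0 + m" "i1 - i0 + m < 2 * m * int R + 2 * m"
    unfolding R using m minus_mod_eq_mult_div[of "i1 - i0 + m" "2 * m"] pos_mod_bound[of "2 * m" "i1 - i0 + m"]
      pos_mod_sign[of "2 * m" "i1 - i0 + m"] by linarith+
  have less: "?s r + m \<le> i1" if "r < R" for r
  proof -
    have "2 * m * (int r + 1) \<le> 2 * m * int R" using that m by (intro mult_left_mono) auto
    with Rm(1) show ?thesis by (simp add: algebra_simps)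
  qed
  have ge: "i0 \<le> ?s r" for r using m by simp
  let ?cost = "\<lambda>r. 31 + (18 + \<kappa>) *
        (of_int \<bar>LM m (?s r) - LM m (?s r + m)\<bar> + of_int \<bar>UM m (?s r) - UM m (?s r + m)\<bar> + 4 * of_int m)"
  \<comment> \<open>The first \<open>r\<close> pairs already have merged bounds; from block
    \<open>2 * r\<close> on, the cells still belong to the current level.\<close>
  let ?I = "\<lambda>r \<tau>. words \<tau> (''s'', 0) = ?s r \<and>
     (\<forall>q<r. words \<tau> (''L'', ?s q) = LM (2 * m) (?s q) \<and> words \<tau> (''U'', ?s q) = UM (2 * m) (?s q)) \<and>
     (\<forall>q\<ge>2 * r. i0 + m * int q \<le> i1 \<longrightarrow>
        words \<tau> (''L'', i0 + m * int q) = LM m (i0 + m * int q) \<and>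
        words \<tau> (''U'', i0 + m * int q) = UM m (i0 + m * int q)) \<and>
     (\<forall>z. elems \<tau> (''c'', z) + remaining m (?s r) z = elems \<sigma> (''c'', z) + remaining m i0 z)"
  have "runs B T level_com \<sigma> (1 + (\<Sum>r<R. 1 + ?cost r)) (?I R)"
    unfolding level_com_def
  proof (rule runs_for, goal_cases)
    case 1
    then show ?case using ok by (simp add: st blocks_ok_def)
  next
    case (2 r \<tau>)
    note fr = 2(3)[folded level_com_def]
    note [simp] = frame_words[OF fr] frame_elems[OF fr]
    note le = less[OF 2(1)]
    have ready': "ready \<tau>" by (rule ready_frame[OF ready fr]) simp_all
    have [simp]: "words \<sigma> (''i1'', 0) = i1" using ready by (simp add: ready_def)
    have [simp]: "fits B 0" "fits B m" "fits B i1" "fits B (?s r)" "fits B (?s r + m)"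
      using N m le ge[of r] i01 by (intro fits_N; linarith)+
    have s: "words \<tau> (''s'', 0) = ?s r" and old: "\<And>q. q < r \<Longrightarrow> words \<tau> (''L'', ?s q) = LM (2 * m) (?s q)"
        "\<And>q. q < r \<Longrightarrow> words \<tau> (''U'', ?s q) = UM (2 * m) (?s q)"
      and todo: "\<And>q. 2 * r \<le> q \<Longrightarrow> i0 + m * int q \<le> i1 \<Longrightarrow> words \<tau> (''L'', i0 + m * int q) = LM m (i0 + m * int q)"
        "\<And>q. 2 * r \<le> q \<Longrightarrow> i0 + m * int q \<le> i1 \<Longrightarrow> words \<tau> (''U'', i0 + m * int q) = UM m (i0 + m * int q)"
      and c: "\<And>z. elems \<tau> (''c'', z) + remaining m (?s r) z = elems \<sigma> (''c'', z) + remaining m i0 z"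
      using 2(2) by blast+
    have e1: "i0 + m * int (2 * r) = ?s r" and e2: "i0 + m * int (2 * r + 1) = ?s r + m"
      and e3: "?s (Suc r) = ?s r + 2 * m" by (simp_all add: algebra_simps)
    have ne: "?s q \<noteq> ?s r" if "q < r" for q using that m by simp
    have ne': "i0 + m * int q \<noteq> ?s r" if "2 * Suc r \<le> q" for q
    proof -
      have "2 * r < q" using that by simp
      then have "m * int (2 * r) < m * int q" using m by (intro mult_strict_left_mono) auto
      then show ?thesis unfolding e1[symmetric] by linarith
    qed
    have "runs B T merge_com \<tau> (?cost r)
       (\<lambda>\<rho>. words \<rho> (''s'', 0) = ?s r + 2 * m \<and>
         (\<forall>x. words \<rho> (''L'', x) = (if x = ?s r then LM (2 * m) (?s r) else words \<tau> (''L'', x))) \<and>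
         (\<forall>x. words \<rho> (''U'', x) = (if x = ?s r then UM (2 * m) (?s r) else words \<tau> (''U'', x))) \<and>
         (\<forall>z. elems \<rho> (''c'', z) + remaining m (?s r + 2 * m) z = elems \<tau> (''c'', z) + remaining m (?s r) z))"
      using todo[of "2 * r"] todo[of "2 * r + 1"] le ge[of r] m unfolding e1 e2
      by (intro run_merge[OF ready' _ s]) (simp_all add: st)
    then have "runs B T merge_com \<tau> (?cost r) (?I (Suc r))"
    proof (rule runs_weaken)
      fix \<rho> assume "words \<rho> (''s'', 0) = ?s r + 2 * m \<and>
         (\<forall>x. words \<rho> (''L'', x) = (if x = ?s r then LM (2 * m) (?s r) else words \<tau> (''L'', x))) \<and>
         (\<forall>x. words \<rho> (''U'', x) = (if x = ?s r then UM (2 * m) (?s r) else words \<tau> (''U'', x))) \<and>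
         (\<forall>z. elems \<rho> (''c'', z) + remaining m (?s r + 2 * m) z = elems \<tau> (''c'', z) + remaining m (?s r) z)"
      then show "?I (Suc r) \<rho>" unfolding e3 using old todo c ne ne' less_SucE by auto
    qed simp
    then show ?case using le by (simp add: s st)
  next
    case (3 \<tau>)
    note fr = 3(2)[folded level_com_def]
    note [simp] = frame_words[OF fr] frame_elems[OF fr]
    have [simp]: "words \<sigma> (''i1'', 0) = i1" using ready by (simp add: ready_def)
    have [simp]: "fits B 0" "fits B m" "fits B i1" "fits B (?s R)" "fits B (?s R + m)"
      using N m ge[of R] Rm i01 by (intro fits_N; linarith)+
    show ?case using 3(1) Rm by (simp add: st)
  qed
  then show ?thesis
  proof (rule runs_weaken, goal_cases)
    case 1
    \<comment> \<open>As \<open>m \<le> i1 - i0\<close>, the bound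
      \<open>2 * m * R \<le> i1 - i0 + m\<close> is at most \<open>2 * (i1 - i0)\<close>. So the
      terms \<open>4 * m\<close> of all pairs together are linear in the number of columns.\<close>
    have "int R * m \<le> i1 - i0 + 1" using Rm(1) m(2) by (simp add: algebra_simps)
    then have R1: "real_of_int (int R * m) \<le> real_of_int (i1 - i0 + 1)" by (simp only: of_int_le_iff)
    have "real R * 1 \<le> real R * of_int m" using m by (intro mult_left_mono) auto
    with R1 have R2: "real R \<le> real_of_int (i1 - i0 + 1)" by simp
    have V: "(\<Sum>r<R. \<bar>LM m (?s r) - LM m (?s r + m)\<bar>) \<le> variation lo"
       "(\<Sum>r<R. \<bar>UM m (?s r) - UM m (?s r + m)\<bar>) \<le> variation hi"
      by (rule sum_variation[where D = "\<lambda>s. \<bar>LM m s - LM m (s + m)\<bar>", OF m(1) LM_diff[OF m(1)] less];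
          assumption)
        (rule sum_variation[where D = "\<lambda>s. \<bar>UM m s - UM m (s + m)\<bar>", OF m(1) UM_diff[OF m(1)] less];
          assumption)
    have V': "real_of_int (\<Sum>r<R. \<bar>LM m (?s r) - LM m (?s r + m)\<bar>) \<le> of_int (variation lo)"
       "real_of_int (\<Sum>r<R. \<bar>UM m (?s r) - UM m (?s r + m)\<bar>) \<le> of_int (variation hi)"
      using V by (simp_all only: of_int_le_iff)
    have "(\<Sum>r<R. 1 + ?cost r) = 32 * real R + (18 + \<kappa>) *
        (of_int (\<Sum>r<R. \<bar>LM m (?s r) - LM m (?s r + m)\<bar>) +
         of_int (\<Sum>r<R. \<bar>UM m (?s r) - UM m (?s r + m)\<bar>) + 4 * real_of_int (int R * m))"
      by (simp add: sum.distrib sum_distrib_left[symmetric])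
    also have "\<dots> \<le> 32 * real_of_int (i1 - i0 + 1) + (18 + \<kappa>) *
        (of_int (variation lo) + of_int (variation hi) + 4 * real_of_int (i1 - i0 + 1))"
      using V' R1 R2 \<kappa>_nonneg by (intro add_mono mult_left_mono) (assumption | simp)+
    finally show ?case by simp
  next
    case (2 \<tau>)
    have old: "\<And>q. q < R \<Longrightarrow> words \<tau> (''L'', ?s q) = LM (2 * m) (?s q) \<and> words \<tau> (''U'', ?s q) = UM (2 * m) (?s q)"
      and todo: "\<And>q. 2 * R \<le> q \<Longrightarrow> i0 + m * int q \<le> i1 \<Longrightarrow> words \<tau> (''L'', i0 + m * int q) = LM m (i0 + m * int q)
          \<and> words \<tau> (''U'', i0 + m * int q) = UM m (i0 + m * int q)"
      and c: "\<And>z. elems \<tau> (''c'', z) + remaining m (?s R) z = elems \<sigma> (''c'', z) + remaining m i0 z"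
      using 2(1) by blast+
    have sR: "?s R \<le> i1 + m" "i1 < ?s R + m" using Rm by linarith+
    have "words \<tau> (''L'', ?s q) = LM (2 * m) (?s q) \<and> words \<tau> (''U'', ?s q) = UM (2 * m) (?s q)"
      if "?s q \<le> i1" for q
    proof (cases "q < R")
      \<comment> \<open>The only block start not rewritten is that of an unpaired last block, whose
        old bounds are already right.\<close>
      case False
      have "q \<le> R"
      proof (rule ccontr)
        assume "\<not> q \<le> R"
        then have "2 * m * (int R + 1) \<le> 2 * m * int q" using m by (intro mult_left_mono) auto
        with that sR(2) m show False by (simp add: algebra_simps)
      qed
      with False have "q = R" by simp
      then show ?thesis
        using todo[of "2 * R"] that LM_last[OF m(1) sR(2)] UM_last[OF m(1) sR(2)] by (simp add: algebra_simps)
    qed (rule old)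
    moreover have "remaining m (?s R) z = remaining (2 * m) i0 z" for z
      by (rule remaining_level[OF m(1) refl sR])
    ultimately show ?case using c by (simp add: blocks_ok_def)
  qed
qed

text \<open>\<open>H\<close> counts the levels until a single block is left: before each of them at
  least two blocks exist. The first bound on \<open>2 ^ H\<close> keeps the block lengths within
  words and within the range of \<open>\<kappa>\<close>.\<close>

lemma run_levels:
  assumes ready: "ready \<sigma>" and st: "words \<sigma> (''m'', 0) = 1" "words \<sigma> (''i0'', 0) = i0"
    and ok: "blocks_ok 1 \<sigma>" and H: "2 ^ H \<le> 2 * (i1 - i0 + 1)" "i1 - i0 < 2 ^ H"
      "\<And>h. h < H \<Longrightarrow> 2 ^ h \<le> i1 - i0"
  shows "runs B T levels_com \<sigma> (1 + real H * (4 + 32 * (i1 - i0 + 1) +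
       (18 + \<kappa>) * (of_int (variation lo) + of_int (variation hi) + 4 * (i1 - i0 + 1))))
     (\<lambda>\<tau>. words \<tau> (''m'', 0) = 2 ^ H \<and> blocks_ok (2 ^ H) \<tau> \<and>
       (\<forall>z. elems \<tau> (''c'', z) + remaining (2 ^ H) i0 z = elems \<sigma> (''c'', z) + remaining 1 i0 z))"
proof -
  define K where "K = 1 + 32 * (i1 - i0 + 1) +
       (18 + \<kappa>) * (of_int (variation lo) + of_int (variation hi) + 4 * (i1 - i0 + 1))"
  let ?I = "\<lambda>h \<tau>. words \<tau> (''m'', 0) = 2 ^ h \<and> blocks_ok (2 ^ h) \<tau> \<and>
       (\<forall>z. elems \<tau> (''c'', z) + remaining (2 ^ h) i0 z = elems \<sigma> (''c'', z) + remaining 1 i0 z)"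
  have H1: "2 ^ H \<le> 2 * i1 - 2 * i0 + 2" using H(1) by simp
  have pow: "0 \<le> (2::int) ^ h" for h by simp
  have [simp]: "fits B 0" "fits B i1" "fits B i0" "fits B (i1 - i0)"
    using N i01 by (intro fits_N; linarith)+
  have [simp]: "words \<sigma> (''i1'', 0) = i1" using ready by (simp add: ready_def)
  have "runs B T levels_com \<sigma> (1 + (\<Sum>h<H. 1 + (2 + K))) (?I H)"
    unfolding levels_com_def
  proof (rule runs_for, goal_cases)
    case 1
    then show ?case using ok by (simp add: st)
  next
    case (2 h \<tau>)
    note fr = 2(3)[folded levels_com_def]
    note [simp] = frame_words[OF fr] frame_elems[OF fr]
    note le = H(3)[OF 2(1)]
    have ready': "ready \<tau>" by (rule ready_frame[OF ready fr]) simp_all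
    have [simp]: "fits B (2 ^ h)" "fits B (2 * 2 ^ h)"
      using N le i01 pow[of h] by (intro fits_N; linarith)+
    show ?case
      using 2(2) le apply (simp add: runs_def st)
      apply (rule wp_runs, rule run_level[where m = "2 ^ h"])
      using ready' apply (simp_all add: st blocks_ok_def)[6]
      subgoal premises l for u \<rho>
      proof -
        note fr' = l(4)
        note [simp] = frame_words[OF fr'] frame_elems[OF fr']
        have "1 \<le> u" using l(5) by (simp add: K_def)
        then show ?thesis using l(1,3) by (simp add: blocks_ok_def)
      qed
      done
  next
    case (3 \<tau>)
    note fr = 3(2)[folded levels_com_def]
    note [simp] = frame_words[OF fr] frame_elems[OF fr]
    have [simp]: "fits B (2 ^ H)"
      using N H1 i01 pow[of H] by (intro fits_N; linarith)+
    show ?case using 3(1) H(2) by (simp add: st)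
  qed
  then show ?thesis
    by (rule runs_weaken) (auto simp: K_def algebra_simps)
qed

lemma run_tree:
  assumes ready: "ready \<sigma>" and st: "words \<sigma> (''i0'', 0) = i0"
    and LU: "\<And>i. i \<in> {i0..i1} \<Longrightarrow> words \<sigma> (''L'', i) = lo i \<and> words \<sigma> (''U'', i) = hi i"
    and H: "2 ^ H \<le> 2 * (i1 - i0 + 1)" "i1 - i0 < 2 ^ H" "\<And>h. h < H \<Longrightarrow> 2 ^ h \<le> i1 - i0"
    and D: "\<And>i. i \<in> {i0..i1} \<Longrightarrow> hi i - lo i \<le> D" "0 \<le> D"
  shows "runs B T tree_com \<sigma> ((1 + real H) * ((18 + \<kappa>) *
       (of_int (variation lo) + of_int (variation hi) + of_int D + 6 * of_int (i1 - i0 + 1))))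
     (\<lambda>\<tau>. \<forall>z. elems \<tau> (''c'', z) = elems \<sigma> (''c'', z) + (\<Sum>i\<in>{i0..i1}. col i (lo i) (hi i) z))"
proof -
  define W V where "W = real_of_int (i1 - i0 + 1)" and "V = real_of_int (variation lo) + of_int (variation hi)"
  have W: "1 \<le> W" using i01 by (simp add: W_def)
  have V: "0 \<le> V" by (simp add: V_def variation_def sum_nonneg)
  let ?m = "2 ^ H :: int"
  have H1: "?m \<le> 2 * i1 - 2 * i0 + 2" "1 \<le> ?m" using H(1) by simp_all
  define l u where "l = LM ?m i0" and "u = UM ?m i0"
  have lu: "- N \<le> l" "l \<le> N" "- N \<le> u" "u \<le> N"
    using LM_bounds[of i0 ?m] UM_bounds[of i0 ?m] H1 i01 by (simp_all add: l_def u_def)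
  \<comment> \<open>The core of the final block lies within the interval of column
    \<open>i0\<close>, so \<open>D\<close> bounds its height.\<close>
  have "l \<ge> lo i0" "u \<le> hi i0"
    unfolding l_def u_def LM_def UM_def using i01 H1(2) by (intro Max_ge Min_le; simp)+
  then have d: "u - l \<le> D" using D(1)[of i0] i01 by simp
  have [simp]: "fits B 0" "fits B 1" "fits B i0" "fits B l" "fits B u"
    using N i01 lu by (intro fits_N; linarith)+
  have ok: "blocks_ok 1 \<sigma>'" if "frame (assign ''m'' e) \<sigma> \<sigma>'" for \<sigma>' e
    using LU that by (auto simp: blocks_ok_def frame_def LM_def UM_def min_def)
  \<comment> \<open>Since \<open>1 \<le> W\<close>, the overhead \<open>4 + 32 * W\<close> is at
    most \<open>(18 + \<kappa>) * (2 * W)\<close>, which raises \<open>4 * W\<close> to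
    \<open>6 * W\<close>. The final rectangle is paid for like one more level.\<close>
  have cost: "6 + real H * (4 + 32 * W + (18 + \<kappa>) * (V + 4 * W)) + (18 + \<kappa>) * (of_int D + 2 * W)
      \<le> (1 + real H) * ((18 + \<kappa>) * (V + of_int D + 6 * W))"
  proof -
    have kW: "0 \<le> W * \<kappa>" using W \<kappa>_nonneg by simp
    have "4 + 32 * W \<le> (18 + \<kappa>) * (2 * W)" using W kW by (simp add: algebra_simps)
    then have "4 + 32 * W + (18 + \<kappa>) * (V + 4 * W) \<le> (18 + \<kappa>) * (V + 6 * W)" by (simp add: algebra_simps)
    also have "\<dots> \<le> (18 + \<kappa>) * (V + of_int D + 6 * W)" using D(2) \<kappa>_nonneg by (intro mult_left_mono) auto
    finally have 1: "real H * (4 + 32 * W + (18 + \<kappa>) * (V + 4 * W)) \<le> real H * ((18 + \<kappa>) * (V + of_int D + 6 * W))"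
      by (intro mult_left_mono) auto
    have "6 \<le> (18 + \<kappa>) * W" using W kW by (simp add: algebra_simps)
    then have "6 + (18 + \<kappa>) * (of_int D + 2 * W) \<le> (18 + \<kappa>) * (of_int D + 3 * W)" by (simp add: algebra_simps)
    also have "\<dots> \<le> (18 + \<kappa>) * (V + of_int D + 6 * W)" using V W \<kappa>_nonneg by (intro mult_left_mono) auto
    finally show ?thesis using 1 by (simp add: algebra_simps)
  qed
  have m: "real_of_int ?m \<le> 2 * W" using H(1) unfolding W_def by linarith
  show ?thesis
    unfolding runs_def tree_com_def V_def[symmetric] W_def[symmetric]
    apply simp
    apply (rule wp_runs, rule run_levels[OF _ _ _ _ H])
    using ready apply (simp add: ready_def)
    apply simp
    apply (simp add: st)
    apply (rule ok, simp add: frame_def)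
    apply assumption
    subgoal premises l for v \<tau>
    proof -
      note fr = l(2)
      note [simp] = frame_words[OF fr] frame_elems[OF fr]
      have ready': "ready \<tau>" by (rule ready_frame[OF _ fr]) (use ready in \<open>simp_all add: ready_def\<close>)
      have LU': "words \<tau> (''L'', i0) = l" "words \<tau> (''U'', i0) = u"
        using l(1) i01 unfolding blocks_ok_def l_def u_def by (auto dest: spec[of _ 0])
      show ?thesis
        apply (simp add: st LU')
        apply (rule wp_runs, rule run_rect'[where m = ?m and p = i0 and j = l and g = u and d = D])
        using ready' l(1) apply (simp_all add: st)[5]
        using lu d D(2) H1 i01 N apply (simp_all)[10]
        subgoal premises r for w \<rho>
        proof -
          have "(18 + \<kappa>) * (of_int D + of_int ?m) \<le> (18 + \<kappa>) * (of_int D + 2 * W)"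
            using m \<kappa>_nonneg by (intro mult_left_mono) auto
          moreover have "(1 + real H) * ((18 + \<kappa>) * (V + of_int D + 6 * W)) - 1 -
              (1 + real H * (4 + 32 * W + (18 + \<kappa>) * (V + 4 * W))) \<le> v"
            using l(3) by (simp add: W_def V_def)
          ultimately have "0 \<le> w" using r(3) cost by linarith
          then show ?thesis
            using r(1) l(1) remaining_last[OF H(2)] by (simp add: remaining_first l_def u_def)
        qed
        done
    qed
    done
qed

end

section \<open>Planar convex polygons\<close>

text \<open>Separate \<open>P\<close> from the open ray and let \<open>t\<close> tend to 0, which
  moves the separating line back to \<open>q\<close>. Applied to vertical rays, this makes the
  lowest and highest points of a section supported points.\<close>

lemma supporting_hyperplane_ray:
  fixes P :: "'a::euclidean_space set"
  assumes "convex P" "q \<in> P" and out: "\<And>t. 0 < t \<Longrightarrow> q + t *\<^sub>R d \<notin> P"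
  obtains \<alpha> where "\<alpha> \<noteq> 0" "\<And>z. z \<in> P \<Longrightarrow> \<alpha> \<bullet> z \<le> \<alpha> \<bullet> q"
proof -
  let ?R = "(\<lambda>t. q + t *\<^sub>R d) ` {0<..}"
  have "convex ((\<lambda>z. q + z) ` ((\<lambda>t. t *\<^sub>R d) ` {0<..}))"
    by (intro convex_translation convex_linear_image) (auto intro: linearI simp: algebra_simps)
  then have "convex ?R" by (simp add: image_image)
  moreover have "P \<inter> ?R = {}" using out by auto
  ultimately obtain \<alpha> \<beta> where \<alpha>: "\<alpha> \<noteq> 0" "\<forall>z\<in>P. \<alpha> \<bullet> z \<le> \<beta>" "\<forall>z\<in>?R. \<beta> \<le> \<alpha> \<bullet> z"
    using separating_hyperplane_sets[of P ?R] assms(1,2) by auto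
  have "\<beta> \<le> \<alpha> \<bullet> q"
  proof (rule field_le_epsilon)
    fix e :: real assume "0 < e"
    define t where "t = e / (\<bar>\<alpha> \<bullet> d\<bar> + 1)"
    have t: "0 < t" using \<open>0 < e\<close> by (simp add: t_def)
    then have "\<beta> \<le> \<alpha> \<bullet> (q + t *\<^sub>R d)" using \<alpha>(3) by auto
    also have "\<dots> = \<alpha> \<bullet> q + t * (\<alpha> \<bullet> d)" by (simp add: inner_add_right)
    also have "t * (\<alpha> \<bullet> d) \<le> t * (\<bar>\<alpha> \<bullet> d\<bar> + 1)" using t by (intro mult_left_mono) auto
    also have "\<dots> = e" using \<open>0 < e\<close> by (simp add: t_def)
    finally show "\<beta> \<le> \<alpha> \<bullet> q + e" by simp
  qed
  with \<alpha> that show ?thesis by force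
qed

text \<open>On a line orthogonal to \<open>\<alpha>\<close> points are ordered by their coordinate
  along the rotated vector \<open>\<beta>\<close>, and of three points one is in the middle. Hence a
  supporting line carries at most two extreme points.\<close>

lemma planar_third_between:
  fixes u v w :: "real \<times> real"
  assumes "\<alpha> \<noteq> 0" "\<alpha> \<bullet> u = \<alpha> \<bullet> v" "\<alpha> \<bullet> u = \<alpha> \<bullet> w" "u \<noteq> v" "u \<noteq> w" "v \<noteq> w"
  shows "u \<in> open_segment v w \<or> v \<in> open_segment u w \<or> w \<in> open_segment u v"
proof -
  obtain a b where \<alpha>: "\<alpha> = (a, b)" by force
  define \<beta> where "\<beta> = (- b, a)"
  have ab: "a\<^sup>2 + b\<^sup>2 > 0" using assms(1) by (simp add: \<alpha> sum_power2_gt_zero_iff zero_prod_def)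
  define \<gamma> where "\<gamma> z = \<beta> \<bullet> z" for z
  \<comment> \<open>Expansion in the orthogonal basis \<open>\<alpha>\<close>,
    \<open>\<beta>\<close>, multiplied by their common squared length to avoid division.\<close>
  have dec: "(a\<^sup>2 + b\<^sup>2) *\<^sub>R z = (\<alpha> \<bullet> z) *\<^sub>R \<alpha> + \<gamma> z *\<^sub>R \<beta>" for z
    by (cases z) (simp add: \<alpha> \<beta>_def \<gamma>_def power2_eq_square algebra_simps)
  have between: "y \<in> open_segment x z"
    if "\<gamma> x < \<gamma> y" "\<gamma> y < \<gamma> z" "\<alpha> \<bullet> x = \<alpha> \<bullet> y" "\<alpha> \<bullet> x = \<alpha> \<bullet> z" for x y z
  proof -
    define t where "t = (\<gamma> y - \<gamma> x) / (\<gamma> z - \<gamma> x)"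
    have "t * (\<gamma> z - \<gamma> x) = \<gamma> y - \<gamma> x" using that(1,2) by (simp add: t_def)
    then have "\<gamma> y = (1 - t) * \<gamma> x + t * \<gamma> z" by (simp add: algebra_simps)
    moreover have "0 < t" "t < 1" using that(1,2) by (simp_all add: t_def field_simps)
    ultimately have t: "0 < t" "t < 1" "\<gamma> y = (1 - t) * \<gamma> x + t * \<gamma> z" by blast+
    have "(a\<^sup>2 + b\<^sup>2) *\<^sub>R ((1 - t) *\<^sub>R x + t *\<^sub>R z) = (1 - t) *\<^sub>R ((a\<^sup>2 + b\<^sup>2) *\<^sub>R x) + t *\<^sub>R ((a\<^sup>2 + b\<^sup>2) *\<^sub>R z)"
      by (simp only: scaleR_add_right scaleR_left_commute)
    also have "\<dots> = (a\<^sup>2 + b\<^sup>2) *\<^sub>R y"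
      unfolding dec t(3) using that(3,4) by (simp add: algebra_simps)
    finally have "y = (1 - t) *\<^sub>R x + t *\<^sub>R z" using ab by auto
    moreover have "x \<noteq> z" using that by auto
    ultimately show ?thesis using t by (auto simp: in_segment)
  qed
  have inj: "\<gamma> x \<noteq> \<gamma> z" if "\<alpha> \<bullet> x = \<alpha> \<bullet> z" "x \<noteq> z" for x z
  proof
    assume "\<gamma> x = \<gamma> z"
    with that(1) dec[of x] dec[of z] have "(a\<^sup>2 + b\<^sup>2) *\<^sub>R x = (a\<^sup>2 + b\<^sup>2) *\<^sub>R z" by simp
    with ab that(2) show False by simp
  qed
  from inj[of u v] inj[of u w] inj[of v w] assms
  consider "\<gamma> u < \<gamma> v" "\<gamma> v < \<gamma> w" | "\<gamma> u < \<gamma> w" "\<gamma> w < \<gamma> v" | "\<gamma> v < \<gamma> u" "\<gamma> u < \<gamma> w"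
    | "\<gamma> v < \<gamma> w" "\<gamma> w < \<gamma> u" | "\<gamma> w < \<gamma> u" "\<gamma> u < \<gamma> v" | "\<gamma> w < \<gamma> v" "\<gamma> v < \<gamma> u"
    by fastforce
  then show ?thesis
    using assms between by cases (metis open_segment_commute)+
qed

text \<open>
  At most two edges meet in a vertex. Hence the edges listed in a polygon are all its edges.
\<close>

lemma planar_no_three_edges:
  fixes d1 d2 d3 \<alpha>1 \<alpha>2 \<alpha>3 :: "real \<times> real"
  assumes "\<alpha>1 \<bullet> d1 = 0" "\<alpha>1 \<bullet> d2 < 0" "\<alpha>1 \<bullet> d3 < 0"
    and "\<alpha>2 \<bullet> d2 = 0" "\<alpha>2 \<bullet> d1 < 0" "\<alpha>2 \<bullet> d3 < 0"
    and "\<alpha>3 \<bullet> d3 = 0" "\<alpha>3 \<bullet> d1 < 0" "\<alpha>3 \<bullet> d2 < 0"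
  shows False
proof -
  \<comment> \<open>The cross product. If \<open>\<alpha>\<close> vanishes on \<open>d\<close> and
    is negative on \<open>e\<close> and \<open>f\<close>, both lie on the same side of
    \<open>d\<close>, so \<open>X d e\<close> and \<open>X d f\<close> have the same sign. For three
    edges at once this fails, since the product of the three positive numbers is minus a
    square.\<close>
  define X where "X d e = fst d * snd e - snd d * fst (e :: real \<times> real)" for d e :: "real \<times> real"
  have cross: "0 < X d e * X d f" if "\<alpha> \<bullet> d = 0" "\<alpha> \<bullet> e < 0" "\<alpha> \<bullet> f < 0" "d \<noteq> 0" for \<alpha> d e f :: "real \<times> real"
  proof -
    obtain a b x y where p: "\<alpha> = (a, b)" "d = (x, y)" by force
    \<comment> \<open>\<open>\<alpha>\<close> is orthogonal to \<open>d = (x, y)\<close>, hence a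
      multiple of \<open>(- y, x)\<close>; \<open>c\<close> is the factor.\<close>
    define c where "c = (if x = 0 then - a / y else b / x)"
    have c: "a = - c * y" "b = c * x"
      using that(1,4) by (auto simp: p c_def field_simps zero_prod_def eq_neg_iff_add_eq_0)
    have "\<alpha> \<bullet> e = c * X d e" "\<alpha> \<bullet> f = c * X d f" by (cases e; cases f; simp add: p c X_def algebra_simps)+
    then have "0 < (c * X d e) * (c * X d f)" using that(2,3) by (simp add: mult_neg_neg)
    then have "0 < c\<^sup>2 * (X d e * X d f)" by (simp add: power2_eq_square mult.assoc mult.left_commute)
    then show ?thesis by (simp add: zero_less_mult_iff)
  qed
  have "d1 \<noteq> 0" "d2 \<noteq> 0" "d3 \<noteq> 0" using assms by auto
  then have 1: "0 < X d1 d2 * X d1 d3" and 2: "0 < X d2 d1 * X d2 d3" and 3: "0 < X d3 d1 * X d3 d2"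
    using cross assms by blast+
  have sw: "X d2 d1 = - X d1 d2" "X d3 d1 = - X d1 d3" "X d3 d2 = - X d2 d3"
    by (simp_all add: X_def)
  have "0 < X d1 d2 * X d1 d3 * (X d2 d1 * X d2 d3) * (X d3 d1 * X d3 d2)"
    by (rule mult_pos_pos[OF mult_pos_pos[OF 1 2] 3])
  also have "\<dots> = - (X d1 d2 * X d1 d3 * X d2 d3)\<^sup>2" by (simp add: sw power2_eq_square algebra_simps)
  finally show False by (simp add: not_less[symmetric])
qed

section \<open>Supported boundary points lie on listed edges\<close>

locale polygon =
  fixes vs :: "(real \<times> real) list"
  assumes cp: "convex_polygon vs"
begin

abbreviation "P \<equiv> filled_polygon vs"
abbreviation "k \<equiv> length vs"
abbreviation "nv \<equiv> next_vertex vs"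

lemma k3: "3 \<le> k" and dist_vs: "distinct vs"
  and vertices: "set vs = {v. v extreme_point_of P}"
  and edge: "\<And>i. i < k \<Longrightarrow> closed_segment (vs ! i) (nv i) edge_of P"
  using cp by (auto simp: convex_polygon_def)

lemma convex_P: "convex P" and compact_P: "compact P"
  by (simp_all add: filled_polygon_def finite_imp_compact_convex_hull)

lemma polyhedron_P: "polyhedron P"
  by (metis List.finite_set filled_polygon_def polytope_convex_hull polytope_imp_polyhedron)

lemma vertex_in: "v \<in> set vs \<Longrightarrow> v \<in> P"
  by (simp add: filled_polygon_def hull_inc)

lemma vertex_not_between: "v \<in> set vs \<Longrightarrow> x \<in> P \<Longrightarrow> y \<in> P \<Longrightarrow> v \<notin> open_segment x y"
  using vertices by (auto simp: extreme_point_of_def)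

lemma nv_in: "i < k \<Longrightarrow> nv i \<in> set vs"
  unfolding next_vertex_def by (rule nth_mem, rule mod_less_divisor) auto

text \<open>Edges of a polyhedron are exposed faces, and by extremality no other vertex lies on the
  edge, so all others are strictly on one side.\<close>

lemma edge_support:
  assumes "i < k"
  obtains \<alpha> where "\<alpha> \<bullet> (nv i - vs ! i) = 0"
    "\<And>v. v \<in> set vs \<Longrightarrow> v \<noteq> vs ! i \<Longrightarrow> v \<noteq> nv i \<Longrightarrow> \<alpha> \<bullet> (v - vs ! i) < 0"
proof -
  let ?S = "closed_segment (vs ! i) (nv i)"
  have "?S exposed_face_of P"
    using edge[OF assms] polyhedron_P by (simp add: exposed_face_of_polyhedron edge_of_def)
  then obtain \<alpha> \<beta> where \<alpha>: "P \<subseteq> {x. \<alpha> \<bullet> x \<le> \<beta>}" "?S = P \<inter> {x. \<alpha> \<bullet> x = \<beta>}"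
    by (auto simp: exposed_face_of_def)
  have ends: "vs ! i \<in> ?S" "nv i \<in> ?S" by auto
  then have e: "\<alpha> \<bullet> (vs ! i) = \<beta>" "\<alpha> \<bullet> nv i = \<beta>" unfolding \<alpha>(2) by auto
  show ?thesis
  proof (rule that)
    show "\<alpha> \<bullet> (nv i - vs ! i) = 0" using e by (simp add: inner_diff_right)
    fix v assume v: "v \<in> set vs" "v \<noteq> vs ! i" "v \<noteq> nv i"
    have "v \<notin> open_segment (vs ! i) (nv i)"
      using vertex_not_between[OF v(1)] vertex_in assms nv_in[OF assms] by simp
    with v have "v \<notin> ?S" by (simp add: open_segment_def)
    with \<alpha> vertex_in[OF v(1)] have "\<alpha> \<bullet> v < \<beta>" by (auto simp: less_le)
    with e show "\<alpha> \<bullet> (v - vs ! i) < 0" by (simp add: inner_diff_right)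
  qed
qed

text \<open>The face on the supporting line is the hull of the vertices on it, of which there are at
  most two. If two such vertices were not neighbours in the list, then their segment and the two
  listed edges at \<open>u\<close> would be three edges at one vertex.\<close>

lemma supported_point_on_edge:
  assumes "q \<in> P" "\<alpha> \<noteq> 0" and sup: "\<And>z. z \<in> P \<Longrightarrow> \<alpha> \<bullet> z \<le> \<alpha> \<bullet> q"
  shows "\<exists>r<k. q \<in> closed_segment (vs ! r) (nv r)"
proof -
  define F where "F = P \<inter> {z. \<alpha> \<bullet> z = \<alpha> \<bullet> q}"
  have F: "F face_of P"
    unfolding F_def by (rule face_of_Int_supporting_hyperplane_le[OF convex_P]) (use sup in auto)
  have "q \<in> F" using assms by (simp add: F_def)
  have E: "{v. v extreme_point_of F} = set vs \<inter> F"
    using extreme_point_of_face[OF F] vertices by auto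
  have hull: "F = convex hull (set vs \<inter> F)"
    unfolding E[symmetric]
    by (rule Krein_Milman_Minkowski) (use F convex_P compact_P face_of_imp_compact face_of_imp_convex in blast)+
  with \<open>q \<in> F\<close> have "set vs \<inter> F \<noteq> {}" by auto
  then obtain u where u: "u \<in> set vs" "u \<in> F" by blast
  then obtain i where i: "i < k" "u = vs ! i" by (metis in_set_conv_nth)
  show ?thesis
  proof (cases "set vs \<inter> F = {u}")
    case True
    with hull \<open>q \<in> F\<close> have "q = u" by simp
    with i show ?thesis by auto
  next
    case False
    with u obtain w where w: "w \<in> set vs" "w \<in> F" "w \<noteq> u" by blast
    have two: "v = u \<or> v = w" if "v \<in> set vs" "v \<in> F" for v
    proof (rule ccontr)
      assume "\<not> ?thesis"
      with planar_third_between[OF assms(2), of v u w] that u w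
      have "v \<in> open_segment u w \<or> u \<in> open_segment v w \<or> w \<in> open_segment v u"
        by (auto simp: F_def)
      with vertex_not_between that u w vertex_in show False by blast
    qed
    have "set vs \<inter> F = {u, w}" using two u w by blast
    with hull \<open>q \<in> F\<close> have q: "q \<in> closed_segment u w" by (simp add: segment_convex_hull)
    define j where "j = (if i = 0 then k - 1 else i - 1)"
    have j: "j < k" "nv j = u" using i k3 by (auto simp: j_def next_vertex_def)
    have neq: "nv i \<noteq> u" "vs ! j \<noteq> u" "nv i \<noteq> vs ! j"
    proof -
      have "Suc i mod k < k" "Suc i mod k \<noteq> i" "j \<noteq> i" "Suc i mod k \<noteq> j"
        using i k3 by (auto simp: j_def mod_Suc)
      then show "nv i \<noteq> u" "vs ! j \<noteq> u" "nv i \<noteq> vs ! j"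
        using i j dist_vs by (simp_all add: next_vertex_def nth_eq_iff_index_eq)
    qed
    have "w = nv i \<or> w = vs ! j"
    proof (rule ccontr)
      assume nadj: "\<not> ?thesis"
      obtain \<alpha>1 where \<alpha>1: "\<alpha>1 \<bullet> (nv i - u) = 0"
        "\<And>v. v \<in> set vs \<Longrightarrow> v \<noteq> u \<Longrightarrow> v \<noteq> nv i \<Longrightarrow> \<alpha>1 \<bullet> (v - u) < 0"
        using edge_support[OF i(1)] i(2) by metis
      obtain \<alpha>2 where \<alpha>2: "\<alpha>2 \<bullet> (u - vs ! j) = 0"
        "\<And>v. v \<in> set vs \<Longrightarrow> v \<noteq> vs ! j \<Longrightarrow> v \<noteq> u \<Longrightarrow> \<alpha>2 \<bullet> (v - vs ! j) < 0"
        using edge_support[OF j(1)] j(2) by metis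
      then have \<alpha>2': "\<alpha>2 \<bullet> (vs ! j - u) = 0"
        "\<And>v. v \<in> set vs \<Longrightarrow> v \<noteq> vs ! j \<Longrightarrow> v \<noteq> u \<Longrightarrow> \<alpha>2 \<bullet> (v - u) < 0"
        by (simp_all add: inner_diff_right)
      have \<alpha>3: "\<alpha> \<bullet> (w - u) = 0" using u w by (simp add: F_def inner_diff_right)
      have \<alpha>3': "\<alpha> \<bullet> (v - u) < 0" if "v \<in> set vs" "v \<noteq> u" "v \<noteq> w" for v
      proof -
        have "v \<notin> F" using two that by blast
        with sup[of v] vertex_in[OF that(1)] u show ?thesis
          by (auto simp: F_def inner_diff_right less_le)
      qed
      show False
        using planar_no_three_edges[of \<alpha>1 "nv i - u" "vs ! j - u" "w - u" \<alpha>2 \<alpha>] \<alpha>1 \<alpha>2' \<alpha>3 \<alpha>3' nadj neq i j w nv_in[OF i(1)]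
          nth_mem[OF j(1)] by metis
    qed
    with q i j show ?thesis by (metis closed_segment_commute)
  qed
qed

section \<open>Vertical sections and crossings of edges with columns\<close>

definition xl :: real where "xl = Min (fst ` set vs)"
definition xu :: real where "xu = Max (fst ` set vs)"
definition yl :: real where "yl = Min (snd ` set vs)"
definition yu :: real where "yu = Max (snd ` set vs)"

definition lower :: "real \<Rightarrow> real" where "lower x = Inf {y. (x, y) \<in> P}"
definition upper :: "real \<Rightarrow> real" where "upper x = Sup {y. (x, y) \<in> P}"

definition spans :: "nat \<Rightarrow> real \<Rightarrow> bool" where
  "spans r x \<longleftrightarrow> min (fst (vs ! r)) (fst (nv r)) \<le> x \<and> x \<le> max (fst (vs ! r)) (fst (nv r))"

text \<open>
  Only the first endpoint of a vertical edge is recorded; the other one is the first endpoint of the next edge.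
\<close>

definition cross :: "nat \<Rightarrow> real \<Rightarrow> real" where
  "cross r x = (if fst (vs ! r) \<noteq> fst (nv r)
     then snd (vs ! r) + (x - fst (vs ! r)) * (snd (nv r) - snd (vs ! r)) / (fst (nv r) - fst (vs ! r))
     else snd (vs ! r))"

lemma vs_nonempty: "set vs \<noteq> {}"
  using k3 by auto

lemma vertex_bounds:
  assumes "v \<in> set vs"
  shows "xl \<le> fst v" "fst v \<le> xu" "yl \<le> snd v" "snd v \<le> yu"
  using assms by (simp_all add: xl_def xu_def yl_def yu_def)

lemma P_bounds:
  assumes "(x, y) \<in> P"
  shows "xl \<le> x" "x \<le> xu" "yl \<le> y" "y \<le> yu"
proof -
  have "P \<subseteq> {xl..xu} \<times> {yl..yu}"
    unfolding filled_polygon_def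
  proof (rule hull_minimal)
    show "set vs \<subseteq> {xl..xu} \<times> {yl..yu}" using vertex_bounds by (force simp: mem_Times_iff)
  qed (intro convex_Times convex_real_interval)
  with assms show "xl \<le> x" "x \<le> xu" "yl \<le> y" "y \<le> yu" by auto
qed

lemma section_nonempty:
  assumes "xl \<le> x" "x \<le> xu"
  shows "\<exists>y. (x, y) \<in> P"
proof -
  have "xl \<in> fst ` set vs" "xu \<in> fst ` set vs"
    unfolding xl_def xu_def using vs_nonempty by (auto intro!: Min_in Max_in)
  then have "xl \<in> fst ` P" "xu \<in> fst ` P" using vertex_in by auto
  moreover have "convex (fst ` P)" by (intro convex_linear_image linear_fst convex_P)
  ultimately have "x \<in> fst ` P"
    using assms by (meson convex_contains_segment closed_segment_eq_real_ivl1 atLeastAtMost_iff order_trans subsetD is_interval_convex_1 mem_is_interval_1_I)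
  then show ?thesis by auto
qed

lemma compact_section: "compact {y. (x, y) \<in> P}"
proof -
  have "compact (P \<inter> {x} \<times> UNIV)"
    by (intro compact_Int_closed compact_P closed_Times) auto
  then have "compact (snd ` (P \<inter> {x} \<times> UNIV))"
    by (intro compact_continuous_image continuous_on_snd continuous_on_id)
  also have "snd ` (P \<inter> {x} \<times> UNIV) = {y. (x, y) \<in> P}" by force
  finally show ?thesis .
qed

lemma lower_in: "xl \<le> x \<Longrightarrow> x \<le> xu \<Longrightarrow> (x, lower x) \<in> P"
  and upper_in: "xl \<le> x \<Longrightarrow> x \<le> xu \<Longrightarrow> (x, upper x) \<in> P"
  using closed_contains_Inf[of "{y. (x, y) \<in> P}"] closed_contains_Sup[of "{y. (x, y) \<in> P}"] section_nonempty[of x]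
    compact_section[of x]
  by (auto simp: lower_def upper_def compact_eq_bounded_closed bounded_imp_bdd_below bounded_imp_bdd_above)

lemma lower_le: "(x, y) \<in> P \<Longrightarrow> lower x \<le> y"
  and le_upper: "(x, y) \<in> P \<Longrightarrow> y \<le> upper x"
  unfolding lower_def upper_def using compact_section[of x]
  by (auto simp: compact_eq_bounded_closed intro!: cInf_lower cSup_upper bounded_imp_bdd_below bounded_imp_bdd_above)

lemma mem_P_iff: "(x, y) \<in> P \<longleftrightarrow> xl \<le> x \<and> x \<le> xu \<and> lower x \<le> y \<and> y \<le> upper x"
proof
  assume r: "xl \<le> x \<and> x \<le> xu \<and> lower x \<le> y \<and> y \<le> upper x"
  have "(x, y) \<in> closed_segment (x, lower x) (x, upper x)"
  proof (cases "lower x = upper x")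
    case False
    define t where "t = (y - lower x) / (upper x - lower x)"
    have "t * (upper x - lower x) = y - lower x" using False by (simp add: t_def)
    moreover have "0 \<le> t" "t \<le> 1" using r False by (simp_all add: t_def field_simps)
    ultimately show ?thesis by (auto simp: in_segment algebra_simps intro!: exI[of _ t])
  qed (use r in auto)
  then show "(x, y) \<in> P"
    using r lower_in upper_in convex_P by (meson convex_contains_segment subsetD)
qed (use P_bounds lower_le le_upper in auto)

lemma cross_on_segment:
  assumes "spans r x"
  shows "(x, cross r x) \<in> closed_segment (vs ! r) (nv r)"
proof (cases "fst (vs ! r) = fst (nv r)")
  case True
  with assms have "(x, cross r x) = vs ! r" by (auto simp: spans_def cross_def prod_eq_iff)
  then show ?thesis by simp
next
  case False
  obtain a b c d where p: "vs ! r = (a, b)" "nv r = (c, d)" by force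
  define t where "t = (x - a) / (c - a)"
  have ac: "a \<noteq> c" using False by (simp add: p)
  have "t * (c - a) = x - a" using ac by (simp add: t_def)
  moreover have "cross r x = b + t * (d - b)" using ac by (simp add: cross_def p t_def)
  moreover have "0 \<le> t" "t \<le> 1" using assms ac
    by (auto simp: t_def spans_def p min_def max_def divide_simps split: if_splits)
  ultimately show ?thesis by (auto simp: in_segment p algebra_simps intro!: exI[of _ t])
qed

lemma cross_in: "r < k \<Longrightarrow> spans r x \<Longrightarrow> (x, cross r x) \<in> P"
  using cross_on_segment[of r x] vertex_in[of "vs ! r"] vertex_in[OF nv_in, of r] convex_P
  by (metis convex_contains_segment nth_mem subsetD)

lemma edge_point_cross:
  assumes "r < k" "(x, y) \<in> closed_segment (vs ! r) (nv r)"
  shows "spans r x" "fst (vs ! r) \<noteq> fst (nv r) \<Longrightarrow> cross r x = y"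
    "fst (vs ! r) = fst (nv r) \<Longrightarrow> (x = fst (vs ! r)) \<and> (min (snd (vs ! r)) (snd (nv r)) \<le> y \<and> y \<le> max (snd (vs ! r)) (snd (nv r)))"
proof -
  obtain a b c d where p: "vs ! r = (a, b)" "nv r = (c, d)" by force
  obtain t where t: "0 \<le> t" "t \<le> 1" "x = (1 - t) * a + t * c" "y = (1 - t) * b + t * d"
    using assms(2) by (auto simp: in_segment p)
  have conv: "min e f \<le> (1 - t) * e + t * f \<and> (1 - t) * e + t * f \<le> max e f" for e f :: real
    using t(1,2) convex_bound_le[of e "max e f" f "1 - t" t] convex_bound_le[of "- e" "- min e f" "- f" "1 - t" t]
    by (simp add: algebra_simps)
  show "spans r x" using conv[of a c] by (simp add: spans_def p t(3))
  show "cross r x = y" if "fst (vs ! r) \<noteq> fst (nv r)"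
  proof -
    have "x - a = t * (c - a)" by (simp add: t(3) algebra_simps)
    then have "(x - a) * (d - b) / (c - a) = t * (d - b)" using that by (simp add: p)
    then show ?thesis using that by (simp add: cross_def p t(4) algebra_simps)
  qed
  show "(x = fst (vs ! r)) \<and> (min (snd (vs ! r)) (snd (nv r)) \<le> y \<and> y \<le> max (snd (vs ! r)) (snd (nv r)))"
    if "fst (vs ! r) = fst (nv r)"
    using that conv[of b d] by (simp add: p t(3,4) algebra_simps)
qed

lemma vertex_cross: "spans r (fst (vs ! r))" "cross r (fst (vs ! r)) = snd (vs ! r)"
  by (simp_all add: spans_def cross_def)

text \<open>The direction \<open>d\<close> is negative for the lower and positive for the upper boundary.\<close>

lemma extremal_cross:
  assumes "(x, y) \<in> P" and out: "\<And>t. 0 < t \<Longrightarrow> (x, y + t * d) \<notin> P" and "d \<noteq> 0"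
  shows "\<exists>r<k. spans r x \<and> cross r x = y"
proof -
  obtain \<alpha> where "\<alpha> \<noteq> 0" "\<And>z. z \<in> P \<Longrightarrow> \<alpha> \<bullet> z \<le> \<alpha> \<bullet> (x, y)"
    using supporting_hyperplane_ray[OF convex_P assms(1), of "(0, d)"] out by auto
  with supported_point_on_edge[OF assms(1)] obtain r where
    r: "r < k" "(x, y) \<in> closed_segment (vs ! r) (nv r)" by blast
  show ?thesis
  proof (cases "fst (vs ! r) = fst (nv r)")
    case False
    with edge_point_cross[OF r] r show ?thesis by blast
  next
    case True
    note e = edge_point_cross(3)[OF r True]
    have nvr: "nv r = vs ! (Suc r mod k)" "Suc r mod k < k" 
      unfolding next_vertex_def using k3 mod_less_divisor[of k "Suc r"] by (simp, linarith)
    have *: "(x, snd (vs ! r)) \<in> P" "(x, snd (nv r)) \<in> P"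
      using e True vertex_in[OF nth_mem[OF r(1)]] vertex_in[OF nv_in[OF r(1)]]
      by (cases "vs ! r"; cases "nv r"; simp)+
    \<comment> \<open>A point strictly inside a vertical edge has points of the edge above and below
      it, so it is not extremal in a vertical direction.\<close>
    have "y = snd (vs ! r) \<or> y = snd (nv r)"
    proof (rule ccontr)
      assume ne: "\<not> ?thesis"
      have no: "(z - y) / d \<le> 0" if "(x, z) \<in> P" for z
        using out[of "(z - y) / d"] that assms(3) by force
      from no[OF *(1)] no[OF *(2)] ne e assms(3) show False
        by (auto simp: divide_le_0_iff min_def max_def split: if_splits)
    qed
    then show ?thesis
    proof
      assume "y = snd (vs ! r)"
      with r e vertex_cross[of r] show ?thesis by auto
    next
      assume "y = snd (nv r)"
      with nvr e True vertex_cross[of "Suc r mod k"] show ?thesis by auto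
    qed
  qed
qed

lemma lower_cross: "xl \<le> x \<Longrightarrow> x \<le> xu \<Longrightarrow> \<exists>r<k. spans r x \<and> cross r x = lower x"
  by (rule extremal_cross[where d = "-1"]) (auto dest: lower_le intro: lower_in)

lemma upper_cross: "xl \<le> x \<Longrightarrow> x \<le> xu \<Longrightarrow> \<exists>r<k. spans r x \<and> cross r x = upper x"
  by (rule extremal_cross[where d = 1]) (auto dest: le_upper intro: upper_in)

text \<open>A chord between boundary points over \<open>x\<close> and \<open>z\<close> stays in
  \<open>P\<close>, and over \<open>y\<close> it lies between the heights of its ends. This
  consequence of convexity is the useful one because, unlike convexity, it survives rounding to
  integers.\<close>

lemma section_quasiconvex:
  assumes "xl \<le> x" "x \<le> y" "y \<le> z" "z \<le> xu"
  shows "lower y \<le> max (lower x) (lower z)" "min (upper x) (upper z) \<le> upper y"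
proof -
  obtain t where t: "0 \<le> t" "t \<le> 1" "y = (1 - t) * x + t * z"
  proof (cases "x = z")
    case False
    define t where "t = (y - x) / (z - x)"
    have "t * (z - x) = y - x" using False by (simp add: t_def)
    then have "y = (1 - t) * x + t * z" by (simp add: algebra_simps)
    moreover have "0 \<le> t" "t \<le> 1" using assms False by (simp_all add: t_def field_simps)
    ultimately show ?thesis by (rule that[rotated 2])
  qed (use that[of 0] assms in simp)
  have *: "(y, (1 - t) * u + t * v) \<in> P" if "(x, u) \<in> P" "(z, v) \<in> P" for u v
  proof -
    have "(1 - t) *\<^sub>R (x, u) + t *\<^sub>R (z, v) \<in> P"
      using convexD[OF convex_P that, of "1 - t" t] t by simp
    then show ?thesis by (simp add: t(3))
  qed
  have conv: "min e f \<le> (1 - t) * e + t * f \<and> (1 - t) * e + t * f \<le> max e f" for e f :: real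
    using t(1,2) convex_bound_le[of e "max e f" f "1 - t" t] convex_bound_le[of "- e" "- min e f" "- f" "1 - t" t]
    by (simp add: algebra_simps)
  show "lower y \<le> max (lower x) (lower z)"
    using lower_le[OF *[OF lower_in lower_in]] conv[of "lower x" "lower z"] assms by simp
  show "min (upper x) (upper z) \<le> upper y"
    using le_upper[OF *[OF upper_in upper_in]] conv[of "upper x" "upper z"] assms by simp
qed

section \<open>Extent and edge widths against the perimeter\<close>

lemma dist_le_perimeter:
  assumes "u \<in> set vs" "v \<in> set vs"
  shows "dist u v \<le> perimeter vs"
proof -
  have path: "dist (vs ! i) (vs ! j) \<le> perimeter vs" if "i \<le> j" "j < k" for i j
  proof -
    have "dist (vs ! i) (vs ! j) \<le> (\<Sum>r\<in>{i..<j}. dist (vs ! r) (vs ! Suc r))" using that(1)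
    proof (induction j rule: dec_induct)
      case (step j)
      then show ?case using dist_triangle[of "vs ! i" "vs ! Suc j" "vs ! j"] by simp
    qed simp
    also have "\<dots> = (\<Sum>r\<in>{i..<j}. dist (vs ! r) (nv r))"
      using that by (intro sum.cong) (auto simp: next_vertex_def)
    also have "\<dots> \<le> perimeter vs"
      unfolding perimeter_def using that by (intro sum_mono2) auto
    finally show ?thesis .
  qed
  obtain i j where "u = vs ! i" "v = vs ! j" "i < k" "j < k" using assms by (metis in_set_conv_nth)
  then show ?thesis using path[of i j] path[of j i] by (cases "i \<le> j") (auto simp: dist_commute)
qed

lemma width_le: "xu - xl \<le> perimeter vs" and height_le: "yu - yl \<le> perimeter vs"
proof -
  have "xl \<in> fst ` set vs" "xu \<in> fst ` set vs" "yl \<in> snd ` set vs" "yu \<in> snd ` set vs"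
    unfolding xl_def xu_def yl_def yu_def using vs_nonempty by (auto intro!: Min_in Max_in)
  then obtain u v u' v' where *: "u \<in> set vs" "v \<in> set vs" "xl = fst u" "xu = fst v"
     "u' \<in> set vs" "v' \<in> set vs" "yl = snd u'" "yu = snd v'" by blast
  show "xu - xl \<le> perimeter vs"
    using dist_le_perimeter[OF *(2,1)] dist_fst_le[of v u] * by (simp add: dist_real_def)
  show "yu - yl \<le> perimeter vs"
    using dist_le_perimeter[OF *(6,5)] dist_snd_le[of v' u'] * by (simp add: dist_real_def)
qed

text \<open>An edge of horizontal width \<open>w\<close> meets at most \<open>w + 1\<close> integer
  columns, so this bounds the rasterising work beyond the constant overhead per edge.\<close>

lemma edge_widths_le: "(\<Sum>r<k. \<bar>fst (nv r) - fst (vs ! r)\<bar>) \<le> perimeter vs"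
  unfolding perimeter_def
  by (rule sum_mono) (metis dist_commute dist_fst_le dist_real_def)

end

text \<open>Left of a minimum at \<open>c\<close> the values do not increase, right of it they do
  not decrease, so on either side the variation telescopes.\<close>

lemma quasiconvex_variation:
  fixes f :: "int \<Rightarrow> int"
  assumes "i0 \<le> i1" and bnd: "\<And>i. i \<in> {i0..i1} \<Longrightarrow> A \<le> f i \<and> f i \<le> A'"
    and qc: "\<And>x y z. i0 \<le> x \<Longrightarrow> x \<le> y \<Longrightarrow> y \<le> z \<Longrightarrow> z \<le> i1 \<Longrightarrow> f y \<le> max (f x) (f z)"
  shows "(\<Sum>i\<in>{i0..<i1}. \<bar>f (i + 1) - f i\<bar>) \<le> 2 * (A' - A)"
proof -
  have "Min (f ` {i0..i1}) \<in> f ` {i0..i1}" using assms(1) by (intro Min_in) auto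
  then obtain c where c: "c \<in> {i0..i1}" "Min (f ` {i0..i1}) = f c" by auto
  have min: "f c \<le> f i" if "i \<in> {i0..i1}" for i using c(2)[symmetric] that by simp
  have up: "(\<Sum>i\<in>{c..<z}. \<bar>f (i + 1) - f i\<bar>) = f z - f c" if "c \<le> z" "z \<le> i1" for z
    using that
  proof (induction z rule: int_ge_induct)
    case (step z)
    have "f z \<le> f (z + 1)" using qc[of c z "z + 1"] min[of z] min[of "z + 1"] c step by auto
    moreover have "{c..<z + 1} = insert z {c..<z}" using step.hyps by auto
    ultimately show ?case using step by simp
  qed simp
  have down: "(\<Sum>i\<in>{z..<c}. \<bar>f (i + 1) - f i\<bar>) = f z - f c" if "z \<le> c" "i0 \<le> z" for z
    using that
  proof (induction z rule: int_le_induct)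
    case (step z)
    have "f z \<le> f (z - 1)" using qc[of "z - 1" z c] min[of z] min[of "z - 1"] c step by auto
    moreover have "{z - 1..<c} = insert (z - 1) {z..<c}" using step.hyps by auto
    ultimately show ?case using step by simp
  qed simp
  have "{i0..<i1} = {i0..<c} \<union> {c..<i1}" using c by auto
  then have "(\<Sum>i\<in>{i0..<i1}. \<bar>f (i + 1) - f i\<bar>) =
      (\<Sum>i\<in>{i0..<c}. \<bar>f (i + 1) - f i\<bar>) + (\<Sum>i\<in>{c..<i1}. \<bar>f (i + 1) - f i\<bar>)"
    by (simp add: sum.union_disjoint)
  then show ?thesis using up[of i1] down[of i0] c(1) bnd[of i0] bnd[of i1] bnd[of c] assms(1) by auto
qed

section \<open>Rasterising the boundary\<close>

abbreviation rvar :: "name \<Rightarrow> rexp" where "rvar x \<equiv> RLoad x (IConst 0)"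
abbreviation rassign :: "name \<Rightarrow> rexp \<Rightarrow> com" where "rassign x e \<equiv> RStore x (IConst 0) e"
abbreviation rload :: "name \<Rightarrow> name \<Rightarrow> rexp" where "rload x i \<equiv> RLoad x (ivar i)"
abbreviation floor_com :: "name \<Rightarrow> rexp \<Rightarrow> com" where "floor_com x e \<equiv> IFloor x (IConst 0) e"
abbreviation ceil_com :: "name \<Rightarrow> rexp \<Rightarrow> com" where
  "ceil_com x e \<equiv> Seq (IFloor x (IConst 0) (RSub (ROfInt (IConst 0)) e)) (assign x (ISub (IConst 0) (ivar x)))"

definition extent_com :: com where
  "extent_com = While (ILess (ivar ''r'') (ivar ''k''))
    (Seq (IfThen (RLess (rload ''x'' ''r'') (rvar ''xl'')) (rassign ''xl'' (rload ''x'' ''r'')) Skip)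
    (Seq (IfThen (RLess (rvar ''xu'') (rload ''x'' ''r'')) (rassign ''xu'' (rload ''x'' ''r'')) Skip)
    (Seq (IfThen (RLess (rload ''y'' ''r'') (rvar ''yl'')) (rassign ''yl'' (rload ''y'' ''r'')) Skip)
    (Seq (IfThen (RLess (rvar ''yu'') (rload ''y'' ''r'')) (rassign ''yu'' (rload ''y'' ''r'')) Skip)
      (incr ''r'')))))"

text \<open>Merging only ever adds to \<open>c\<close>, whose initial contents are
  arbitrary.\<close>

definition zero_com :: com where
  "zero_com = While (ile (ivar ''s'') (ivar ''e'')) (Seq (EStore ''c'' (ivar ''s'') (EConst 0)) (incr ''s''))"

definition init_com :: com where
  "init_com = While (ile (ivar ''s'') (ivar ''i1''))
    (Seq (IFloor ''L'' (ivar ''s'') (RAdd (rvar ''yu'') (ROfInt (IConst 1))))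
    (Seq (IFloor ''U'' (ivar ''s'') (RSub (rvar ''yl'') (ROfInt (IConst 1)))) (incr ''s'')))"

definition edge_com :: com where
  "edge_com = While (ile (ivar ''s'') (ivar ''e''))
    (Seq (rassign ''z'' (rload ''y'' ''r''))
    (Seq (IfThen (BNot (BAnd (BNot (RLess (rload ''x'' ''r'') (rload ''x'' ''q'')))
                             (BNot (RLess (rload ''x'' ''q'') (rload ''x'' ''r'')))))
           (rassign ''z'' (RAdd (rload ''y'' ''r'')
              (RDiv (RMul (RSub (ROfInt (ivar ''s'')) (rload ''x'' ''r'')) (RSub (rload ''y'' ''q'') (rload ''y'' ''r'')))
                    (RSub (rload ''x'' ''q'') (rload ''x'' ''r''))))) Skip)
    (Seq (ceil_com ''w'' (rvar ''z''))
    (Seq (IfThen (ILess (ivar ''w'') (ILoad ''L'' (ivar ''s''))) (IStore ''L'' (ivar ''s'') (ivar ''w'')) Skip)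
    (Seq (floor_com ''w'' (rvar ''z''))
    (Seq (IfThen (ILess (ILoad ''U'' (ivar ''s'')) (ivar ''w'')) (IStore ''U'' (ivar ''s'') (ivar ''w'')) Skip)
      (incr ''s'')))))))"

definition edges_com :: com where
  "edges_com = While (ILess (ivar ''r'') (ivar ''k''))
    (Seq (assign ''q'' (IAdd (ivar ''r'') (IConst 1)))
    (Seq (IfThen (ile (ivar ''k'') (ivar ''q'')) (assign ''q'' (IConst 0)) Skip)
    (Seq (rassign ''u'' (rload ''x'' ''r'')) (Seq (rassign ''v'' (rload ''x'' ''q''))
    (Seq (IfThen (RLess (rload ''x'' ''q'') (rload ''x'' ''r'')) (rassign ''u'' (rload ''x'' ''q'')) Skip)
    (Seq (IfThen (RLess (rload ''x'' ''q'') (rload ''x'' ''r'')) (rassign ''v'' (rload ''x'' ''r'')) Skip)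
    (Seq (ceil_com ''s'' (rvar ''u'')) (Seq (floor_com ''e'' (rvar ''v'')) (Seq edge_com (incr ''r''))))))))))"

definition scan_com :: com where
  "scan_com = Seq (rassign ''xl'' (RLoad ''x'' (IConst 0))) (Seq (rassign ''xu'' (RLoad ''x'' (IConst 0)))
    (Seq (rassign ''yl'' (RLoad ''y'' (IConst 0))) (Seq (rassign ''yu'' (RLoad ''y'' (IConst 0)))
    (Seq (assign ''r'' (IConst 1)) (Seq extent_com
    (Seq (floor_com ''s'' (RAdd (rvar ''xl'') (rvar ''yl''))) (Seq (floor_com ''e'' (RAdd (rvar ''xu'') (rvar ''yu'')))
    (Seq zero_com
    (Seq (ceil_com ''i0'' (rvar ''xl'')) (Seq (floor_com ''i1'' (rvar ''xu''))
    (Seq (assign ''s'' (ivar ''i0'')) (Seq init_com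
    (Seq (assign ''r'' (IConst 0)) edges_com)))))))))))))"

lemma extent_mod [simp]: "wmod extent_com = {''r''}" "rmod extent_com = {''xl'', ''xu'', ''yl'', ''yu''}" "emod extent_com = {}"
  by (auto simp: extent_com_def)

lemma zero_mod [simp]: "wmod zero_com = {''s''}" "rmod zero_com = {}" "emod zero_com = {''c''}"
  by (auto simp: zero_com_def)

lemma init_mod [simp]: "wmod init_com = {''L'', ''U'', ''s''}" "rmod init_com = {}" "emod init_com = {}"
  by (auto simp: init_com_def)

lemma edge_mod [simp]: "wmod edge_com = {''L'', ''U'', ''s'', ''w''}" "rmod edge_com = {''z''}" "emod edge_com = {}"
  by (auto simp: edge_com_def)

lemma edges_mod [simp]: "wmod edges_com = {''L'', ''U'', ''s'', ''w'', ''q'', ''r'', ''e''}"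
    "rmod edges_com = {''z'', ''u'', ''v''}" "emod edges_com = {}"
  by (auto simp: edges_com_def)

lemma scan_mod [simp]: "wmod scan_com = {''L'', ''U'', ''s'', ''w'', ''q'', ''r'', ''e'', ''i0'', ''i1''}"
    "emod scan_com = {''c''}"
  by (auto simp: scan_com_def)

text \<open>Coordinates are at most \<open>N / 4 - 2\<close> in absolute value. This keeps sums of
  two coordinates, their roundings and the start values just outside the extent within the scale
  \<open>N\<close>.\<close>

locale scan = polygon +
  fixes B :: real and T :: "nat \<Rightarrow> nat" and N :: int
  assumes B: "of_int (16 * N) \<le> B" and N: "int k \<le> N"
    and coords: "\<And>v. v \<in> set vs \<Longrightarrow> 4 * \<bar>fst v\<bar> + 8 \<le> of_int N \<and> 4 * \<bar>snd v\<bar> + 8 \<le> of_int N"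
begin

definition i0 :: int where "i0 = \<lceil>xl\<rceil>"
definition i1 :: int where "i1 = \<lfloor>xu\<rfloor>"
definition lo :: "int \<Rightarrow> int" where "lo i = \<lceil>lower (of_int i)\<rceil>"
definition hi :: "int \<Rightarrow> int" where "hi i = \<lfloor>upper (of_int i)\<rfloor>"

lemma fits_N: "- 16 * N \<le> i \<Longrightarrow> i \<le> 16 * N \<Longrightarrow> fits B i"
  using B unfolding fits_def by linarith

lemma extent:
  "4 * \<bar>xl\<bar> + 8 \<le> of_int N" "4 * \<bar>xu\<bar> + 8 \<le> of_int N" "4 * \<bar>yl\<bar> + 8 \<le> of_int N" "4 * \<bar>yu\<bar> + 8 \<le> of_int N"
proof -
  have "xl \<in> fst ` set vs" "xu \<in> fst ` set vs" "yl \<in> snd ` set vs" "yu \<in> snd ` set vs"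
    unfolding xl_def xu_def yl_def yu_def using vs_nonempty by (auto intro!: Min_in Max_in)
  then show "4 * \<bar>xl\<bar> + 8 \<le> of_int N" "4 * \<bar>xu\<bar> + 8 \<le> of_int N" "4 * \<bar>yl\<bar> + 8 \<le> of_int N" "4 * \<bar>yu\<bar> + 8 \<le> of_int N"
    using coords by auto
qed

lemma xl_le_xu: "xl \<le> xu" and yl_le_yu: "yl \<le> yu"
  using vertex_bounds[OF nth_mem[of 0 vs]] k3 by (simp_all, linarith+)

lemma N8: "8 \<le> N"
  using extent(1) by linarith

lemma fits_real: "4 * \<bar>x :: real\<bar> \<le> of_int N + 8 \<Longrightarrow> fits B \<lfloor>x\<rfloor> \<and> fits B \<lceil>x\<rceil>"
  using N8 by (intro conjI fits_N) linarith+

definition polygon_input :: "'a state \<Rightarrow> bool" where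
  "polygon_input \<sigma> \<longleftrightarrow> words \<sigma> (''k'', 0) = int k \<and>
    (\<forall>r<k. reals \<sigma> (''x'', int r) = fst (vs ! r) \<and> reals \<sigma> (''y'', int r) = snd (vs ! r))"

lemma set_vs_image: "f ` set vs = (\<lambda>r. f (vs ! r)) ` {..k - 1}"
proof -
  have "{..k - 1} = {..<k}" using k3 by auto
  then show ?thesis by (auto simp: set_conv_nth)
qed

lemma if_less_min: "(if a < b then a else b) = min a b" and if_less_max: "(if b < a then a else b) = max a b"
  for a b :: "'b::linorder"
  by auto

lemma run_extent:
  fixes \<sigma> :: "'a::comm_ring_1 state"
  assumes inp: "polygon_input \<sigma>" and "words \<sigma> (''r'', 0) = 1"
    "reals \<sigma> (''xl'', 0) = fst (vs ! 0)" "reals \<sigma> (''xu'', 0) = fst (vs ! 0)"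
    "reals \<sigma> (''yl'', 0) = snd (vs ! 0)" "reals \<sigma> (''yu'', 0) = snd (vs ! 0)"
  shows "runs B T extent_com \<sigma> (1 + 10 * real k) (\<lambda>\<tau>. reals \<tau> (''xl'', 0) = xl \<and> reals \<tau> (''xu'', 0) = xu \<and>
     reals \<tau> (''yl'', 0) = yl \<and> reals \<tau> (''yu'', 0) = yu)"
proof -
  let ?x = "\<lambda>r. fst (vs ! r)" and ?y = "\<lambda>r. snd (vs ! r)"
  \<comment> \<open>Vertex 0 is read before the loop, so \<open>r\<close> iterations cover the
    vertices \<open>0..r\<close>.\<close>
  let ?I = "\<lambda>r \<tau>. words \<tau> (''r'', 0) = 1 + int r \<and>
     reals \<tau> (''xl'', 0) = Min (?x ` {..r}) \<and> reals \<tau> (''xu'', 0) = Max (?x ` {..r}) \<and>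
     reals \<tau> (''yl'', 0) = Min (?y ` {..r}) \<and> reals \<tau> (''yu'', 0) = Max (?y ` {..r})"
  have k: "words \<sigma> (''k'', 0) = int k" using inp by (simp add: polygon_input_def)
  have "runs B T extent_com \<sigma> (1 + (\<Sum>r<k - 1. 1 + 9)) (?I (k - 1))"
    unfolding extent_com_def
  proof (rule runs_for, goal_cases)
    case 1
    then show ?case using assms by simp
  next
    case (2 r \<tau>)
    note fr = 2(3)[folded extent_com_def]
    note [simp] = frame_words[OF fr] frame_reals[OF fr]
    have r: "Suc r < k" using 2(1) by linarith
    have [simp]: "fits B 0" "fits B 1" "fits B (int k)" "fits B (1 + int r)" "fits B (2 + int r)"
      using N N8 r by (intro fits_N; linarith)+
    have xy: "reals \<sigma> (''x'', 1 + int r) = fst (vs ! Suc r)" "reals \<sigma> (''y'', 1 + int r) = snd (vs ! Suc r)"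
      using inp r unfolding polygon_input_def by (metis of_nat_Suc add.commute)+
    show ?case using 2(2) r
      by (simp add: runs_def k xy atMost_Suc if_less_min if_less_max del: wp_IfThen Min_gr_iff Max_less_iff split del: if_split cong: if_cong)
  next
    case (3 \<tau>)
    note fr = 3(2)[folded extent_com_def]
    have [simp]: "fits B 0" "fits B 1" "fits B (int k)" "fits B (1 + int (k - 1))"
      using N N8 by (intro fits_N; linarith)+
    show ?case using 3(1) k3 by (simp add: frame_words[OF fr] k)
  qed
  then show ?thesis
    by (rule runs_weaken) (use k3 in \<open>auto simp: xl_def xu_def yl_def yu_def set_vs_image\<close>)
qed

lemma run_zero:
  fixes \<sigma> :: "'a::comm_ring_1 state"
  assumes "words \<sigma> (''s'', 0) = s" "words \<sigma> (''e'', 0) = e" and bnd: "- N \<le> s" "e \<le> N" "s \<le> e + 1"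
  shows "runs B T zero_com \<sigma> (1 + 3 * (of_int e - of_int s + 1)) (\<lambda>\<tau>. \<forall>i\<in>{s..e}. elems \<tau> (''c'', i) = 0)"
proof -
  let ?I = "\<lambda>r \<tau>. words \<tau> (''s'', 0) = s + int r \<and> (\<forall>i\<in>{s..<s + int r}. elems \<tau> (''c'', i) = 0)"
  have "runs B T zero_com \<sigma> (1 + (\<Sum>r<nat (e - s + 1). 1 + 2)) (?I (nat (e - s + 1)))"
    unfolding zero_com_def
  proof (rule runs_for, goal_cases)
    case (2 r \<tau>)
    note fr = 2(3)[folded zero_com_def]
    have r: "s + int r \<le> e" using 2(1) by linarith
    have [simp]: "fits B 0" "fits B 1" "fits B e" "fits B (s + int r)" "fits B (s + int r + 1)"
      using N8 r bnd by (intro fits_N; linarith)+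
    show ?case using 2(2) r by (auto simp: runs_def assms frame_words[OF fr])
  next
    case (3 \<tau>)
    note fr = 3(2)[folded zero_com_def]
    have [simp]: "fits B 0" "fits B e" "fits B (e + 1)"
      using N8 bnd by (intro fits_N; linarith)+
    show ?case using 3(1) bnd by (simp add: assms frame_words[OF fr])
  qed (use assms in auto)
  then show ?thesis
    by (rule runs_weaken) (use bnd in auto)
qed

lemma run_init:
  fixes \<sigma> :: "'a::comm_ring_1 state"
  assumes "words \<sigma> (''s'', 0) = i0" "words \<sigma> (''i1'', 0) = i1"
    "reals \<sigma> (''yl'', 0) = yl" "reals \<sigma> (''yu'', 0) = yu"
  shows "runs B T init_com \<sigma> (1 + 4 * (perimeter vs + 1))
    (\<lambda>\<tau>. \<forall>i\<in>{i0..i1}. words \<tau> (''L'', i) = \<lfloor>yu\<rfloor> + 1 \<and> words \<tau> (''U'', i) = \<lfloor>yl\<rfloor> - 1)"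
proof -
  let ?I = "\<lambda>r \<tau>. words \<tau> (''s'', 0) = i0 + int r \<and>
    (\<forall>i\<in>{i0..<i0 + int r}. words \<tau> (''L'', i) = \<lfloor>yu\<rfloor> + 1 \<and> words \<tau> (''U'', i) = \<lfloor>yl\<rfloor> - 1)"
  \<comment> \<open>\<open>i0 = i1 + 1\<close> occurs when no integer lies between \<open>xl\<close>
    and \<open>xu\<close>; then there is no column.\<close>
  have bnd: "- N \<le> i0" "i0 \<le> N" "- N \<le> i1" "i1 \<le> N" "i0 \<le> i1 + 1"
    using extent xl_le_xu unfolding i0_def i1_def by linarith+
  have "4 * \<bar>yu + 1\<bar> \<le> of_int N + 8" "4 * \<bar>yl - 1\<bar> \<le> of_int N + 8"
    using extent abs_triangle_ineq[of yu 1] abs_triangle_ineq4[of yl 1] by simp_all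
  from this[THEN fits_real] have F: "fits B (\<lfloor>yu\<rfloor> + 1)" "fits B (\<lfloor>yl\<rfloor> - 1)" by simp_all
  have "runs B T init_com \<sigma> (1 + (\<Sum>r<nat (i1 - i0 + 1). 1 + 3)) (?I (nat (i1 - i0 + 1)))"
    unfolding init_com_def
  proof (rule runs_for, goal_cases)
    case (2 r \<tau>)
    note fr = 2(3)[folded init_com_def]
    have r: "i0 + int r \<le> i1" using 2(1) by linarith
    have [simp]: "fits B 0" "fits B 1" "fits B i1" "fits B (i0 + int r)" "fits B (i0 + int r + 1)"
      using N8 r bnd by (intro fits_N; linarith)+
    show ?case using 2(2) r F by (auto simp: runs_def assms frame_words[OF fr] frame_reals[OF fr])
  next
    case (3 \<tau>)
    note fr = 3(2)[folded init_com_def]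
    have [simp]: "fits B 0" "fits B i1" "fits B (i1 + 1)"
      using N8 bnd by (intro fits_N; linarith)+
    show ?case using 3(1) bnd by (simp add: assms frame_words[OF fr])
  qed (use assms in auto)
  then show ?thesis
  proof (rule runs_weaken)
    have "real_of_int (i1 - i0) \<le> xu - xl" unfolding i0_def i1_def by linarith
    then show "1 + (\<Sum>r<nat (i1 - i0 + 1). 1 + 3) \<le> 1 + 4 * (perimeter vs + 1)"
      using width_le bnd(5) by simp
  qed (use bnd in auto)
qed

text \<open>Row bounds of column \<open>i\<close> known after the first \<open>r\<close> edges. The
  start value is at or above every rounded crossing, and that of \<open>acc_hi\<close> at or below,
  so both are neutral for \<open>min\<close> and \<open>max\<close>.\<close>

primrec acc_lo :: "nat \<Rightarrow> int \<Rightarrow> int" where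
  "acc_lo 0 i = \<lfloor>yu\<rfloor> + 1"
| "acc_lo (Suc r) i = (if spans r (of_int i) then min (acc_lo r i) \<lceil>cross r (of_int i)\<rceil> else acc_lo r i)"

primrec acc_hi :: "nat \<Rightarrow> int \<Rightarrow> int" where
  "acc_hi 0 i = \<lfloor>yl\<rfloor> - 1"
| "acc_hi (Suc r) i = (if spans r (of_int i) then max (acc_hi r i) \<lfloor>cross r (of_int i)\<rfloor> else acc_hi r i)"

lemma int_in_extent: "i \<in> {i0..i1} \<longleftrightarrow> xl \<le> of_int i \<and> of_int i \<le> xu"
  unfolding i0_def i1_def by (simp add: ceiling_le_iff le_floor_iff)

lemma spans_iff: "spans r (of_int i) \<longleftrightarrow>
    \<lceil>min (fst (vs ! r)) (fst (nv r))\<rceil> \<le> i \<and> i \<le> \<lfloor>max (fst (vs ! r)) (fst (nv r))\<rfloor>"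
  unfolding spans_def by (simp only: ceiling_le_iff le_floor_iff)

lemma spans_in: "r < k \<Longrightarrow> spans r (of_int i) \<Longrightarrow> i \<in> {i0..i1}"
  unfolding int_in_extent using P_bounds(1,2)[OF cross_in] by blast

lemma acc_bounds:
  assumes "i \<in> {i0..i1}" "r \<le> k"
  shows "lo i \<le> acc_lo r i" "acc_lo r i \<le> \<lfloor>yu\<rfloor> + 1" "acc_hi r i \<le> hi i" "\<lfloor>yl\<rfloor> - 1 \<le> acc_hi r i"
proof -
  note x = assms(1)[unfolded int_in_extent]
  have init: "lo i \<le> \<lfloor>yu\<rfloor> + 1" "\<lfloor>yl\<rfloor> - 1 \<le> hi i"
    using P_bounds(4)[OF lower_in, of "of_int i"] P_bounds(3)[OF upper_in, of "of_int i"] x unfolding lo_def hi_def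
    by linarith+
  have *: "lo i \<le> acc_lo r i \<and> acc_lo r i \<le> \<lfloor>yu\<rfloor> + 1 \<and> acc_hi r i \<le> hi i \<and> \<lfloor>yl\<rfloor> - 1 \<le> acc_hi r i"
    using assms(2)
  proof (induction r)
    case (Suc r)
    have "lo i \<le> \<lceil>cross r (of_int i)\<rceil>" "\<lfloor>cross r (of_int i)\<rfloor> \<le> hi i" if "spans r (of_int i)"
      using lower_le[OF cross_in] le_upper[OF cross_in] Suc.prems that
      by (auto simp: lo_def hi_def intro!: ceiling_mono floor_mono)
    with Suc show ?case by auto
  qed (use init in simp)
  then show "lo i \<le> acc_lo r i" "acc_lo r i \<le> \<lfloor>yu\<rfloor> + 1" "acc_hi r i \<le> hi i" "\<lfloor>yl\<rfloor> - 1 \<le> acc_hi r i"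
    by blast+
qed

lemma acc_le_cross:
  "q < r \<Longrightarrow> spans q (of_int i) \<Longrightarrow> acc_lo r i \<le> \<lceil>cross q (of_int i)\<rceil> \<and> \<lfloor>cross q (of_int i)\<rfloor> \<le> acc_hi r i"
  by (induction r) (auto simp: less_Suc_eq)

text \<open>Crossings are points of \<open>P\<close>, so the accumulated bounds never pass the true
  ones. Equality holds as some edge attains the lower boundary and some edge the upper boundary of
  the section.\<close>

lemma acc_final:
  assumes "i \<in> {i0..i1}"
  shows "acc_lo k i = lo i" "acc_hi k i = hi i"
proof -
  note x = assms[unfolded int_in_extent]
  obtain q where q: "q < k" "spans q (of_int i)" "cross q (of_int i) = lower (of_int i)" using lower_cross x by blast
  show "acc_lo k i = lo i" using acc_le_cross[OF q(1,2)] acc_bounds(1)[OF assms order.refl] by (simp add: q(3) lo_def)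
  obtain q where q: "q < k" "spans q (of_int i)" "cross q (of_int i) = upper (of_int i)" using upper_cross x by blast
  show "acc_hi k i = hi i" using acc_le_cross[OF q(1,2)] acc_bounds(3)[OF assms order.refl] by (simp add: q(3) hi_def)
qed

text \<open>Programs compare reals only by strict inequality, so distinctness of the abscissae
  appears as a disjunction.\<close>

lemma cross_if:
  "(if fst (vs ! r) < fst (nv r) \<or> fst (nv r) < fst (vs ! r)
    then snd (vs ! r) + (x - fst (vs ! r)) * (snd (nv r) - snd (vs ! r)) / (fst (nv r) - fst (vs ! r))
    else snd (vs ! r)) = cross r x"
  by (auto simp: cross_def)

text \<open>A column costs one test and 11 units for the body, and an edge has at most its width
  plus one of them. Spanned columns lie in \<open>{i0..i1}\<close>, so the cells read have been
  initialised.\<close>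

lemma run_edge:
  fixes \<sigma> :: "'a::comm_ring_1 state"
  assumes inp: "polygon_input \<sigma>" and r: "r < k" and st: "words \<sigma> (''r'', 0) = int r" "words \<sigma> (''q'', 0) = int (Suc r mod k)"
    "words \<sigma> (''s'', 0) = \<lceil>min (fst (vs ! r)) (fst (nv r))\<rceil>" "words \<sigma> (''e'', 0) = \<lfloor>max (fst (vs ! r)) (fst (nv r))\<rfloor>"
    and LU: "\<And>i. i \<in> {i0..i1} \<Longrightarrow> words \<sigma> (''L'', i) = acc_lo r i \<and> words \<sigma> (''U'', i) = acc_hi r i"
  shows "runs B T edge_com \<sigma> (1 + 12 * (\<bar>fst (nv r) - fst (vs ! r)\<bar> + 1))
    (\<lambda>\<tau>. \<forall>i\<in>{i0..i1}. words \<tau> (''L'', i) = acc_lo (Suc r) i \<and> words \<tau> (''U'', i) = acc_hi (Suc r) i)"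
proof -
  define s e where "s = \<lceil>min (fst (vs ! r)) (fst (nv r))\<rceil>" and "e = \<lfloor>max (fst (vs ! r)) (fst (nv r))\<rfloor>"
  note st' = st[folded s_def e_def]
  have q: "Suc r mod k < k" "vs ! (Suc r mod k) = nv r"
    using k3 mod_less_divisor[of k "Suc r"] by (linarith, simp add: next_vertex_def)
  have xy: "reals \<sigma> (''x'', int r) = fst (vs ! r)" "reals \<sigma> (''y'', int r) = snd (vs ! r)"
     "reals \<sigma> (''x'', int (Suc r mod k)) = fst (nv r)" "reals \<sigma> (''y'', int (Suc r mod k)) = snd (nv r)"
    using inp r q unfolding polygon_input_def by auto
  have bnd: "- N \<le> s" "e \<le> N" "s \<le> e + 1" "- N \<le> e"
    using coords[OF nth_mem[OF r]] coords[OF nv_in[OF r]] unfolding s_def e_def by linarith+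
  let ?I = "\<lambda>c \<tau>. words \<tau> (''s'', 0) = s + int c \<and> (\<forall>i\<in>{i0..i1}.
     words \<tau> (''L'', i) = (if s \<le> i \<and> i < s + int c then acc_lo (Suc r) i else acc_lo r i) \<and>
     words \<tau> (''U'', i) = (if s \<le> i \<and> i < s + int c then acc_hi (Suc r) i else acc_hi r i))"
  have "runs B T edge_com \<sigma> (1 + (\<Sum>c<nat (e - s + 1). 1 + 11)) (?I (nat (e - s + 1)))"
    unfolding edge_com_def
  proof (rule runs_for, goal_cases)
    case 1
    show ?case using LU by (simp add: st')
  next
    case (2 c \<tau>)
    note fr = 2(3)[folded edge_com_def]
    note [simp] = frame_words[OF fr] frame_reals[OF fr]
    define i where "i = s + int c"
    have i: "s \<le> i" "i \<le> e" using 2(1) unfolding i_def by linarith+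
    then have sp: "spans r (of_int i)" unfolding spans_iff s_def e_def by simp
    have mem: "i \<in> {i0..i1}" using spans_in[OF r sp] .
    let ?c = "cross r (of_int i)"
    have "yl \<le> ?c" "?c \<le> yu" using P_bounds(3,4)[OF cross_in[OF r sp]] .
    then have "4 * \<bar>?c\<bar> \<le> of_int N + 8" "4 * \<bar>- ?c\<bar> \<le> of_int N + 8" using extent by linarith+
    from this[THEN fits_real] have [simp]: "fits B \<lfloor>?c\<rfloor>" "fits B \<lceil>?c\<rceil>" "fits B (- \<lceil>?c\<rceil>)"
      by (simp_all add: floor_minus)
    have acc: "words \<tau> (''L'', i) = acc_lo r i" "words \<tau> (''U'', i) = acc_hi r i"
      using 2(2) mem by (simp_all add: i_def)
    have acc': "- N \<le> acc_lo r i" "acc_lo r i \<le> N" "- N \<le> acc_hi r i" "acc_hi r i \<le> N"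
    proof -
      have "yl \<le> lower (of_int i)" "upper (of_int i) \<le> yu"
        using P_bounds(3)[OF lower_in] P_bounds(4)[OF upper_in] mem unfolding int_in_extent by blast+
      then have "\<lceil>yl\<rceil> \<le> lo i" "hi i \<le> \<lfloor>yu\<rfloor>" unfolding lo_def hi_def by (intro ceiling_mono floor_mono; simp)+
      with acc_bounds[OF mem, of r] r extent show "- N \<le> acc_lo r i" "acc_lo r i \<le> N" "- N \<le> acc_hi r i" "acc_hi r i \<le> N"
        by linarith+
    qed
    have [simp]: "fits B 0" "fits B 1" "fits B e" "fits B i" "fits B (i + 1)" "fits B (int r)" "fits B (int (Suc r mod k))"
      "fits B (acc_lo r i)" "fits B (acc_hi r i)"
      using N8 N r q(1) i bnd acc' by (intro fits_N; linarith)+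
    have s: "words \<tau> (''s'', 0) = i" using 2(2) by (simp add: i_def)
    have old: "words \<tau> (''L'', j) = (if s \<le> j \<and> j < i then acc_lo (Suc r) j else acc_lo r j)"
        "words \<tau> (''U'', j) = (if s \<le> j \<and> j < i then acc_hi (Suc r) j else acc_hi r j)" if "j \<in> {i0..i1}" for j
      using 2(2) that by (auto simp: i_def)
    have i': "s + int (Suc c) = i + 1" by (simp add: i_def)
    have new: "acc_lo (Suc r) i = min \<lceil>?c\<rceil> (acc_lo r i)" "acc_hi (Suc r) i = max \<lfloor>?c\<rfloor> (acc_hi r i)"
      using sp by (simp_all add: min.commute max.commute)
    show ?case
      unfolding i' using i
      apply (simp add: runs_def st' s xy acc cross_if if_less_min if_less_max floor_minus
          del: wp_IfThen acc_lo.simps acc_hi.simps split del: if_split cong: if_cong)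
      apply (auto simp: old new less_le simp del: acc_lo.simps acc_hi.simps)
      done
  next
    case (3 \<tau>)
    note fr = 3(2)[folded edge_com_def]
    note [simp] = frame_words[OF fr]
    have [simp]: "fits B 0" "fits B e" "fits B (e + 1)"
      using N8 bnd by (intro fits_N; linarith)+
    show ?case using 3(1) bnd by (simp add: st')
  qed
  then show ?thesis
  proof (rule runs_weaken, goal_cases)
    case 1
    have "real_of_int (e - s) \<le> \<bar>fst (nv r) - fst (vs ! r)\<bar>" unfolding s_def e_def by linarith
    then show ?case using bnd(3) by simp
  next
    case (2 \<tau>)
    have "int (nat (e - s + 1)) = e - s + 1" using bnd(3) by simp
    \<comment> \<open>Integer columns outside \<open>s..e\<close> are not spanned, so their
      accumulated bounds stay as they are.\<close>
    then show ?case using 2(1) by (auto simp: spans_iff s_def[symmetric] e_def[symmetric])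
  qed
qed

lemma run_edges:
  fixes \<sigma> :: "'a::comm_ring_1 state"
  assumes inp: "polygon_input \<sigma>" and st: "words \<sigma> (''r'', 0) = 0"
    and LU: "\<And>i. i \<in> {i0..i1} \<Longrightarrow> words \<sigma> (''L'', i) = \<lfloor>yu\<rfloor> + 1 \<and> words \<sigma> (''U'', i) = \<lfloor>yl\<rfloor> - 1"
  shows "runs B T edges_com \<sigma> (1 + 27 * real k + 12 * perimeter vs)
    (\<lambda>\<tau>. \<forall>i\<in>{i0..i1}. words \<tau> (''L'', i) = lo i \<and> words \<tau> (''U'', i) = hi i)"
proof -
  let ?d = "\<lambda>r. \<bar>fst (nv r) - fst (vs ! r)\<bar>"
  let ?I = "\<lambda>r \<tau>. words \<tau> (''r'', 0) = int r \<and>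
    (\<forall>i\<in>{i0..i1}. words \<tau> (''L'', i) = acc_lo r i \<and> words \<tau> (''U'', i) = acc_hi r i)"
  have k: "words \<sigma> (''k'', 0) = int k" using inp by (simp add: polygon_input_def)
  \<comment> \<open>Of the 26 units, 13 are spent on setting up the edge and advancing
    \<open>r\<close>, and 13 are the constant part of \<open>run_edge\<close>.\<close>
  have "runs B T edges_com \<sigma> (1 + (\<Sum>r<k. 1 + (26 + 12 * ?d r))) (?I k)"
    unfolding edges_com_def
  proof (rule runs_for, goal_cases)
    case 1
    show ?case using LU by (simp add: st)
  next
    case (2 r \<tau>)
    note fr = 2(3)[folded edges_com_def]
    note [simp] = frame_words[OF fr] frame_reals[OF fr]
    note r = 2(1)
    have q: "Suc r mod k < k" "vs ! (Suc r mod k) = nv r"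
      using k3 mod_less_divisor[of k "Suc r"] by (linarith, simp add: next_vertex_def)
    have xy: "reals \<sigma> (''x'', int r) = fst (vs ! r)" "reals \<sigma> (''x'', int (Suc r mod k)) = fst (nv r)"
      using inp r q unfolding polygon_input_def by auto
    have if_q: "(if int k \<le> int r + 1 then 0 else int r + 1) = int (Suc r mod k)"
      using r by (cases "Suc r = k") auto
    let ?u = "min (fst (nv r)) (fst (vs ! r))" and ?v = "max (fst (vs ! r)) (fst (nv r))"
    have "4 * \<bar>- ?u\<bar> \<le> of_int N + 8" "4 * \<bar>?v\<bar> \<le> of_int N + 8"
      using coords[OF nth_mem[OF r]] coords[OF nv_in[OF r]] unfolding min_def max_def by auto
    from this[THEN fits_real] have [simp]: "fits B \<lfloor>- ?u\<rfloor>" "fits B (- \<lceil>?u\<rceil>)" "fits B \<lceil>?u\<rceil>" "fits B \<lfloor>?v\<rfloor>"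
      by (simp_all add: floor_minus ceiling_minus fits_def)
    have [simp]: "fits B 0" "fits B 1" "fits B (int r)" "fits B (int r + 1)" "fits B (int k)" "fits B (int (Suc r mod k))"
      using N8 N r q(1) by (intro fits_N; linarith)+
    have inp': "polygon_input \<tau>" using inp by (simp add: polygon_input_def)
    show ?case using 2(2) r
      apply (simp add: runs_def k xy if_q not_less if_less_min if_less_max floor_minus
          del: wp_IfThen acc_lo.simps acc_hi.simps of_nat_Suc split del: if_split cong: if_cong)
      apply (rule wp_runs, rule run_edge[where r = r])
      using inp' apply (simp_all add: polygon_input_def min.commute del: acc_lo.simps acc_hi.simps of_nat_Suc)[7]
      subgoal premises e for v \<rho>
      proof -
        note fr' = e(4)
        note [simp] = frame_words[OF fr']
        show ?thesis using e(1-3,5) by (simp del: acc_lo.simps acc_hi.simps)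
      qed
      done
  next
    case (3 \<tau>)
    note fr = 3(2)[folded edges_com_def]
    note [simp] = frame_words[OF fr]
    have [simp]: "fits B 0" "fits B (int k)" using N8 N by (intro fits_N; linarith)+
    show ?case using 3(1) by (simp add: k)
  qed
  then show ?thesis
  proof (rule runs_weaken, goal_cases)
    case 1
    have "(\<Sum>r<k. 1 + (26 + 12 * ?d r)) = 27 * real k + 12 * (\<Sum>r<k. ?d r)"
      by (simp add: sum.distrib sum_distrib_left)
    then show ?case using edge_widths_le by simp
  qed (use acc_final in auto)
qed

lemma run_scan:
  fixes \<sigma> :: "'a::comm_ring_1 state"
  assumes inp: "polygon_input \<sigma>"
  shows "runs B T scan_com \<sigma> (50 * (real k + perimeter vs)) (\<lambda>\<tau>. words \<tau> (''i0'', 0) = i0 \<and> words \<tau> (''i1'', 0) = i1 \<and>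
      (\<forall>i\<in>{i0..i1}. words \<tau> (''L'', i) = lo i \<and> words \<tau> (''U'', i) = hi i) \<and>
      (\<forall>s\<in>sum_range vs. elems \<tau> (''c'', s) = 0))"
proof -
  have x0: "reals \<sigma> (''x'', 0) = fst (vs ! 0)" "reals \<sigma> (''y'', 0) = snd (vs ! 0)"
    using inp k3 unfolding polygon_input_def by (metis of_nat_0 less_le_trans zero_less_numeral)+
  define s e where "s = \<lfloor>xl + yl\<rfloor>" and "e = \<lfloor>xu + yu\<rfloor>"
  have se: "- N \<le> s" "s \<le> N" "- N \<le> e" "e \<le> N" "s \<le> e + 1" "of_int e - of_int s + 1 \<le> 2 * perimeter vs + 2"
    using extent xl_le_xu yl_le_yu width_le height_le unfolding s_def e_def by linarith+
  have "4 * \<bar>- xl\<bar> \<le> of_int N + 8" "4 * \<bar>xu\<bar> \<le> of_int N + 8" using extent by linarith+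
  from this[THEN fits_real] have [simp]: "fits B (- \<lceil>xl\<rceil>)" "fits B \<lceil>xl\<rceil>" "fits B \<lfloor>xu\<rfloor>"
    by (simp_all add: floor_minus fits_def)
  have [simp]: "fits B 0" "fits B 1" "fits B s" "fits B e" using N8 se by (intro fits_N; linarith)+
  show ?thesis
    unfolding runs_def scan_com_def
    apply simp
    apply (rule wp_runs, rule run_extent)
    using inp apply (simp_all add: polygon_input_def x0)[6]
    subgoal premises x for v1 \<tau>1
    proof -
      note [simp] = frame_words[OF x(2)] frame_reals[OF x(2)]
      show ?thesis
        using x(1) apply (simp add: s_def[symmetric] e_def[symmetric])
        apply (rule wp_runs, rule run_zero[where s = s and e = e])
        using se apply simp_all[5]
        subgoal premises z for v2 \<tau>2
        proof -
          note [simp] = frame_words[OF z(3)] frame_reals[OF z(3)]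
          show ?thesis
            using z(1) apply (simp add: floor_minus)
            apply (rule wp_runs, rule run_init)
            apply (simp_all add: i0_def i1_def)[4]
            subgoal premises i for v3 \<tau>3
            proof -
              note [simp] = frame_words[OF i(3)] frame_reals[OF i(3)] frame_elems[OF i(3)]
              show ?thesis
                apply simp
                apply (rule wp_runs, rule run_edges)
                using inp x0 i(2) apply (simp_all add: polygon_input_def)[3]
                subgoal premises d for v4 \<tau>4
                proof -
                  note [simp] = frame_words[OF d(2)] frame_elems[OF d(2)]
                  \<comment> \<open>\<open>k\<close> absorbs the additive constants of all
                    phases.\<close>
                  have "3 \<le> real k" using k3 by simp
                  then have "0 \<le> v4"
                    using d(3) i(4) z(4) x(3) se(6) width_le xl_le_xu by simp
                  moreover have "elems \<tau>4 (''c'', i) = 0" if "i \<in> sum_range vs" for i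
                  proof -
                    have "xl + yl \<le> of_int i" "of_int i \<le> xu + yu"
                      using that by (simp_all add: sum_range_def xl_def xu_def yl_def yu_def)
                    then have "i \<in> {s..e}" unfolding s_def e_def atLeastAtMost_iff by linarith
                    then show ?thesis using z(2) by simp
                  qed
                  ultimately show ?thesis using d(1) by (simp add: i0_def i1_def)
                qed
                done
            qed
            done
        qed
        done
    qed
    done
qed

end

section \<open>Assembling the algorithm\<close>

text \<open>For \<open>p \<le> 2\<close> the left side is at most \<open>3 * 36\<close>, which
  \<open>k\<close> alone covers. For \<open>p > 2\<close> one has \<open>1 / 2 \<le> ln p\<close>,
  so \<open>1 + ln (2 * p + 2) \<le> 3 + ln p \<le> 7 * ln p\<close>, and
  \<open>1 \<le> ln k\<close> because \<open>k\<close> exceeds Euler's number.\<close>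

lemma perimeter_log_bound:
  fixes p k :: real
  assumes "0 \<le> p" "3 \<le> k"
  shows "(p + 1) * (1 + ln (2 * p + 2))\<^sup>2 \<le> 110 * (k + p * (ln p)\<^sup>2 * ln k)"
proof (cases "p \<le> 2")
  case True
  have "ln (2 * p + 2) \<le> 5" using ln_le_minus_one[of "2 * p + 2"] assms True by simp
  moreover have "0 \<le> ln (2 * p + 2)" using assms by simp
  ultimately have "(1 + ln (2 * p + 2))\<^sup>2 \<le> 6\<^sup>2" by (intro power_mono) auto
  then have "(p + 1) * (1 + ln (2 * p + 2))\<^sup>2 \<le> 3 * 36" using assms True by (intro mult_mono) auto
  moreover have "0 \<le> p * (ln p)\<^sup>2 * ln k" using assms by simp
  ultimately show ?thesis using assms unfolding distrib_left by linarith
next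
  case False
  then have p: "2 < p" by simp
  have "ln 2 \<le> ln p" using p by simp
  with ln2_ge_two_thirds have l2: "1 / 2 \<le> ln p" by linarith
  have "ln (2 * p + 2) \<le> ln (3 * p)" using p by simp
  also have "\<dots> = ln 3 + ln p" using p by (simp add: ln_mult)
  also have "ln 3 \<le> (2::real)" using ln_le_minus_one[of "3::real"] by simp
  finally have "1 + ln (2 * p + 2) \<le> 7 * ln p" using l2 by linarith
  moreover have "0 \<le> ln (2 * p + 2)" using p by simp
  ultimately have "(1 + ln (2 * p + 2))\<^sup>2 \<le> (7 * ln p)\<^sup>2" by (intro power_mono) auto
  also have "\<dots> = 49 * (ln p)\<^sup>2" by (simp add: power_mult_distrib)
  finally have "(p + 1) * (1 + ln (2 * p + 2))\<^sup>2 \<le> (2 * p) * (49 * (ln p)\<^sup>2)"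
    using p by (intro mult_mono) auto
  also have "\<dots> \<le> 110 * (p * (ln p)\<^sup>2 * 1)" using p by (simp add: mult_right_mono)
  also have "1 \<le> ln k" using exp_le assms(2) by (simp add: ln_ge_iff order_trans)
  then have "110 * (p * (ln p)\<^sup>2 * 1) \<le> 110 * (p * (ln p)\<^sup>2 * ln k)"
    using p by (intro mult_left_mono) auto
  finally show ?thesis using assms by (simp add: distrib_left)
qed

text \<open>The finitely many lengths not covered by the asymptotic bound go into the constant
  \<open>S\<close>. Adding 1 to the logarithm is necessary because \<open>ln 1 = 0\<close> while
  \<open>T 1\<close> may be positive.\<close>

lemma superlinear_bound:
  fixes T :: "nat \<Rightarrow> nat"
  assumes "(\<lambda>m. real (T m)) \<in> O(\<lambda>m. real m * ln (real m))"
  obtains K where "0 \<le> K" "\<And>m. 1 \<le> m \<Longrightarrow> real (T m) \<le> K * (real m * (1 + ln (real m)))"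
proof -
  from assms obtain c where c: "0 < c" "\<forall>\<^sub>F m in sequentially. norm (real (T m)) \<le> c * norm (real m * ln (real m))"
    by (rule landau_o.bigE)
  then obtain M where M: "\<And>m. M \<le> m \<Longrightarrow> real (T m) \<le> c * \<bar>real m * ln (real m)\<bar>"
    by (auto simp: eventually_sequentially)
  define S where "S = (\<Sum>m<M. real (T m))"
  have S: "0 \<le> S" by (simp add: S_def sum_nonneg)
  have "real (T m) \<le> (c + S) * (real m * (1 + ln (real m)))" if m: "1 \<le> m" for m
  proof -
    have ln: "0 \<le> ln (real m)" using m by simp
    then have 1: "1 * 1 \<le> real m * (1 + ln (real m))" using m by (intro mult_mono) auto
    show ?thesis
    proof (cases "M \<le> m")
      case True
      have "real (T m) \<le> c * (real m * ln (real m))" using M[OF True] ln by simp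
      also have "\<dots> \<le> (c + S) * (real m * (1 + ln (real m)))"
        using c S ln by (intro mult_mono) auto
      finally show ?thesis .
    next
      case False
      then have "real (T m) \<le> S * 1" using member_le_sum[of m "{..<M}" "\<lambda>m. real (T m)"] by (simp add: S_def)
      also have "\<dots> \<le> (c + S) * (real m * (1 + ln (real m)))" using c S 1 by (intro mult_mono) auto
      finally show ?thesis .
    qed
  qed
  then show ?thesis using that[of "c + S"] c S by simp
qed

text \<open>Take the least exponent whose power reaches \<open>w\<close>; by minimality half of that
  power is below \<open>w\<close>. The factor 2 in the last bound comes from
  \<open>ln 2 \<ge> 1 / 2\<close>.\<close>

lemma obtain_levels:
  fixes w :: int
  assumes "1 \<le> w"
  obtains H where "2 ^ H \<le> 2 * w" "w - 1 < 2 ^ H" "\<And>h. h < H \<Longrightarrow> 2 ^ h \<le> w - 1"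
    "1 + real H \<le> 2 * (1 + ln (2 * of_int w))"
proof -
  define H where "H = (LEAST H. w - 1 < 2 ^ H)"
  have "w - 1 < 2 ^ nat w" using assms of_nat_less_two_power[of "nat w", where 'a = int] by simp
  then have H: "w - 1 < 2 ^ H" unfolding H_def by (rule LeastI)
  have less: "2 ^ h \<le> w - 1" if "h < H" for h
    using not_less_Least[of h "\<lambda>H. w - 1 < 2 ^ H"] that by (simp add: H_def)
  have le: "2 ^ H \<le> 2 * w"
  proof (cases H)
    case (Suc h)
    then show ?thesis using less[of h] by simp
  qed (use assms in simp)
  then have "real_of_int (2 ^ H) \<le> real_of_int (2 * w)" by (simp only: of_int_le_iff)
  then have "(2::real) ^ H \<le> 2 * of_int w" by simp
  then have "ln ((2::real) ^ H) \<le> ln (2 * of_int w)" using assms by (subst ln_le_cancel_iff) auto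
  then have "real H * ln 2 \<le> ln (2 * of_int w)" by (simp add: ln_realpow)
  moreover have "real H * (1 / 2) \<le> real H * ln 2" using ln2_ge_two_thirds by (intro mult_left_mono) auto
  ultimately have "1 + real H \<le> 2 * (1 + ln (2 * of_int w))" by (simp add: algebra_simps)
  with le H less that show ?thesis by blast
qed

text \<open>If the polygon meets no integer column, all sums are zero and have already been written
  by \<open>scan_com\<close>.\<close>

definition polygon_sums_com :: com where
  "polygon_sums_com = Seq scan_com (IfThen (ile (ivar ''i0'') (ivar ''i1'')) tree_com Skip)"

context scan
begin

lemma i_bounds: "- N \<le> i0" "i0 \<le> N" "- N \<le> i1" "i1 \<le> N" "i1 - i0 < N" "of_int (i1 - i0 + 1) \<le> perimeter vs + 1"
  using extent xl_le_xu width_le unfolding i0_def i1_def by linarith+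

lemma lo_hi_bounds:
  assumes "i \<in> {i0..i1}"
  shows "\<lceil>yl\<rceil> \<le> lo i" "lo i \<le> \<lfloor>yu\<rfloor> + 1" "\<lfloor>yl\<rfloor> - 1 \<le> hi i" "hi i \<le> \<lfloor>yu\<rfloor>"
proof -
  have "yl \<le> lower (of_int i)" "upper (of_int i) \<le> yu"
    using P_bounds(3)[OF lower_in] P_bounds(4)[OF upper_in] assms unfolding int_in_extent by blast+
  then show "\<lceil>yl\<rceil> \<le> lo i" "hi i \<le> \<lfloor>yu\<rfloor>" unfolding lo_def hi_def by (intro ceiling_mono floor_mono; simp)+
  show "lo i \<le> \<lfloor>yu\<rfloor> + 1" "\<lfloor>yl\<rfloor> - 1 \<le> hi i" using acc_bounds[OF assms, of k] acc_final[OF assms] by simp_all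
qed

lemma lattice_point_iff: "(of_int i, of_int j) \<in> P \<longleftrightarrow> i \<in> {i0..i1} \<and> lo i \<le> j \<and> j \<le> hi i"
  unfolding mem_P_iff int_in_extent lo_def hi_def by (simp add: ceiling_le_iff le_floor_iff)

lemma section_height:
  assumes "i \<in> {i0..i1}"
  shows "hi i - lo i \<le> \<lfloor>perimeter vs\<rfloor>"
proof -
  have "yl \<le> lower (of_int i)" "upper (of_int i) \<le> yu"
    using P_bounds(3)[OF lower_in] P_bounds(4)[OF upper_in] assms unfolding int_in_extent by blast+
  then show ?thesis using height_le unfolding lo_def hi_def by linarith
qed

text \<open>Rounding is monotone and hence preserves quasiconvexity. \<open>hi\<close> is treated
  through \<open>- hi\<close>, and rounding widens the range of rows by at most 2.\<close>

lemma variation_bounds: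
  assumes "i0 \<le> i1"
  shows "of_int (\<Sum>i\<in>{i0..<i1}. \<bar>lo (i + 1) - lo i\<bar>) \<le> 2 * (perimeter vs + 2)"
    "of_int (\<Sum>i\<in>{i0..<i1}. \<bar>hi (i + 1) - hi i\<bar>) \<le> 2 * (perimeter vs + 2)"
proof -
  have dbl: "of_int x \<le> 2 * u" if "x \<le> 2 * y" "of_int y \<le> u" for x y :: int and u :: real
    using that by linarith
  have q: "lo y \<le> max (lo x) (lo z)" "min (hi x) (hi z) \<le> hi y" if "i0 \<le> x" "x \<le> y" "y \<le> z" "z \<le> i1" for x y z
  proof -
    have "xl \<le> of_int x" "real_of_int x \<le> of_int y" "real_of_int y \<le> of_int z" "of_int z \<le> xu"
      using that int_in_extent[of x] int_in_extent[of z] by simp_all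
    note * = section_quasiconvex[OF this]
    show "lo y \<le> max (lo x) (lo z)" using ceiling_mono[OF *(1)] unfolding lo_def max_def by (auto split: if_splits)
    show "min (hi x) (hi z) \<le> hi y" using floor_mono[OF *(2)] unfolding hi_def min_def by (auto split: if_splits)
  qed
  have "(\<Sum>i\<in>{i0..<i1}. \<bar>lo (i + 1) - lo i\<bar>) \<le> 2 * (\<lfloor>yu\<rfloor> + 1 - \<lceil>yl\<rceil>)"
    by (rule quasiconvex_variation[OF assms]) (use lo_hi_bounds in simp, rule q(1))
  moreover have "of_int (\<lfloor>yu\<rfloor> + 1 - \<lceil>yl\<rceil>) \<le> perimeter vs + 2" using height_le by linarith
  ultimately show "of_int (\<Sum>i\<in>{i0..<i1}. \<bar>lo (i + 1) - lo i\<bar>) \<le> 2 * (perimeter vs + 2)" by (rule dbl)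
  have "(\<Sum>i\<in>{i0..<i1}. \<bar>- hi (i + 1) - - hi i\<bar>) \<le> 2 * (- (\<lfloor>yl\<rfloor> - 1) - - \<lfloor>yu\<rfloor>)"
  proof (rule quasiconvex_variation[OF assms])
    show "- \<lfloor>yu\<rfloor> \<le> - hi i \<and> - hi i \<le> - (\<lfloor>yl\<rfloor> - 1)" if "i \<in> {i0..i1}" for i
      using lo_hi_bounds[OF that] by simp
    show "- hi y \<le> max (- hi x) (- hi z)" if "i0 \<le> x" "x \<le> y" "y \<le> z" "z \<le> i1" for x y z
      using q(2)[OF that] by linarith
  qed
  moreover have "\<bar>- hi (i + 1) - - hi i\<bar> = \<bar>hi (i + 1) - hi i\<bar>" for i by simp
  ultimately have "(\<Sum>i\<in>{i0..<i1}. \<bar>hi (i + 1) - hi i\<bar>) \<le> 2 * (- (\<lfloor>yl\<rfloor> - 1) - - \<lfloor>yu\<rfloor>)" by simp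
  moreover have "of_int (- (\<lfloor>yl\<rfloor> - 1) - - \<lfloor>yu\<rfloor>) \<le> perimeter vs + 2" using height_le by linarith
  ultimately show "of_int (\<Sum>i\<in>{i0..<i1}. \<bar>hi (i + 1) - hi i\<bar>) \<le> 2 * (perimeter vs + 2)" by (rule dbl)
qed

lemma partial_sum_columns:
  fixes a b :: "nat \<Rightarrow> 'a::comm_ring_1"
  shows "partial_sum n a b P s = (\<Sum>i\<in>{i0..i1}. if lo i \<le> s - i \<and> s - i \<le> hi i then entry n a i * entry n b (s - i) else 0)"
proof -
  have "partial_sum n a b P s = (\<Sum>i\<in>{i\<in>{i0..i1}. lo i \<le> s - i \<and> s - i \<le> hi i}. entry n a i * entry n b (s - i))"
    unfolding partial_sum_def
    by (rule sum.reindex_bij_witness[of _ "\<lambda>i. (i, s - i)" fst]) (auto simp: lattice_point_iff)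
  also have "\<dots> = (\<Sum>i\<in>{i0..i1}. if lo i \<le> s - i \<and> s - i \<le> hi i then entry n a i * entry n b (s - i) else 0)"
    by (rule sum.inter_filter) simp
  finally show ?thesis .
qed

lemma run_polygon_sums:
  fixes \<sigma> :: "'a::comm_ring_1 state"
  assumes inp: "holds_input n a b vs \<sigma>" and n: "int n \<le> N"
    and K: "0 \<le> K" "\<And>m. 1 \<le> m \<Longrightarrow> real (T m) \<le> K * (real m * (1 + ln (real m)))"
  shows "runs B T polygon_sums_com \<sigma> (50 * (real k + perimeter vs) + 2 +
      28 * (18 + K) * ((perimeter vs + 1) * (1 + ln (2 * perimeter vs + 2))\<^sup>2)) (holds_output n a b vs)"
proof -
  let ?p = "perimeter vs"
  have p0: "0 \<le> ?p" by (simp add: perimeter_def sum_nonneg)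
  have inp': "polygon_input \<sigma>" using inp by (simp add: holds_input_def polygon_input_def)
  define tree where "tree = 28 * (18 + K) * ((?p + 1) * (1 + ln (2 * ?p + 2))\<^sup>2)"
  have tree0: "0 \<le> tree" using K p0 by (simp add: tree_def)
  have [simp]: "fits B 0" "fits B i0" "fits B i1" using i_bounds N8 by (intro fits_N; linarith)+
  show ?thesis
    unfolding runs_def polygon_sums_com_def tree_def[symmetric]
    apply (simp del: wp_IfThen)
    apply (rule wp_runs, rule run_scan[OF inp'])
    subgoal premises sc for v \<tau>
    proof -
      note fr = sc(2)
      have w: "words \<tau> (''i0'', 0) = i0" "words \<tau> (''i1'', 0) = i1" using sc(1) by auto
      show ?thesis
      proof (cases "i0 \<le> i1")
        case False
        then have "holds_output n a b vs \<tau>"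
          using sc(1) by (simp add: holds_output_def partial_sum_columns)
        then show ?thesis using sc(3) tree0 False by (simp add: w)
      next
        case True
        define w where "w = i1 - i0 + 1"
        \<comment> \<open>Blocks have length at most \<open>2 * w\<close>, so this dominates
          \<open>T m / m\<close>; it carries the second logarithm.\<close>
        define \<kappa> where "\<kappa> = K * (1 + ln (2 * of_int w))"
        have w1: "1 \<le> w" "of_int w \<le> ?p + 1" using True i_bounds(6) by (simp_all add: w_def)
        interpret columns B T N n a b i1 i0 lo hi \<kappa>
        proof
          show "real (T m) \<le> \<kappa> * real m" if m: "1 \<le> m" "int m \<le> 2 * (i1 - i0 + 1)" for m
          proof -
            have "real m \<le> 2 * of_int w" using m(2) unfolding w_def by linarith
            then have "ln (real m) \<le> ln (2 * of_int w)" using m(1) by (subst ln_le_cancel_iff) auto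
            then have "K * (real m * (1 + ln (real m))) \<le> K * (real m * (1 + ln (2 * of_int w)))"
              using K(1) by (intro mult_left_mono) auto
            then show ?thesis using K(2)[OF m(1)] by (simp add: \<kappa>_def mult.assoc mult.commute mult.left_commute)
          qed
          show "- N \<le> lo i \<and> lo i \<le> N" "- N \<le> hi i \<and> hi i \<le> N" if "i \<in> {i0..i1}" for i
            using lo_hi_bounds[OF that] extent by linarith+
        qed (use B N8 n i_bounds True in linarith)+
        obtain H where H: "2 ^ H \<le> 2 * (i1 - i0 + 1)" "i1 - i0 < 2 ^ H" "\<And>h. h < H \<Longrightarrow> 2 ^ h \<le> i1 - i0"
           "1 + real H \<le> 2 * (1 + ln (2 * of_int w))"
          using obtain_levels[OF w1(1)] unfolding w_def by auto
        have cost: "(1 + real H) * ((18 + \<kappa>) * (of_int (variation lo) + of_int (variation hi) + of_int \<lfloor>?p\<rfloor> +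
             6 * of_int (i1 - i0 + 1))) \<le> tree"
        proof -
          define l l' where "l = 1 + ln (2 * real_of_int w)" and "l' = 1 + ln (2 * ?p + 2)"
          have l: "1 \<le> l" "l \<le> l'" using w1 p0 by (auto simp: l_def l'_def)
          have "K \<le> K * l" using K(1) l(1) by (simp add: mult_le_cancel_left1)
          then have "18 + \<kappa> \<le> (18 + K) * l" using l(1) by (simp add: \<kappa>_def l_def[symmetric] distrib_right)
          also have "\<dots> \<le> (18 + K) * l'" using K(1) l by (intro mult_left_mono) auto
          finally have 1: "18 + \<kappa> \<le> (18 + K) * l'" .
          \<comment> \<open>The variations give \<open>4 * ?p + 8\<close>, the height
            \<open>?p\<close> and the columns \<open>6 * ?p + 6\<close>. Together with the factor 2
            in the bound on \<open>1 + real H\<close>, the 14 makes the constant 28.\<close>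
          have 2: "of_int (variation lo) + of_int (variation hi) + of_int \<lfloor>?p\<rfloor> + 6 * real_of_int (i1 - i0 + 1) \<le> 14 * (?p + 1)"
          proof -
            have "6 * real_of_int (i1 - i0 + 1) \<le> 6 * ?p + 6" using i_bounds(6) by simp
            with variation_bounds[OF True] of_int_floor_le[of ?p] p0 show ?thesis
              unfolding variation_def distrib_left by linarith
          qed
          have "0 \<le> real_of_int (variation lo)" "0 \<le> real_of_int (variation hi)" "0 \<le> real_of_int \<lfloor>?p\<rfloor>"
            using p0 by (simp_all add: variation_def sum_nonneg)
          then have S0: "0 \<le> of_int (variation lo) + of_int (variation hi) + of_int \<lfloor>?p\<rfloor> + 6 * real_of_int (i1 - i0 + 1)"
            using True by simp
          have 3: "(18 + \<kappa>) * (of_int (variation lo) + of_int (variation hi) + of_int \<lfloor>?p\<rfloor> + 6 * real_of_int (i1 - i0 + 1))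
              \<le> ((18 + K) * l') * (14 * (?p + 1))"
            by (rule mult_mono[OF 1 2 _ S0]) (use K(1) l in simp)
          have 4: "1 + real H \<le> 2 * l'" using H(4) l by (simp add: l_def)
          have "(1 + real H) * ((18 + \<kappa>) * (of_int (variation lo) + of_int (variation hi) + of_int \<lfloor>?p\<rfloor> +
             6 * real_of_int (i1 - i0 + 1))) \<le> (2 * l') * (((18 + K) * l') * (14 * (?p + 1)))"
            by (rule mult_mono[OF 4 3 _ mult_nonneg_nonneg[OF _ S0]]) (use l \<kappa>_nonneg in simp_all)
          also have "\<dots> = tree" by (simp add: tree_def l'_def power2_eq_square algebra_simps)
          finally show ?thesis .
        qed
        have ready: "ready \<tau>"
          unfolding ready_def
        proof (intro conjI ballI)
          show "words \<tau> (''n'', 0) = int n" using inp frame_words[OF fr] by (simp add: holds_input_def)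
          fix i assume "i \<in> {0..int n}"
          then have i: "nat i \<le> n" "int (nat i) = i" "0 \<le> i" by auto
          have "elems \<sigma> (''a'', int (nat i)) = a (nat i)" "elems \<sigma> (''b'', int (nat i)) = b (nat i)"
            using inp i(1) unfolding holds_input_def by blast+
          then show "elems \<tau> (''a'', i) = entry n a i" "elems \<tau> (''b'', i) = entry n b i"
            using frame_elems[OF fr] i by (simp_all add: entry_def)
        qed (rule w)
        show ?thesis
          using True apply (simp add: w)
          apply (rule wp_runs, rule run_tree[OF ready _ _ H(1-3) section_height])
          using sc(1) p0 apply simp_all[5]
          subgoal premises t for u \<rho>
          proof -
            have "0 \<le> u" using t(4) sc(3) cost by simp
            moreover have "elems \<rho> (''c'', s) = partial_sum n a b P s" if "s \<in> sum_range vs" for s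
              using t(2) sc(1) that by (simp add: partial_sum_columns col_def)
            ultimately show ?thesis by (simp add: holds_output_def)
          qed
          done
      qed
    qed
    done
qed

end

theorem theorem6:
  fixes T :: "nat \<Rightarrow> nat"
  assumes "(\<lambda>m. real (T m)) \<in> O(\<lambda>m. real m * ln (real m))"
  shows "\<exists>(prog :: com) (d :: nat) (C :: real).
    \<forall>(n :: nat) (a :: nat \<Rightarrow> 'a::comm_ring_1) (b :: nat \<Rightarrow> 'a) (vs :: (real \<times> real) list).
      convex_polygon vs \<longrightarrow>
        solves_within d T prog
          (C * (real (length vs) +
                perimeter vs * (ln (perimeter vs))\<^sup>2 * ln (real (length vs))))
          n a b vs"
proof -
  obtain K where K: "0 \<le> K" "\<And>m. 1 \<le> m \<Longrightarrow> real (T m) \<le> K * (real m * (1 + ln (real m)))"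
    using superlinear_bound[OF assms] by blast
  \<comment> \<open>52 pays for \<open>50 * k + 2\<close>; the rest pays for \<open>50 * p\<close>
    and for the tree, both bounded through \<open>p \<le> F \<le> 110 * G\<close> below.\<close>
  define C where "C = 52 + 110 * (50 + 28 * (18 + K))"
  have "solves_within 4 T polygon_sums_com
      (C * (real (length vs) + perimeter vs * (ln (perimeter vs))\<^sup>2 * ln (real (length vs)))) n a b vs"
    if cp: "convex_polygon vs" for n and a b :: "nat \<Rightarrow> 'a" and vs
    unfolding solves_within_def
  proof (intro allI impI)
    fix \<sigma> :: "'a state"
    assume inp: "holds_input n a b vs \<sigma>"
    interpret polygon vs by standard (rule cp)
    define M where "M = magnitude n vs"
    have "vs ! 0 \<in> set vs" using k3 by (intro nth_mem) linarith
    then have "norm (vs ! 0) \<le> Max (norm ` set vs)" by simp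
    then have Max0: "0 \<le> Max (norm ` set vs)" using norm_ge_zero[of "vs ! 0"] by linarith
    have M5: "5 + real n \<le> M" using k3 Max0 by (simp add: M_def magnitude_def)
    \<comment> \<open>The summand 2 in \<open>magnitude\<close> becomes the 8 in the coordinate
      bound of \<open>scan\<close>.\<close>
    define N where "N = \<lceil>4 * M\<rceil>"
    have N: "4 * M \<le> of_int N" "of_int N \<le> 4 * M + 1" unfolding N_def by linarith+
    have n: "int n \<le> N" using N(1) M5 by linarith
    interpret scan vs "M ^ 4" T N
    proof
      \<comment> \<open>The exponent 4 suffices:
        \<open>16 * N \<le> 64 * M + 16 \<le> 125 * M\<close>, and \<open>5 \<le> M\<close> as there
        are at least three vertices.\<close>
      have "5 ^ 3 \<le> M ^ 3" using M5 by (intro power_mono) auto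
      then have "125 * M \<le> M ^ 3 * M" using M5 by (intro mult_right_mono) auto
      also have "\<dots> = M ^ 4" by (simp add: power_numeral_reduce)
      finally show "of_int (16 * N) \<le> M ^ 4" using N(2) M5 by simp
      show "int k \<le> N" using N(1) Max0 by (simp add: M_def magnitude_def)
      fix v assume "v \<in> set vs"
      then have "norm v \<le> Max (norm ` set vs)" by simp
      then have "4 * norm v + 8 \<le> 4 * M" by (simp add: M_def magnitude_def)
      moreover have "\<bar>fst v\<bar> \<le> norm v" "\<bar>snd v\<bar> \<le> norm v" using dist_fst_le[of v 0] dist_snd_le[of v 0] by simp_all
      ultimately show "4 * \<bar>fst v\<bar> + 8 \<le> of_int N \<and> 4 * \<bar>snd v\<bar> + 8 \<le> of_int N" using N(1) by linarith
    qed
    let ?p = "perimeter vs" and ?k = "real (length vs)"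
    define F G where "F = (?p + 1) * (1 + ln (2 * ?p + 2))\<^sup>2" and "G = ?k + ?p * (ln ?p)\<^sup>2 * ln ?k"
    have p0: "0 \<le> ?p" by (simp add: perimeter_def sum_nonneg)
    have "0 \<le> ln (2 * ?p + 2)" using p0 by simp
    then have "1 \<le> (1 + ln (2 * ?p + 2))\<^sup>2" by (intro one_le_power) simp
    then have "?p * 1 \<le> F" unfolding F_def using p0 by (intro mult_mono) auto
    moreover have FG: "F \<le> 110 * G" unfolding F_def G_def
      using p0 k3 by (intro perimeter_log_bound) auto
    moreover have "0 \<le> ?p * (ln ?p)\<^sup>2 * ln ?k" using p0 k3 by simp
    then have kG: "?k \<le> G" by (simp add: G_def)
    moreover have "3 \<le> ?k" using k3 by simp
    moreover define Q where "Q = 28 * (18 + K)"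
    have "Q * F \<le> Q * (110 * G)" using FG K(1) unfolding Q_def by (intro mult_left_mono) auto
    moreover have "C * G = 52 * G + 5500 * G + Q * (110 * G)" by (simp add: C_def Q_def algebra_simps)
    moreover have "50 * (?k + ?p) = 50 * ?k + 50 * ?p" by simp
    ultimately have le: "50 * (?k + ?p) + 2 + 28 * (18 + K) * F \<le> C * G"
      unfolding Q_def[symmetric] by linarith
    have "runs (M ^ 4) T polygon_sums_com \<sigma> (C * G) (holds_output n a b vs)"
      by (rule runs_weaken[OF run_polygon_sums[OF inp n K, folded F_def] le])
    then show "\<exists>t \<tau>. exec (magnitude n vs ^ 4) T polygon_sums_com \<sigma> t \<tau> \<and> holds_output n a b vs \<tau> \<and>
        real t \<le> C * (real (length vs) + perimeter vs * (ln (perimeter vs))\<^sup>2 * ln (real (length vs)))"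
      unfolding runs_exec M_def[symmetric] G_def[symmetric] by auto
  qed
  then show ?thesis by blast
qed

end
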